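(* Let $L\subseteq\{0,1\}^*$ be a language. Then $L\in\mathrm{NP}^{\mathrm{NEXP}}$ if and only if there exist a polynomial $p(n)$ and deterministic polynomial-time computable predicates $R$ and $S$ (ternary relations on strings) such that, for every string $w$, $$w\in L\iff(\exists t\in\Sigma^{\le p(|w|)})\Big((\exists u\in\Sigma^{\le 2^{p(|w|)}})\,R(w,t,u)=1\ \land\ (\forall v\in\Sigma^{\le 2^{p(|w|)}})\,S(w,t,v)=1\Big).$$
   Context: $\Sigma=\{0,1\}$ and $\Sigma^{\le m}$ is the set of binary strings of length at most $m$. $\mathrm{NP}^{\mathrm{NEXP}}$ is the class of languages decided by nondeterministic polynomial-time oracle Turing machines with an oracle for some language in $\mathrm{NEXP}$ (each query costs one step). A predicate is polynomial-time if it is decidable by a deterministic Turing machine in time polynomial in the total length of its arguments. *)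

theory Defs
  imports "HOL-Computational_Algebra.Polynomial"
begin

text \<open>A self-contained model of multi-tape nondeterministic oracle Turing machines.
  Tape symbols are natural numbers below tm_syms: 0 is the blank, 1 encodes the bit False
  (character 0), 2 encodes the bit True (character 1), 3 is a separator used to
  encode tuples of strings. Tape 0 is the input tape, tape 1 is the oracle (query) tape.
  Each step (including an oracle query) costs one time unit.\<close>

record tm =
  tm_states :: nat
  tm_syms   :: nat
  tm_tapes  :: nat
  tm_start  :: nat
  tm_acc    :: nat
  tm_rej    :: nat
  tm_qry    :: nat
  tm_yes    :: nat
  tm_no     :: nat
  tm_delta  :: "(nat \<times> nat list \<times> nat \<times> nat list \<times> int list) set"
    \<comment> \<open>(state, symbols read, next state, symbols written, head moves in {-1,0,1})\<close>

record conf =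
  c_state :: nat
  c_tapes :: "(nat \<Rightarrow> nat) list"
  c_heads :: "nat list"

definition wf_tm :: "tm \<Rightarrow> bool" where
  "wf_tm M \<longleftrightarrow>
     tm_syms M \<ge> 4 \<and> tm_tapes M \<ge> 2 \<and>
     tm_start M < tm_states M \<and> tm_acc M < tm_states M \<and> tm_rej M < tm_states M \<and>
     tm_qry M < tm_states M \<and> tm_yes M < tm_states M \<and> tm_no M < tm_states M \<and>
     distinct [tm_acc M, tm_rej M, tm_qry M] \<and>
     finite (tm_delta M) \<and>
     (\<forall>(q, rd, q', wr, mv) \<in> tm_delta M.
        q < tm_states M \<and> q \<notin> {tm_acc M, tm_rej M, tm_qry M} \<and> q' < tm_states M \<and>
        length rd = tm_tapes M \<and> length wr = tm_tapes M \<and> length mv = tm_tapes M \<and>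
        (\<forall>s \<in> set rd. s < tm_syms M) \<and> (\<forall>s \<in> set wr. s < tm_syms M) \<and>
        (\<forall>m \<in> set mv. m \<in> {-1, 0, 1}))"

definition deterministic_tm :: "tm \<Rightarrow> bool" where
  "deterministic_tm M \<longleftrightarrow>
     (\<forall>(q, rd, q', wr, mv) \<in> tm_delta M. \<forall>(p, rd2, p', wr2, mv2) \<in> tm_delta M.
        q = p \<and> rd = rd2 \<longrightarrow> q' = p' \<and> wr = wr2 \<and> mv = mv2)"

definition enc_bit :: "bool \<Rightarrow> nat" where
  "enc_bit b = (if b then 2 else 1)"

definition enc :: "bool list \<Rightarrow> nat list" where
  "enc x = map enc_bit x"

definition enc3 :: "bool list \<Rightarrow> bool list \<Rightarrow> bool list \<Rightarrow> nat list" where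
  "enc3 w t u = enc w @ [3] @ enc t @ [3] @ enc u"

definition tape_word :: "(nat \<Rightarrow> nat) \<Rightarrow> bool list" where
  "tape_word f = map (\<lambda>i. f i = 2) [0..<(LEAST n. f n \<notin> {1, 2})]"

definition init_conf :: "tm \<Rightarrow> nat list \<Rightarrow> conf" where
  "init_conf M inp =
     \<lparr> c_state = tm_start M,
       c_tapes = (\<lambda>i. if i < length inp then inp ! i else 0) #
                 replicate (tm_tapes M - 1) (\<lambda>_. 0),
       c_heads = replicate (tm_tapes M) 0 \<rparr>"

definition step :: "tm \<Rightarrow> bool list set \<Rightarrow> conf \<Rightarrow> conf \<Rightarrow> bool" where
  "step M Orc c c' \<longleftrightarrow>
     (if c_state c = tm_qry M then
        c' = c\<lparr> c_state := (if tape_word (c_tapes c ! 1) \<in> Orc then tm_yes M else tm_no M) \<rparr>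
      else
        (\<exists>rd q' wr mv. (c_state c, rd, q', wr, mv) \<in> tm_delta M \<and>
           rd = map (\<lambda>i. (c_tapes c ! i) (c_heads c ! i)) [0..<tm_tapes M] \<and>
           c' = \<lparr> c_state = q',
                  c_tapes = map (\<lambda>i. (c_tapes c ! i)((c_heads c ! i) := wr ! i)) [0..<tm_tapes M],
                  c_heads = map (\<lambda>i. nat (int (c_heads c ! i) + mv ! i)) [0..<tm_tapes M] \<rparr>))"

definition accepts :: "tm \<Rightarrow> bool list set \<Rightarrow> nat list \<Rightarrow> bool" where
  "accepts M Orc inp \<longleftrightarrow> (\<exists>n c. (step M Orc ^^ n) (init_conf M inp) c \<and> c_state c = tm_acc M)"

definition time_bounded :: "tm \<Rightarrow> bool list set \<Rightarrow> nat list \<Rightarrow> nat \<Rightarrow> bool" where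
  "time_bounded M Orc inp T \<longleftrightarrow> (\<forall>n c. (step M Orc ^^ n) (init_conf M inp) c \<longrightarrow> n \<le> T)"

text \<open>NEXP: decided by a nondeterministic TM (without oracle, i.e. with the empty oracle,
  whose queries are trivially answered "no") in time 2^(p n) for a polynomial p.\<close>
definition in_NEXP :: "bool list set \<Rightarrow> bool" where
  "in_NEXP A \<longleftrightarrow> (\<exists>M (p :: nat poly). wf_tm M \<and>
     (\<forall>x. time_bounded M {} (enc x) (2 ^ poly p (length x)) \<and>
          (x \<in> A \<longleftrightarrow> accepts M {} (enc x))))"

definition in_NP_NEXP :: "bool list set \<Rightarrow> bool" where
  "in_NP_NEXP L \<longleftrightarrow> (\<exists>A M (p :: nat poly). in_NEXP A \<and> wf_tm M \<and>
     (\<forall>x. time_bounded M A (enc x) (poly p (length x)) \<and>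
          (x \<in> L \<longleftrightarrow> accepts M A (enc x))))"

definition polytime_pred3 :: "(bool list \<Rightarrow> bool list \<Rightarrow> bool list \<Rightarrow> bool) \<Rightarrow> bool" where
  "polytime_pred3 R \<longleftrightarrow> (\<exists>M (p :: nat poly). wf_tm M \<and> deterministic_tm M \<and>
     (\<forall>w t u. time_bounded M {} (enc3 w t u) (poly p (length w + length t + length u)) \<and>
              (R w t u \<longleftrightarrow> accepts M {} (enc3 w t u))))"

end

theory Submission
  imports Defs "HOL-Library.Sublist"
begin

text \<open>From left to right, the string \<open>t\<close> records the nondeterministic choices of the oracle machine together with
  the answers of the oracle, \<open>R\<close> checks with certificates read from \<open>u\<close> that all positive answers are
  correct, and \<open>S\<close> rejects if \<open>v\<close> certifies that some negative answer is wrong. From right to left, an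
  oracle machine guesses \<open>t\<close> and asks one language in NEXP twice: whether there is \<open>u\<close> with \<open>R(w, t, u)\<close>, and
  whether there is \<open>v\<close> with \<open>S(w, t, v)\<close> false; the queries carry \<open>p(|w|)\<close> in unary.

  The machines are compiled from while programs over named tapes. Data tapes carry no end markers: a head
  is rewound by as many left moves as a counter prescribes, since left moves in cell 0 have no effect.\<close>

text \<open>A correct positive answer has a certificate, and so has the falsity of a negative one;
  the correctness of a negative answer has none. Hence one predicate stands under an existential and
  one under a universal quantifier. The certificates are choice strings as long as an exponential
  computation, and \<open>R\<close> and \<open>S\<close> may take time polynomial in the length of
  all their arguments, so replaying such a computation along its certificate is a polynomial-time
  task. As \<open>v\<close> is bounded, a wrong \<open>t\<close> must be refutable by a short
  \<open>v\<close>, and this depends on the length of the queries.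

  In the converse direction the oracle language has to meet its time bound on every word. The unary
  number keeps the witness length \<open>2 ^ m\<close> exponential in the length of any query,
  without reference to \<open>p\<close>.

  Two facts shape the programs: a simulated tape may contain blanks amid its data, so its extent is
  known only through clocks and shadow counters; and time bounds concern all runs, also those that
  get stuck, so reasoning about programs has to record the set of outcomes together with a bound for
  every run.\<close>

type_synonym tape = "(nat \<Rightarrow> nat) \<times> nat"

subsection \<open>Reachability and run length for abstract transition systems\<close>

definition reaches :: "('a \<Rightarrow> 'a \<Rightarrow> bool) \<Rightarrow> ('a \<Rightarrow> bool) \<Rightarrow> 'a \<Rightarrow> bool" where
  "reaches r P c \<longleftrightarrow> (\<exists>n c'. (r ^^ n) c c' \<and> P c')"

definition bounded_runs :: "('a \<Rightarrow> 'a \<Rightarrow> bool) \<Rightarrow> 'a \<Rightarrow> nat \<Rightarrow> bool" where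
  "bounded_runs r c T \<longleftrightarrow> (\<forall>n c'. (r ^^ n) c c' \<longrightarrow> n \<le> T)"

lemma relpowp_Suc_iff: "(r ^^ Suc n) x z \<longleftrightarrow> (\<exists>y. r x y \<and> (r ^^ n) y z)"
  by (meson relpowp_Suc_E2 relpowp_Suc_I2)

lemma reaches_unfold: "reaches r P c \<longleftrightarrow> P c \<or> (\<exists>c'. r c c' \<and> reaches r P c')"
proof
  assume "reaches r P c"
  then obtain n d where d: "(r ^^ n) c d" "P d" unfolding reaches_def by blast
  show "P c \<or> (\<exists>c'. r c c' \<and> reaches r P c')"
  proof (cases n)
    case 0
    then show ?thesis using d by simp
  next
    case (Suc m)
    then show ?thesis using d unfolding Suc relpowp_Suc_iff reaches_def by blast
  qed
next
  assume "P c \<or> (\<exists>c'. r c c' \<and> reaches r P c')"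
  then show "reaches r P c"
  proof
    assume "P c"
    then show ?thesis unfolding reaches_def by (intro exI[of _ 0]) auto
  next
    assume "\<exists>c'. r c c' \<and> reaches r P c'"
    then obtain c' n d where "r c c'" "(r ^^ n) c' d" "P d" unfolding reaches_def by blast
    then show ?thesis unfolding reaches_def
      by (intro exI[of _ "Suc n"] exI[of _ d]) (auto simp: relpowp_Suc_iff simp del: relpowp.simps)
  qed
qed

lemma bounded_runs_Suc: "bounded_runs r c (Suc T) \<longleftrightarrow> (\<forall>c'. r c c' \<longrightarrow> bounded_runs r c' T)"
proof
  assume L: "bounded_runs r c (Suc T)"
  show "\<forall>c'. r c c' \<longrightarrow> bounded_runs r c' T"
    using L unfolding bounded_runs_def by (metis relpowp_Suc_I2 Suc_le_mono)
next
  assume R: "\<forall>c'. r c c' \<longrightarrow> bounded_runs r c' T"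
  show "bounded_runs r c (Suc T)"
    unfolding bounded_runs_def
  proof (intro allI impI)
    fix n c' assume "(r ^^ n) c c'"
    then show "n \<le> Suc T"
      using R unfolding bounded_runs_def by (cases n) (auto simp: relpowp_Suc_iff simp del: relpowp.simps(2))
  qed
qed

lemma bounded_runs_mono: "bounded_runs r c T \<Longrightarrow> T \<le> T' \<Longrightarrow> bounded_runs r c T'"
  unfolding bounded_runs_def using le_trans by blast

lemma bounded_runs_stepE:
  assumes "bounded_runs r c T" "r c c'"
  obtains T' where "T = Suc T'" "bounded_runs r c' T'"
proof (cases T)
  case 0
  have "(r ^^ Suc 0) c c'" using assms(2) by (subst relpowp_Suc_iff) simp
  then show ?thesis using assms(1) 0 unfolding bounded_runs_def by fastforce
next
  case (Suc T')
  then show ?thesis using that assms bounded_runs_Suc by metis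
qed

lemma bounded_runs_stuck: "(\<And>c'. \<not> r c c') \<Longrightarrow> bounded_runs r c T"
proof -
  assume stuck: "\<And>c'. \<not> r c c'"
  have "bounded_runs r c 0"
    unfolding bounded_runs_def
  proof (intro allI impI)
    fix n d assume d: "(r ^^ n) c d"
    show "n \<le> 0"
    proof (cases n)
      case (Suc m)
      show ?thesis using d stuck unfolding Suc relpowp_Suc_iff by simp
    qed simp
  qed
  then show ?thesis by (rule bounded_runs_mono) simp
qed

text \<open>Since \<open>f\<close> is a function on source states, one equivalence per step captures
  both directions of a simulation; iterating it transfers acceptance and run length alike. The
  invariant \<open>I\<close> excludes source states that the target cannot represent.\<close>

locale functional_bisim =
  fixes q :: "'a \<Rightarrow> 'a \<Rightarrow> bool" and r :: "'b \<Rightarrow> 'b \<Rightarrow> bool" and f :: "'a \<Rightarrow> 'b" and I :: "'a \<Rightarrow> bool"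
  assumes step_iff: "I a \<Longrightarrow> r (f a) c \<longleftrightarrow> (\<exists>a'. q a a' \<and> c = f a')"
    and inv: "I a \<Longrightarrow> q a a' \<Longrightarrow> I a'"
begin

lemma pow_iff: "I a \<Longrightarrow> (r ^^ n) (f a) c \<longleftrightarrow> (\<exists>a'. (q ^^ n) a a' \<and> c = f a')"
proof (induction n arbitrary: a)
  case 0
  then show ?case by auto
next
  case (Suc n)
  have "(r ^^ Suc n) (f a) c \<longleftrightarrow> (\<exists>b. q a b \<and> (r ^^ n) (f b) c)"
    unfolding relpowp_Suc_iff step_iff[OF Suc.prems] by auto
  also have "\<dots> \<longleftrightarrow> (\<exists>b. q a b \<and> (\<exists>a'. (q ^^ n) b a' \<and> c = f a'))"
    using Suc.IH inv[OF Suc.prems] by (intro ex_cong1 conj_cong) auto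
  also have "\<dots> \<longleftrightarrow> (\<exists>a'. (q ^^ Suc n) a a' \<and> c = f a')"
    unfolding relpowp_Suc_iff by auto
  finally show ?case .
qed

lemma pow_inv: "I a \<Longrightarrow> (q ^^ n) a a' \<Longrightarrow> I a'"
proof (induction n arbitrary: a)
  case (Suc n)
  then show ?case unfolding relpowp_Suc_iff using inv by blast
qed simp

lemma reaches_iff:
  assumes "I a" "\<And>a'. I a' \<Longrightarrow> P (f a') \<longleftrightarrow> Q a'"
  shows "reaches r P (f a) \<longleftrightarrow> reaches q Q a"
  unfolding reaches_def pow_iff[OF assms(1)] using assms pow_inv by blast

lemma bounded_runs_iff: "I a \<Longrightarrow> bounded_runs r (f a) T \<longleftrightarrow> bounded_runs q a T"
  unfolding bounded_runs_def pow_iff by blast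

end

subsection \<open>Machines acting on functions from tape indices to tapes\<close>

definition scan :: "tape \<Rightarrow> nat" where
  "scan x = fst x (snd x)"

definition upd :: "tape \<Rightarrow> nat \<Rightarrow> int \<Rightarrow> tape" where
  "upd x a d = ((fst x)(snd x := a), nat (int (snd x) + d))"

definition cells :: "nat list \<Rightarrow> nat \<Rightarrow> nat" where
  "cells l = (\<lambda>i. if i < length l then l ! i else 0)"

text \<open>A register keeps its value as the symbol in cell 0, under a head at rest, so a single
  step reads or overwrites it. \<open>reg 0\<close> is at the same time the blank tape.\<close>

definition reg :: "nat \<Rightarrow> tape" where
  "reg a = (\<lambda>i. if i = 0 then a else 0, 0)"

text \<open>Pairing each tape with its head and indexing tapes by all natural numbers avoids list
  bookkeeping; tapes outside the machine are carried along unchanged.\<close>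

definition mstep :: "tm \<Rightarrow> bool list set \<Rightarrow> nat \<times> (nat \<Rightarrow> tape) \<Rightarrow> nat \<times> (nat \<Rightarrow> tape) \<Rightarrow> bool" where
  "mstep M Orc x y \<longleftrightarrow>
     (if fst x = tm_qry M then
        y = (if tape_word (fst (snd x 1)) \<in> Orc then tm_yes M else tm_no M, snd x)
      else
        (\<exists>rd q' wr mv. (fst x, rd, q', wr, mv) \<in> tm_delta M \<and>
           rd = map (\<lambda>i. scan (snd x i)) [0..<tm_tapes M] \<and>
           y = (q', \<lambda>i. if i < tm_tapes M then upd (snd x i) (wr ! i) (mv ! i) else snd x i)))"

definition minit :: "tm \<Rightarrow> nat list \<Rightarrow> nat \<times> (nat \<Rightarrow> tape)" where
  "minit M inp = (tm_start M, \<lambda>i. if i = 0 then (cells inp, 0) else reg 0)"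

definition conf_of :: "tm \<Rightarrow> nat \<times> (nat \<Rightarrow> tape) \<Rightarrow> conf" where
  "conf_of M x =
     \<lparr> c_state = fst x,
       c_tapes = map (\<lambda>i. fst (snd x i)) [0..<tm_tapes M],
       c_heads = map (\<lambda>i. snd (snd x i)) [0..<tm_tapes M] \<rparr>"

lemma conf_of_minit:
  assumes "tm_tapes M \<ge> 2"
  shows "conf_of M (minit M inp) = init_conf M inp"
proof -
  have "map (\<lambda>i. fst (if i = 0 then (cells inp, 0::nat) else reg 0)) [0..<tm_tapes M]
        = cells inp # replicate (tm_tapes M - 1) (\<lambda>_. 0)"
    using assms by (intro nth_equalityI) (auto simp: reg_def nth_Cons split: nat.splits)
  moreover have "map (\<lambda>i. snd (if i = 0 then (cells inp, 0::nat) else reg 0)) [0..<tm_tapes M]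
        = replicate (tm_tapes M) 0"
    by (intro nth_equalityI) (auto simp: reg_def)
  ultimately show ?thesis
    by (simp add: conf_of_def minit_def init_conf_def cells_def)
qed

lemma step_conf_of:
  assumes "tm_tapes M \<ge> 2"
  shows "step M Orc (conf_of M x) c \<longleftrightarrow> (\<exists>y. mstep M Orc x y \<and> c = conf_of M y)"
proof (cases "fst x = tm_qry M")
  case True
  then show ?thesis using assms by (auto simp: step_def mstep_def conf_of_def)
next
  case False
  have rd: "map (\<lambda>i. (c_tapes (conf_of M x) ! i) (c_heads (conf_of M x) ! i)) [0..<tm_tapes M]
      = map (\<lambda>i. scan (snd x i)) [0..<tm_tapes M]"
    by (simp add: conf_of_def scan_def)
  have wr: "\<lparr> c_state = q',
                  c_tapes = map (\<lambda>i. (c_tapes (conf_of M x) ! i)((c_heads (conf_of M x) ! i) := wr ! i)) [0..<tm_tapes M],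
                  c_heads = map (\<lambda>i. nat (int (c_heads (conf_of M x) ! i) + mv ! i)) [0..<tm_tapes M] \<rparr>
     = conf_of M (q', \<lambda>i. if i < tm_tapes M then upd (snd x i) (wr ! i) (mv ! i) else snd x i)" for q' wr mv
    by (simp add: conf_of_def upd_def)
  have st: "c_state (conf_of M x) = fst x" by (simp add: conf_of_def)
  show ?thesis
    unfolding step_def mstep_def st if_not_P[OF False] rd wr by blast
qed

lemma functional_bisim_conf_of:
  assumes "tm_tapes M \<ge> 2"
  shows "functional_bisim (mstep M Orc) (step M Orc) (conf_of M) (\<lambda>_. True)"
  by unfold_locales (auto simp: step_conf_of[OF assms])

lemma accepts_iff_mstep:
  assumes "wf_tm M"
  shows "accepts M Orc inp \<longleftrightarrow> reaches (mstep M Orc) (\<lambda>x. fst x = tm_acc M) (minit M inp)"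
proof -
  have k: "tm_tapes M \<ge> 2" using assms by (simp add: wf_tm_def)
  interpret functional_bisim "mstep M Orc" "step M Orc" "conf_of M" "\<lambda>_. True"
    by (rule functional_bisim_conf_of[OF k])
  have "accepts M Orc inp \<longleftrightarrow> reaches (step M Orc) (\<lambda>c. c_state c = tm_acc M) (conf_of M (minit M inp))"
    by (simp add: accepts_def reaches_def conf_of_minit[OF k])
  then show ?thesis
    using reaches_iff[where a = "minit M inp" and P = "\<lambda>c. c_state c = tm_acc M"
        and Q = "\<lambda>x. fst x = tm_acc M"]
    by (simp add: conf_of_def)
qed

lemma time_bounded_iff_mstep:
  assumes "wf_tm M"
  shows "time_bounded M Orc inp T \<longleftrightarrow> bounded_runs (mstep M Orc) (minit M inp) T"
proof -
  have k: "tm_tapes M \<ge> 2" using assms by (simp add: wf_tm_def)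
  interpret functional_bisim "mstep M Orc" "step M Orc" "conf_of M" "\<lambda>_. True"
    by (rule functional_bisim_conf_of[OF k])
  have "time_bounded M Orc inp T \<longleftrightarrow> bounded_runs (step M Orc) (conf_of M (minit M inp)) T"
    by (simp add: time_bounded_def bounded_runs_def conf_of_minit[OF k])
  then show ?thesis using bounded_runs_iff[where a = "minit M inp"] by simp
qed

subsection \<open>While programs over named tapes\<close>

text \<open>\<open>MT\<close> and \<open>NT\<close> are two blocks, each able to hold all tapes of
  one simulated machine; the \<open>Rg\<close> tapes serve as counters, registers and stores for
  strings.\<close>

datatype tp = Inp | Qry | Rg nat | MT nat | NT nat

type_synonym store = "tp \<Rightarrow> tape"
type_synonym view = "tp \<Rightarrow> nat"
type_synonym moves = "tp \<Rightarrow> int"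

text \<open>Guards and actions depend only on the symbols under the heads, so the control state of a
  program is merely the list of pieces still to be run. Nondeterminism sits in \<open>Act\<close>
  alone, and an empty set of actions is a dead end.\<close>

datatype prog =
    Act "view \<Rightarrow> (view \<times> moves) set"
  | Seq prog prog
  | Cond "view \<Rightarrow> bool" prog prog
  | While "view \<Rightarrow> bool" prog
  | Ask

definition view :: "store \<Rightarrow> view" where
  "view s = (\<lambda>x. scan (s x))"

definition eff :: "store \<Rightarrow> view \<Rightarrow> moves \<Rightarrow> store" where
  "eff s w m = (\<lambda>x. upd (s x) (w x) (m x))"

fun ptrans :: "prog list \<Rightarrow> view \<Rightarrow> (prog list \<times> view \<times> moves) set" where
  "ptrans [] v = {}"
| "ptrans (Act a # k) v = {(k, w, m) | w m. (w, m) \<in> a v}"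
| "ptrans (Seq c d # k) v = {(c # d # k, v, \<lambda>_. 0)}"
| "ptrans (Cond g c d # k) v = {((if g v then c else d) # k, v, \<lambda>_. 0)}"
| "ptrans (While g c # k) v = {(if g v then c # While g c # k else k, v, \<lambda>_. 0)}"
| "ptrans (Ask # k) v = {}"

text \<open>The continuation \<open>[]\<close> is the accepting state and \<open>[Ask]\<close> is the query state; a query answered
  yes (no) resumes at a fixed continuation, because a machine has only one state for each answer.\<close>

type_synonym env = "bool list set \<times> prog list \<times> prog list"

definition pstep :: "env \<Rightarrow> prog list \<times> store \<Rightarrow> prog list \<times> store \<Rightarrow> bool" where
  "pstep E x y \<longleftrightarrow>
     (if fst x = [Ask] then
        y = (if tape_word (fst (snd x Qry)) \<in> fst E then fst (snd E) else snd (snd E), snd x)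
      else (\<exists>k w m. (k, w, m) \<in> ptrans (fst x) (view (snd x)) \<and> y = (k, eff (snd x) w m)))"

text \<open>All control states that can arise while \<open>c\<close> runs in front of
  \<open>k\<close>, except \<open>k\<close> itself, which belongs to the surroundings. The body of a
  loop is continued by the loop itself, so looping yields no new states and the set stays
  finite.\<close>

fun conts :: "prog \<Rightarrow> prog list \<Rightarrow> prog list set" where
  "conts (Seq c d) k = insert (Seq c d # k) (conts c (d # k) \<union> conts d k)"
| "conts (Cond g c d) k = insert (Cond g c d # k) (conts c k \<union> conts d k)"
| "conts (While g c) k = insert (While g c # k) (conts c (While g c # k))"
| "conts c k = {c # k}"

lemma finite_conts: "finite (conts c k)"
  by (induction c k rule: conts.induct) auto

lemma conts_self: "c # k \<in> conts c k"
  by (cases c) auto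

lemma conts_closed:
  "q \<in> conts c k \<Longrightarrow> (q', w, m) \<in> ptrans q v \<Longrightarrow> q' \<in> insert k (conts c k)"
proof (induction c k arbitrary: q rule: conts.induct)
  case (1 c d k)
  then show ?case using conts_self[of c "d # k"] conts_self[of d k] by fastforce
next
  case (2 g c d k)
  then show ?case using conts_self[of c k] conts_self[of d k] by (fastforce split: if_splits)
next
  case (3 g c k)
  then show ?case using conts_self[of c "While g c # k"] by (fastforce split: if_splits)
qed auto

text \<open>A single size parameter bounds both the alphabet and the indices of the tapes in use.\<close>

definition tset :: "nat \<Rightarrow> tp set" where
  "tset n = {Inp, Qry} \<union> Rg ` {..<n} \<union> MT ` {..<n} \<union> NT ` {..<n}"

definition view_ok :: "nat \<Rightarrow> view \<Rightarrow> bool" where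
  "view_ok n v \<longleftrightarrow> (\<forall>x. v x < n) \<and> (\<forall>x. x \<notin> tset n \<longrightarrow> v x = 0)"

definition moves_ok :: "nat \<Rightarrow> moves \<Rightarrow> bool" where
  "moves_ok n m \<longleftrightarrow> (\<forall>x. m x \<in> {-1, 0, 1}) \<and> (\<forall>x. x \<notin> tset n \<longrightarrow> m x = 0)"

definition act_ok :: "nat \<Rightarrow> (view \<Rightarrow> (view \<times> moves) set) \<Rightarrow> bool" where
  "act_ok n a \<longleftrightarrow> (\<forall>v w m. view_ok n v \<longrightarrow> (w, m) \<in> a v \<longrightarrow> view_ok n w \<and> moves_ok n m)"

fun prog_ok :: "nat \<Rightarrow> prog \<Rightarrow> bool" where
  "prog_ok n (Act a) = act_ok n a"
| "prog_ok n (Seq c d) = (prog_ok n c \<and> prog_ok n d)"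
| "prog_ok n (Cond g c d) = (prog_ok n c \<and> prog_ok n d)"
| "prog_ok n (While g c) = prog_ok n c"
| "prog_ok n Ask = True"

fun prog_det :: "prog \<Rightarrow> bool" where
  "prog_det (Act a) = (\<forall>v x y. x \<in> a v \<longrightarrow> y \<in> a v \<longrightarrow> x = y)"
| "prog_det (Seq c d) = (prog_det c \<and> prog_det d)"
| "prog_det (Cond g c d) = (prog_det c \<and> prog_det d)"
| "prog_det (While g c) = prog_det c"
| "prog_det Ask = True"

lemma trans_ok:
  assumes "\<forall>c\<in>set q. prog_ok n c" "view_ok n v" "(q', w, m) \<in> ptrans q v"
  shows "view_ok n w \<and> moves_ok n m \<and> (\<forall>c\<in>set q'. prog_ok n c)"
  using assms by (cases "(q, v)" rule: ptrans.cases) (auto simp: act_ok_def moves_ok_def split: if_splits)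

lemma trans_det:
  assumes "\<forall>c\<in>set q. prog_det c" "x \<in> ptrans q v" "y \<in> ptrans q v"
  shows "x = y"
  using assms
proof (cases "(q, v)" rule: ptrans.cases)
  case (2 a k va)
  then obtain w m w' m' where "x = (k, w, m)" "(w, m) \<in> a v" "y = (k, w', m')" "(w', m') \<in> a v"
    using assms(2,3) by auto
  moreover have "prog_det (Act a)" using assms(1) 2 by simp
  ultimately show ?thesis unfolding prog_det.simps by blast
qed auto

text \<open>Any property inherited by subprograms passes to every piece of every control state; it
  is applied to \<open>prog_ok\<close> and to \<open>prog_det\<close>.\<close>

lemma conts_all:
  assumes "\<forall>d\<in>set (c # k). P d" "q \<in> conts c k"
    and "\<And>a b. P (Seq a b) \<Longrightarrow> P a \<and> P b" "\<And>g a b. P (Cond g a b) \<Longrightarrow> P a \<and> P b"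
    and "\<And>g a. P (While g a) \<Longrightarrow> P a"
  shows "\<forall>d\<in>set q. P d"
  using assms(1,2)
proof (induction c k arbitrary: q rule: conts.induct)
  case (1 c d k)
  have p: "P c" "P d" "\<forall>d\<in>set k. P d" using "1.prems"(1) assms(3)[of c d] by auto
  consider "q = Seq c d # k" | "q \<in> conts c (d # k)" | "q \<in> conts d k"
    using "1.prems"(2) by auto
  then show ?case
    by cases (use "1.prems"(1) in simp, rule "1.IH"(1), use p in simp, assumption,
        rule "1.IH"(2), use p in simp, assumption)
next
  case (2 g c d k)
  have p: "P c" "P d" "\<forall>d\<in>set k. P d" using "2.prems"(1) assms(4)[of g c d] by auto
  consider "q = Cond g c d # k" | "q \<in> conts c k" | "q \<in> conts d k"
    using "2.prems"(2) by auto
  then show ?case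
    by cases (use "2.prems"(1) in simp, rule "2.IH"(1), use p in simp, assumption,
        rule "2.IH"(2), use p in simp, assumption)
next
  case (3 g c k)
  have p: "P c" using "3.prems"(1) assms(5)[of g c] by auto
  consider "q = While g c # k" | "q \<in> conts c (While g c # k)"
    using "3.prems"(2) by auto
  then show ?case
    by cases (use "3.prems"(1) in simp, rule "3.IH", use p "3.prems"(1) in simp, assumption)
qed auto

lemma conts_prog_ok:
  "q \<in> conts c k \<Longrightarrow> d \<in> set q \<Longrightarrow> prog_ok n c \<Longrightarrow> \<forall>e\<in>set k. prog_ok n e \<Longrightarrow> prog_ok n d"
  by (rule bspec[OF conts_all[of c k "prog_ok n" q]]) auto

lemma conts_prog_det:
  "q \<in> conts c k \<Longrightarrow> d \<in> set q \<Longrightarrow> prog_det c \<Longrightarrow> \<forall>e\<in>set k. prog_det e \<Longrightarrow> prog_det d"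
  by (rule bspec[OF conts_all[of c k prog_det q]]) auto

subsection \<open>Compilation of programs to machines\<close>

text \<open>\<open>Inp\<close> and \<open>Qry\<close> stand first because the machine model fixes
  tape 0 as the input tape and tape 1 as the oracle tape.\<close>

definition tlist :: "nat \<Rightarrow> tp list" where
  "tlist n = [Inp, Qry] @ map Rg [0..<n] @ map MT [0..<n] @ map NT [0..<n]"

lemma set_tlist: "set (tlist n) = tset n"
  by (auto simp: tlist_def tset_def)

lemma distinct_tlist: "distinct (tlist n)"
  by (auto simp: tlist_def distinct_map inj_on_def)

definition store_ok :: "nat \<Rightarrow> store \<Rightarrow> bool" where
  "store_ok n s \<longleftrightarrow> (\<forall>x j. fst (s x) j < n) \<and> (\<forall>x. x \<notin> tset n \<longrightarrow> s x = reg 0)"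

lemma store_ok_view: "store_ok n s \<Longrightarrow> view_ok n (view s)"
  by (auto simp: store_ok_def view_ok_def view_def scan_def reg_def)

lemma store_ok_eff: "store_ok n s \<Longrightarrow> view_ok n w \<Longrightarrow> moves_ok n m \<Longrightarrow> store_ok n (eff s w m)"
  by (auto simp: store_ok_def view_ok_def moves_ok_def eff_def upd_def reg_def fun_eq_iff)

text \<open>A machine reads a list of symbols, a program reads a view; this translates the former
  into the latter, with blanks on the tapes outside the machine.\<close>

definition vl :: "nat \<Rightarrow> nat list \<Rightarrow> view" where
  "vl n l = (\<lambda>x. if x \<in> tset n then l ! (THE i. i < length (tlist n) \<and> tlist n ! i = x) else 0)"

lemma the_index:
  assumes "i < length (tlist n)"
  shows "(THE j. j < length (tlist n) \<and> tlist n ! j = tlist n ! i) = i"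
  using assms distinct_tlist[of n] by (intro the_equality) (auto simp: nth_eq_iff_index_eq)

lemma vl_map:
  assumes "\<And>x. x \<notin> tset n \<Longrightarrow> v x = 0"
  shows "vl n (map v (tlist n)) = v"
proof
  fix x
  show "vl n (map v (tlist n)) x = v x"
  proof (cases "x \<in> tset n")
    case True
    then obtain i where i: "i < length (tlist n)" "tlist n ! i = x"
      by (metis in_set_conv_nth set_tlist)
    then show ?thesis using True the_index[OF i(1)] by (simp add: vl_def)
  next
    case False
    then show ?thesis using assms by (simp add: vl_def)
  qed
qed

lemma map_vl: 
  assumes "length l = length (tlist n)"
  shows "map (vl n l) (tlist n) = l"
proof (rule nth_equalityI)
  fix i assume "i < length (map (vl n l) (tlist n))"
  then have i: "i < length (tlist n)" by simp
  have "tlist n ! i \<in> tset n" using i set_tlist nth_mem by metis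
  then show "map (vl n l) (tlist n) ! i = l ! i"
    using i the_index[OF i] by (simp add: vl_def)
qed (simp add: assms)

definition init_store :: "nat list \<Rightarrow> store" where
  "init_store inp = (\<lambda>_. reg 0)(Inp := (cells inp, 0))"

text \<open>The number \<open>card Q\<close> belongs to no control state. It becomes the rejecting
  state, which has to differ from the accepting and the query state and is never entered, since
  programs reject by getting stuck.\<close>

definition compiled :: "nat \<Rightarrow> prog list set \<Rightarrow> (prog list \<Rightarrow> nat) \<Rightarrow> prog list \<Rightarrow> prog list \<Rightarrow> prog list \<Rightarrow> tm" where
  "compiled n Q num k0 ky kn =
     \<lparr> tm_states = Suc (card Q), tm_syms = n, tm_tapes = length (tlist n),
       tm_start = num k0, tm_acc = num [], tm_rej = card Q, tm_qry = num [Ask],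
       tm_yes = num ky, tm_no = num kn,
       tm_delta = {(num q, l, num q', map w (tlist n), map m (tlist n)) | q l q' w m.
          q \<in> Q \<and> length l = length (tlist n) \<and> set l \<subseteq> {..<n} \<and> (q', w, m) \<in> ptrans q (vl n l)} \<rparr>"

locale compilation =
  fixes n :: nat and Q :: "prog list set" and num :: "prog list \<Rightarrow> nat" and k0 ky kn :: "prog list"
  assumes n: "n \<ge> 4" and fin: "finite Q" and num: "bij_betw num Q {0..<card Q}"
    and mem: "[] \<in> Q" "[Ask] \<in> Q" "k0 \<in> Q" "ky \<in> Q" "kn \<in> Q"
    and closed: "q \<in> Q \<Longrightarrow> (q', w, m) \<in> ptrans q v \<Longrightarrow> q' \<in> Q"
    and ok: "q \<in> Q \<Longrightarrow> c \<in> set q \<Longrightarrow> prog_ok n c"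
begin

abbreviation "M \<equiv> compiled n Q num k0 ky kn"

lemma num_lt: "q \<in> Q \<Longrightarrow> num q < card Q"
  using num by (auto simp: bij_betw_def)

lemma num_eq: "q \<in> Q \<Longrightarrow> q' \<in> Q \<Longrightarrow> num q = num q' \<longleftrightarrow> q = q'"
  using num by (auto simp: bij_betw_def inj_on_def)

lemma view_ok_vl: "length l = length (tlist n) \<Longrightarrow> set l \<subseteq> {..<n} \<Longrightarrow> view_ok n (vl n l)"
proof -
  assume l: "length l = length (tlist n)" "set l \<subseteq> {..<n}"
  have "vl n l x < n" for x
  proof (cases "x \<in> tset n")
    case True
    then have "x \<in> set (tlist n)" by (simp add: set_tlist)
    then have "vl n l x \<in> set (map (vl n l) (tlist n))" by auto
    then show ?thesis using l map_vl[OF l(1)] by auto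
  next
    case False
    then show ?thesis using n by (simp add: vl_def)
  qed
  then show ?thesis by (simp add: view_ok_def vl_def)
qed

lemma delta_ok:
  assumes "d \<in> tm_delta M"
  obtains q l q' w m where "d = (num q, l, num q', map w (tlist n), map m (tlist n))"
    "q \<in> Q" "length l = length (tlist n)" "set l \<subseteq> {..<n}" "(q', w, m) \<in> ptrans q (vl n l)"
    "q' \<in> Q" "view_ok n w" "moves_ok n m"
proof -
  from assms obtain q l q' w m where d: "d = (num q, l, num q', map w (tlist n), map m (tlist n))"
    "q \<in> Q" "length l = length (tlist n)" "set l \<subseteq> {..<n}" "(q', w, m) \<in> ptrans q (vl n l)"
    unfolding compiled_def by simp blast
  moreover have "view_ok n w \<and> moves_ok n m"
    using trans_ok[OF _ view_ok_vl[OF d(3,4)] d(5)] ok d(2) by blast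
  ultimately show ?thesis using closed that by blast
qed

lemma wf: "wf_tm M"
proof -
  let ?k = "length (tlist n)"
  let ?L = "{l. set l \<subseteq> {..<n} \<and> length l = ?k}"
  let ?Z = "{l. set l \<subseteq> {-1, 0, 1::int} \<and> length l = ?k}"
  have sub: "tm_delta M \<subseteq> {..<card Q} \<times> ?L \<times> {..<card Q} \<times> ?L \<times> ?Z"
  proof
    fix d assume "d \<in> tm_delta M"
    then show "d \<in> {..<card Q} \<times> ?L \<times> {..<card Q} \<times> ?L \<times> ?Z"
    proof (rule delta_ok)
      fix q l q' w m assume "d = (num q, l, num q', map w (tlist n), map m (tlist n))"
        "q \<in> Q" "length l = length (tlist n)" "set l \<subseteq> {..<n}" "(q', w, m) \<in> ptrans q (vl n l)"
        "q' \<in> Q" "view_ok n w" "moves_ok n m"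
      then show ?thesis using num_lt by (auto simp: view_ok_def moves_ok_def)
    qed
  qed
  have "finite ?L" "finite ?Z" by (auto intro!: finite_lists_length_eq)
  then have fin: "finite (tm_delta M)" by (intro finite_subset[OF sub] finite_cartesian_product) auto
  have B: "\<forall>(q, rd, q', wr, mv) \<in> tm_delta M.
        q < tm_states M \<and> q \<notin> {tm_acc M, tm_rej M, tm_qry M} \<and> q' < tm_states M \<and>
        length rd = tm_tapes M \<and> length wr = tm_tapes M \<and> length mv = tm_tapes M \<and>
        (\<forall>s \<in> set rd. s < tm_syms M) \<and> (\<forall>s \<in> set wr. s < tm_syms M) \<and>
        (\<forall>m \<in> set mv. m \<in> {-1, 0, 1})"
  proof
    fix d assume "d \<in> tm_delta M"
    then show "case d of (q, rd, q', wr, mv) \<Rightarrow>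
        q < tm_states M \<and> q \<notin> {tm_acc M, tm_rej M, tm_qry M} \<and> q' < tm_states M \<and>
        length rd = tm_tapes M \<and> length wr = tm_tapes M \<and> length mv = tm_tapes M \<and>
        (\<forall>s \<in> set rd. s < tm_syms M) \<and> (\<forall>s \<in> set wr. s < tm_syms M) \<and>
        (\<forall>m \<in> set mv. m \<in> {-1, 0, 1})"
    proof (rule delta_ok)
      fix q l q' w m assume d: "d = (num q, l, num q', map w (tlist n), map m (tlist n))"
        "q \<in> Q" "length l = length (tlist n)" "set l \<subseteq> {..<n}" "(q', w, m) \<in> ptrans q (vl n l)"
        "q' \<in> Q" "view_ok n w" "moves_ok n m"
      have "q \<noteq> []" "q \<noteq> [Ask]" using d(5) by auto
      then have "num q \<notin> {num [], card Q, num [Ask]}"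
        using num_lt[OF d(2)] num_eq d(2) mem by auto
      then show ?thesis using d num_lt[OF d(2)] num_lt[OF d(6)]
        by (auto simp: compiled_def view_ok_def moves_ok_def less_Suc_eq)
    qed
  qed
  have "num [] \<noteq> num [Ask]" "num [] \<noteq> card Q" "num [Ask] \<noteq> card Q"
    using num_eq[OF mem(1,2)] num_lt[OF mem(1)] num_lt[OF mem(2)] by auto
  then have "distinct [tm_acc M, tm_rej M, tm_qry M]" by (auto simp: compiled_def)
  moreover have "tm_syms M \<ge> 4" "tm_tapes M \<ge> 2"
     "tm_start M < tm_states M" "tm_acc M < tm_states M" "tm_rej M < tm_states M"
     "tm_qry M < tm_states M" "tm_yes M < tm_states M" "tm_no M < tm_states M"
    using n num_lt[OF mem(1)] num_lt[OF mem(2)] num_lt[OF mem(3)] num_lt[OF mem(4)] num_lt[OF mem(5)]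
    by (simp_all add: compiled_def tlist_def)
  ultimately show ?thesis
    unfolding wf_tm_def using fin B by (intro conjI)
qed

lemma det:
  assumes "\<And>q c. q \<in> Q \<Longrightarrow> c \<in> set q \<Longrightarrow> prog_det c"
  shows "deterministic_tm M"
proof -
  have "q' = p' \<and> wr = wr2 \<and> mv = mv2"
    if d1: "(q, rd, q', wr, mv) \<in> tm_delta M" and d2: "(q, rd, p', wr2, mv2) \<in> tm_delta M" for q rd q' wr mv p' wr2 mv2
  proof -
    obtain a l a' w m where 1: "(q, rd, q', wr, mv) = (num a, l, num a', map w (tlist n), map m (tlist n))"
      "a \<in> Q" "(a', w, m) \<in> ptrans a (vl n l)" by (rule delta_ok[OF d1], blast)
    obtain b k b' w2 m2 where 2: "(q, rd, p', wr2, mv2) = (num b, k, num b', map w2 (tlist n), map m2 (tlist n))"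
      "b \<in> Q" "(b', w2, m2) \<in> ptrans b (vl n k)" by (rule delta_ok[OF d2], blast)
    have "a = b" "l = k" using 1 2 num_eq by auto
    then have "(a', w, m) = (b', w2, m2)" using trans_det 1 2 assms by blast
    then show ?thesis using 1 2 by auto
  qed
  then show ?thesis unfolding deterministic_tm_def by blast
qed

definition repr :: "prog list \<times> store \<Rightarrow> nat \<times> (nat \<Rightarrow> tape)" where
  "repr x = (num (fst x), \<lambda>i. if i < length (tlist n) then snd x (tlist n ! i) else reg 0)"

lemma repr_eff:
  assumes "s = snd x"
  shows "(num k, \<lambda>i. if i < length (tlist n) then upd (snd (repr x) i) (map w (tlist n) ! i) (map m (tlist n) ! i) else snd (repr x) i)
   = repr (k, eff s w m)"
  using assms by (auto simp: repr_def eff_def fun_eq_iff)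

text \<open>The machine has transitions only for symbols of its alphabet and for control states in
  \<open>Q\<close>. Both \<open>store_ok\<close> and the closure of \<open>Q\<close> under steps
  keep every run within this range, where program and machine move in lockstep.\<close>

lemma bisim: "functional_bisim (pstep (Ob, ky, kn)) (mstep M Ob) repr (\<lambda>x. fst x \<in> Q \<and> store_ok n (snd x))"
proof
  fix x c assume I: "fst x \<in> Q \<and> store_ok n (snd x)"
  obtain q s where x: "x = (q, s)" by force
  have q: "q \<in> Q" and s: "store_ok n s" using I x by auto
  have v: "view_ok n (view s)" using s by (rule store_ok_view)
  show "mstep M Ob (repr x) c \<longleftrightarrow> (\<exists>y. pstep (Ob, ky, kn) x y \<and> c = repr y)"
  proof (cases "q = [Ask]")
    case True
    then have "fst (repr x) = tm_qry M" by (simp add: repr_def x compiled_def)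
    moreover have "snd (repr x) 1 = s Qry" by (simp add: repr_def x tlist_def)
    ultimately show ?thesis
      using True by (auto simp: mstep_def pstep_def x repr_def compiled_def)
  next
    case False
    have nq: "fst (repr x) \<noteq> tm_qry M" using num_eq[OF q mem(2)] False by (simp add: repr_def x compiled_def)
    have rd: "map (\<lambda>i. scan (snd (repr x) i)) [0..<tm_tapes M] = map (view s) (tlist n)"
      by (rule nth_equalityI) (simp_all add: repr_def x compiled_def view_def)
    have vl: "vl n (map (view s) (tlist n)) = view s"
      using v by (intro vl_map) (simp add: view_ok_def)
    show ?thesis
    proof
      assume "mstep M Ob (repr x) c"
      then obtain q' wr mv where d: "(num q, map (view s) (tlist n), q', wr, mv) \<in> tm_delta M"
        and c: "c = (q', \<lambda>i. if i < tm_tapes M then upd (snd (repr x) i) (wr ! i) (mv ! i) else snd (repr x) i)"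
        using nq unfolding mstep_def rd by (auto simp: repr_def x)
      obtain a l a' w m where 1: "(num q, map (view s) (tlist n), q', wr, mv) = (num a, l, num a', map w (tlist n), map m (tlist n))"
        "a \<in> Q" "(a', w, m) \<in> ptrans a (vl n l)" by (rule delta_ok[OF d], blast)
      then have a: "a = q" "l = map (view s) (tlist n)" using num_eq q by auto
      then have t: "(a', w, m) \<in> ptrans q (view s)" using 1 vl by simp
      have e: "q' = num a'" "wr = map w (tlist n)" "mv = map m (tlist n)" using 1(1) by simp_all
      have k: "tm_tapes M = length (tlist n)" by (simp add: compiled_def)
      have "c = repr (a', eff s w m)"
        unfolding c e k by (rule repr_eff) (simp add: x)
      then show "\<exists>y. pstep (Ob, ky, kn) x y \<and> c = repr y"
        using t False by (auto simp: pstep_def x)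
    next
      assume "\<exists>y. pstep (Ob, ky, kn) x y \<and> c = repr y"
      then obtain k w m where t: "(k, w, m) \<in> ptrans q (view s)" and c: "c = repr (k, eff s w m)"
        using False by (auto simp: pstep_def x)
      have "set (map (view s) (tlist n)) \<subseteq> {..<n}" using v by (auto simp: view_ok_def)
      then have d: "(num q, map (view s) (tlist n), num k, map w (tlist n), map m (tlist n)) \<in> tm_delta M"
        using q t vl by (simp add: compiled_def) (metis length_map vl)
      have k: "tm_tapes M = length (tlist n)" by (simp add: compiled_def)
      have st: "fst (repr x) = num q" by (simp add: repr_def x)
      have e: "repr (k, eff s w m) = (num k, \<lambda>i. if i < tm_tapes M
          then upd (snd (repr x) i) (map w (tlist n) ! i) (map m (tlist n) ! i) else snd (repr x) i)"
        unfolding k by (rule repr_eff[symmetric]) (simp add: x)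
      show "mstep M Ob (repr x) c"
        unfolding mstep_def rd c st if_not_P[OF nq[unfolded st]] by (intro exI conjI, rule d, rule refl, rule e)
    qed
  qed
next
  fix x y assume I: "fst x \<in> Q \<and> store_ok n (snd x)" and p: "pstep (Ob, ky, kn) x y"
  show "fst y \<in> Q \<and> store_ok n (snd y)"
  proof (cases "fst x = [Ask]")
    case True
    then show ?thesis using p I mem by (auto simp: pstep_def)
  next
    case False
    then obtain k w m where t: "(k, w, m) \<in> ptrans (fst x) (view (snd x))" "y = (k, eff (snd x) w m)"
      using p by (auto simp: pstep_def)
    have "view_ok n w \<and> moves_ok n m"
      using trans_ok[OF _ store_ok_view t(1)] I ok by blast
    then show ?thesis using t I closed store_ok_eff by auto
  qed
qed

lemma repr_init: "repr (k0, init_store inp) = minit M inp"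
proof -
  have "tlist n ! i \<noteq> Inp" if "i < length (tlist n)" "i \<noteq> 0" for i
    using distinct_tlist[of n] that by (metis append_Cons length_greater_0_conv list.size(3) not_less0 nth_Cons_0 nth_eq_iff_index_eq tlist_def)
  moreover have "tlist n ! 0 = Inp" "0 < length (tlist n)" by (auto simp: tlist_def)
  ultimately show ?thesis
    by (auto simp: repr_def minit_def init_store_def compiled_def fun_eq_iff)
qed

lemma store_ok_init: "set inp \<subseteq> {..<4} \<Longrightarrow> store_ok n (init_store inp)"
  using n by (fastforce simp: store_ok_def init_store_def cells_def reg_def tset_def subset_iff dest: nth_mem)

lemma correct:
  assumes "set inp \<subseteq> {..<4}"
  shows "accepts M Ob inp \<longleftrightarrow> reaches (pstep (Ob, ky, kn)) (\<lambda>x. fst x = []) (k0, init_store inp)"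
    and "time_bounded M Ob inp T \<longleftrightarrow> bounded_runs (pstep (Ob, ky, kn)) (k0, init_store inp) T"
proof -
  interpret functional_bisim "pstep (Ob, ky, kn)" "mstep M Ob" repr "\<lambda>x. fst x \<in> Q \<and> store_ok n (snd x)"
    by (rule bisim)
  have I: "fst (k0, init_store inp) \<in> Q \<and> store_ok n (snd (k0, init_store inp))"
    using mem store_ok_init[OF assms] by simp
  show "accepts M Ob inp \<longleftrightarrow> reaches (pstep (Ob, ky, kn)) (\<lambda>x. fst x = []) (k0, init_store inp)"
    unfolding accepts_iff_mstep[OF wf] repr_init[symmetric]
    by (rule reaches_iff[OF I]) (use num_eq mem in \<open>auto simp: repr_def compiled_def\<close>)
  show "time_bounded M Ob inp T \<longleftrightarrow> bounded_runs (pstep (Ob, ky, kn)) (k0, init_store inp) T"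
    unfolding time_bounded_iff_mstep[OF wf] repr_init[symmetric]
    by (rule bounded_runs_iff[OF I])
qed

end

abbreviation pacc :: "env \<Rightarrow> prog list \<times> store \<Rightarrow> bool" where
  "pacc E \<equiv> reaches (pstep E) (\<lambda>x. fst x = [])"

abbreviation pbounded :: "env \<Rightarrow> prog list \<times> store \<Rightarrow> nat \<Rightarrow> bool" where
  "pbounded E \<equiv> bounded_runs (pstep E)"

text \<open>The two continuations fix a protocol: after a yes answer \<open>y\<close> runs and a
  further query follows, while after a no answer the run accepts as soon as \<open>z\<close> is
  completed.\<close>

lemma compile_oracle:
  assumes n: "n \<ge> 4" and ok: "prog_ok n p" "prog_ok n y" "prog_ok n z"
  obtains M where "wf_tm M"
    "\<And>Ob inp. set inp \<subseteq> {..<4} \<Longrightarrow> accepts M Ob inp \<longleftrightarrow> pacc (Ob, [y, Ask], [z]) ([p, Ask], init_store inp)"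
    "\<And>Ob inp T. set inp \<subseteq> {..<4} \<Longrightarrow> time_bounded M Ob inp T \<longleftrightarrow> pbounded (Ob, [y, Ask], [z]) ([p, Ask], init_store inp) T"
proof -
  define Q where "Q = {[], [Ask]} \<union> conts p [Ask] \<union> conts y [Ask] \<union> conts z []"
  have fin: "finite Q" by (simp add: Q_def finite_conts)
  obtain num where num: "bij_betw num Q {0..<card Q}" using ex_bij_betw_finite_nat[OF fin] by blast
  interpret compilation n Q num "[p, Ask]" "[y, Ask]" "[z]"
  proof
    fix q q' w m v assume q: "q \<in> Q" and t: "(q', w, m) \<in> ptrans q v"
    consider "q \<in> {[], [Ask]}" | "q \<in> conts p [Ask]" | "q \<in> conts y [Ask]" | "q \<in> conts z []"
      using q by (auto simp: Q_def)
    then show "q' \<in> Q"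
    proof cases
      case 1
      then show ?thesis using t by auto
    next
      case 2
      show ?thesis using conts_closed[OF 2 t] by (auto simp: Q_def)
    next
      case 3
      show ?thesis using conts_closed[OF 3 t] by (auto simp: Q_def)
    next
      case 4
      show ?thesis using conts_closed[OF 4 t] by (auto simp: Q_def)
    qed
  next
    fix q c assume "q \<in> Q" "c \<in> set q"
    then show "prog_ok n c"
      using conts_prog_ok[OF _ _ ok(1)] conts_prog_ok[OF _ _ ok(2)] conts_prog_ok[OF _ _ ok(3)]
      by (fastforce simp: Q_def)
  qed (use n fin num in \<open>simp_all add: Q_def conts_self\<close>)
  show ?thesis using that wf correct by blast
qed

lemma compile:
  assumes n: "n \<ge> 4" and ok: "prog_ok n p"
  obtains M where "wf_tm M" "prog_det p \<Longrightarrow> deterministic_tm M"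
    "\<And>Ob inp. set inp \<subseteq> {..<4} \<Longrightarrow> accepts M Ob inp \<longleftrightarrow> pacc (Ob, [], []) ([p], init_store inp)"
    "\<And>Ob inp T. set inp \<subseteq> {..<4} \<Longrightarrow> time_bounded M Ob inp T \<longleftrightarrow> pbounded (Ob, [], []) ([p], init_store inp) T"
proof -
  \<comment> \<open>\<open>[Ask]\<close> is put in so that the machine has a query state, whether or
    not \<open>p\<close> can reach it.\<close>
  define Q where "Q = {[], [Ask]} \<union> conts p []"
  have fin: "finite Q" by (simp add: Q_def finite_conts)
  obtain num where num: "bij_betw num Q {0..<card Q}" using ex_bij_betw_finite_nat[OF fin] by blast
  interpret compilation n Q num "[p]" "[]" "[]"
  proof
    fix q q' w m v assume "q \<in> Q" "(q', w, m) \<in> ptrans q v"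
    then show "q' \<in> Q" using conts_closed[of q p "[]"] by (auto simp: Q_def)
  next
    fix q c assume "q \<in> Q" "c \<in> set q"
    then show "prog_ok n c" using conts_prog_ok[OF _ _ ok] by (fastforce simp: Q_def)
  qed (use n fin num in \<open>simp_all add: Q_def conts_self\<close>)
  have "deterministic_tm M" if "prog_det p"
  proof (rule det)
    fix q c assume "q \<in> Q" "c \<in> set q"
    then show "prog_det c" using conts_prog_det[OF _ _ that] by (fastforce simp: Q_def)
  qed
  then show ?thesis using that wf correct by blast
qed

subsection \<open>Big-step reasoning about programs\<close>

text \<open>\<open>runs_to c s T X\<close>: in every context, the complete runs of \<open>c\<close> from \<open>s\<close> end exactly in the
  stores of \<open>X\<close>, and every run, complete or not, spends at most \<open>T\<close> steps in \<open>c\<close>.\<close>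

definition runs_to :: "prog \<Rightarrow> store \<Rightarrow> nat \<Rightarrow> store set \<Rightarrow> bool" where
  "runs_to c s T X \<longleftrightarrow> (\<forall>E k.
     (pacc E (c # k, s) \<longleftrightarrow> (\<exists>s'\<in>X. pacc E (k, s'))) \<and>
     (\<forall>T'. (\<forall>s'\<in>X. pbounded E (k, s') T') \<longrightarrow> pbounded E (c # k, s) (T + T')))"

lemma runs_to_mono:
  assumes "runs_to c s T X" "T \<le> T'"
  shows "runs_to c s T' X"
  unfolding runs_to_def
proof (intro allI conjI impI)
  fix E k U assume "\<forall>s'\<in>X. pbounded E (k, s') U"
  then have "pbounded E (c # k, s) (T + U)" using assms(1) unfolding runs_to_def by blast
  then show "pbounded E (c # k, s) (T' + U)" by (rule bounded_runs_mono) (use assms(2) in simp)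
next
  fix E k
  show "pacc E (c # k, s) \<longleftrightarrow> (\<exists>s'\<in>X. pacc E (k, s'))" using assms(1) unfolding runs_to_def by blast
qed

lemma runs_to_eq: "runs_to c s T X \<Longrightarrow> T \<le> T' \<Longrightarrow> X = Y \<Longrightarrow> runs_to c s T' Y"
  using runs_to_mono by blast

lemma pstep_iff: "c \<noteq> Ask \<Longrightarrow> pstep E (c # k, s) y \<longleftrightarrow>
    (\<exists>k' w m. (k', w, m) \<in> ptrans (c # k) (view s) \<and> y = (k', eff s w m))"
  by (auto simp: pstep_def)

lemma eff_id [simp]: "eff s (view s) (\<lambda>_. 0) = s"
  by (auto simp: eff_def upd_def view_def scan_def fun_eq_iff)

text \<open>The common root of the rules for the single constructs: \<open>Y\<close> lists the
  outcomes of the first step, with the pieces \<open>l\<close> put in front of the continuation, and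
  this step accounts for the successor in the time bound.\<close>

lemma runs_to_unfold:
  assumes "c \<noteq> Ask"
    and Y: "\<And>k. ptrans (c # k) (view s) = (\<lambda>(l, w, m). (l @ k, w, m)) ` Y"
    and *: "\<And>E k. (\<exists>(l, w, m)\<in>Y. pacc E (l @ k, eff s w m)) \<longleftrightarrow> (\<exists>s'\<in>X. pacc E (k, s'))"
    and **: "\<And>E k T' l w m. \<forall>s'\<in>X. pbounded E (k, s') T' \<Longrightarrow> (l, w, m) \<in> Y \<Longrightarrow> pbounded E (l @ k, eff s w m) (T + T')"
  shows "runs_to c s (Suc T) X"
  unfolding runs_to_def
proof (intro allI conjI impI)
  fix E k
  have st: "pstep E (c # k, s) y \<longleftrightarrow> (\<exists>(l, w, m)\<in>Y. y = (l @ k, eff s w m))" for y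
    unfolding pstep_iff[OF assms(1)] Y by force
  show "pacc E (c # k, s) \<longleftrightarrow> (\<exists>s'\<in>X. pacc E (k, s'))"
  proof -
    have "pacc E (c # k, s) \<longleftrightarrow> (\<exists>y. pstep E (c # k, s) y \<and> pacc E y)"
      by (subst reaches_unfold) simp
    also have "\<dots> \<longleftrightarrow> (\<exists>(l, w, m)\<in>Y. pacc E (l @ k, eff s w m))"
      unfolding st by blast
    finally show ?thesis unfolding * .
  qed
  fix T' assume b: "\<forall>s'\<in>X. pbounded E (k, s') T'"
  show "pbounded E (c # k, s) (Suc T + T')"
    unfolding add_Suc bounded_runs_Suc st using **[OF b] by fast
qed

lemma runs_to_Act:
  "runs_to (Act a) s 1 {eff s w m | w m. (w, m) \<in> a (view s)}"
proof -
  have "runs_to (Act a) s (Suc 0) {eff s w m | w m. (w, m) \<in> a (view s)}"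
  proof (rule runs_to_unfold[where Y = "{([], w, m) | w m. (w, m) \<in> a (view s)}"])
    fix k show "ptrans (Act a # k) (view s) = (\<lambda>(l, w, m). (l @ k, w, m)) ` {([], w, m) |w m. (w, m) \<in> a (view s)}"
      by force
  qed auto
  then show ?thesis by simp
qed

lemma runs_to_Seq:
  assumes "runs_to c s T X" "\<And>s'. s' \<in> X \<Longrightarrow> runs_to d s' T' (Y s')"
  shows "runs_to (Seq c d) s (T + T' + 1) (\<Union>s'\<in>X. Y s')"
proof -
  have "runs_to (Seq c d) s (Suc (T + T')) (\<Union>s'\<in>X. Y s')"
  proof (rule runs_to_unfold[where Y = "{([c, d], view s, \<lambda>_. 0)}"])
    fix E k
    have "pacc E (c # d # k, s) \<longleftrightarrow> (\<exists>s'\<in>X. pacc E (d # k, s'))"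
      using assms(1) unfolding runs_to_def by blast
    also have "\<dots> \<longleftrightarrow> (\<exists>s'\<in>X. \<exists>u\<in>Y s'. pacc E (k, u))"
      using assms(2) unfolding runs_to_def by blast
    finally show "(\<exists>(l, w, m)\<in>{([c, d], view s, \<lambda>_. 0)}. pacc E (l @ k, eff s w m)) \<longleftrightarrow> (\<exists>s'\<in>\<Union> (Y ` X). pacc E (k, s'))"
      by simp
  next
    fix E k T'' l and w :: view and m :: moves assume b: "\<forall>s'\<in>\<Union> (Y ` X). pbounded E (k, s') T''"
      and "(l, w, m) \<in> {([c, d], view s, \<lambda>_. 0)}"
    then have e: "l = [c, d]" "eff s w m = s" by auto
    have "\<forall>s'\<in>X. pbounded E (d # k, s') (T' + T'')"
      using assms(2) b unfolding runs_to_def by blast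
    then have "pbounded E (c # d # k, s) (T + (T' + T''))"
      using assms(1) unfolding runs_to_def by blast
    then show "pbounded E (l @ k, eff s w m) (T + T' + T'')" by (simp add: e add.assoc)
  qed auto
  then show ?thesis by simp
qed

lemma runs_to_Seq1: "runs_to c s T {s'} \<Longrightarrow> runs_to d s' T' Y \<Longrightarrow> runs_to (Seq c d) s (T + T' + 1) Y"
  using runs_to_Seq[of c s T "{s'}" d T' "\<lambda>_. Y"] by simp

lemma runs_to_Seq0: "runs_to c s T {} \<Longrightarrow> runs_to (Seq c d) s (T + 1) {}"
  using runs_to_Seq[of c s T "{}" d 0 "\<lambda>_. {}"] by simp

lemma runs_to_Cond:
  assumes "runs_to (if g (view s) then c else d) s T X"
  shows "runs_to (Cond g c d) s (T + 1) X"
proof -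
  have "runs_to (Cond g c d) s (Suc T) X"
    by (rule runs_to_unfold[where Y = "{([if g (view s) then c else d], view s, \<lambda>_. 0)}"])
      (use assms in \<open>auto simp: runs_to_def split: if_splits\<close>)
  then show ?thesis by simp
qed

lemma runs_to_While_done: "\<not> g (view s) \<Longrightarrow> runs_to (While g c) s 1 {s}"
  unfolding One_nat_def by (rule runs_to_unfold[where Y = "{([], view s, \<lambda>_. 0)}"]) auto

lemma runs_to_While_step:
  assumes g: "g (view s)" and "runs_to c s T X" "\<And>s'. s' \<in> X \<Longrightarrow> runs_to (While g c) s' T' (Y s')"
  shows "runs_to (While g c) s (T + T' + 1) (\<Union>s'\<in>X. Y s')"
proof -
  have "runs_to (While g c) s (Suc (T + T')) (\<Union>s'\<in>X. Y s')"
  proof (rule runs_to_unfold[where Y = "{([c, While g c], view s, \<lambda>_. 0)}"])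
    fix E k
    have "pacc E (c # While g c # k, s) \<longleftrightarrow> (\<exists>s'\<in>X. pacc E (While g c # k, s'))"
      using assms(2) unfolding runs_to_def by blast
    also have "\<dots> \<longleftrightarrow> (\<exists>s'\<in>X. \<exists>u\<in>Y s'. pacc E (k, u))"
      using assms(3) unfolding runs_to_def by blast
    finally show "(\<exists>(l, w, m)\<in>{([c, While g c], view s, \<lambda>_. 0)}. pacc E (l @ k, eff s w m)) \<longleftrightarrow> (\<exists>s'\<in>\<Union> (Y ` X). pacc E (k, s'))"
      by simp
  next
    fix E k T'' l and w :: view and m :: moves assume b: "\<forall>s'\<in>\<Union> (Y ` X). pbounded E (k, s') T''"
      and "(l, w, m) \<in> {([c, While g c], view s, \<lambda>_. 0)}"
    then have e: "l = [c, While g c]" "eff s w m = s" by auto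
    have "\<forall>s'\<in>X. pbounded E (While g c # k, s') (T' + T'')"
      using assms(3) b unfolding runs_to_def by blast
    then have "pbounded E (c # While g c # k, s) (T + (T' + T''))"
      using assms(2) unfolding runs_to_def by blast
    then show "pbounded E (l @ k, eff s w m) (T + T' + T'')" by (simp add: e add.assoc)
  qed (use g in auto)
  then show ?thesis by simp
qed

lemma runs_to_While_step1:
  "g (view s) \<Longrightarrow> runs_to c s T {s'} \<Longrightarrow> runs_to (While g c) s' T' Y \<Longrightarrow> runs_to (While g c) s (T + T' + 1) Y"
  using runs_to_While_step[of g s c T "{s'}" T' "\<lambda>_. Y"] by simp

lemma runs_to_While_step0:
  "g (view s) \<Longrightarrow> runs_to c s T {} \<Longrightarrow> runs_to (While g c) s (T + 1) {}"
  using runs_to_While_step[of g s c T "{}" 0 "\<lambda>_. {}"] by simp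

definition Fail :: prog where
  "Fail = Act (\<lambda>_. {})"

definition Upd :: "(view \<Rightarrow> view) \<Rightarrow> moves \<Rightarrow> prog" where
  "Upd f m = Act (\<lambda>v. {(f v, m)})"

abbreviation Move :: "moves \<Rightarrow> prog" where
  "Move m \<equiv> Upd (\<lambda>v. v) m"

abbreviation Write :: "tp \<Rightarrow> nat \<Rightarrow> prog" where
  "Write x a \<equiv> Upd (\<lambda>v. v(x := a)) (\<lambda>_. 0)"

abbreviation Skip :: prog where
  "Skip \<equiv> Move (\<lambda>_. 0)"

lemma runs_to_Fail: "runs_to Fail s 1 {}"
  using runs_to_Act[of "\<lambda>_. {}" s] by (simp add: Fail_def)

lemma runs_to_Upd: "s' = eff s (f (view s)) m \<Longrightarrow> runs_to (Upd f m) s 1 {s'}"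
  using runs_to_Act[of "\<lambda>v. {(f v, m)}" s] by (simp add: Upd_def)

lemma runs_to_Skip: "runs_to Skip s 1 {s}"
  by (rule runs_to_Upd) simp

lemma prog_det_Upd [simp]: "prog_det (Upd f m)" and prog_det_Fail [simp]: "prog_det Fail"
  by (simp_all add: Upd_def Fail_def)

lemma prog_ok_Fail [simp]: "prog_ok n Fail"
  by (simp add: Fail_def act_ok_def)

lemma prog_ok_Upd: "(\<And>v. view_ok n v \<Longrightarrow> view_ok n (f v)) \<Longrightarrow> moves_ok n m \<Longrightarrow> prog_ok n (Upd f m)"
  by (simp add: Upd_def act_ok_def)

lemma view_ok_upd [simp]: "view_ok n v \<Longrightarrow> a < n \<Longrightarrow> x \<in> tset n \<Longrightarrow> view_ok n (v(x := a))"
  by (auto simp: view_ok_def)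

lemma view_ok_less [simp]: "view_ok n v \<Longrightarrow> v x < n"
  by (auto simp: view_ok_def)

lemma moves_ok_0 [simp]: "moves_ok n (\<lambda>_. 0)"
  by (simp add: moves_ok_def)

lemma moves_ok_upd [simp]: "moves_ok n m \<Longrightarrow> d \<in> {-1, 0, 1} \<Longrightarrow> x \<in> tset n \<Longrightarrow> moves_ok n (m(x := d))"
  by (auto simp: moves_ok_def)

lemma tset_simps [simp]:
  "Inp \<in> tset n" "Qry \<in> tset n" "Rg i \<in> tset n \<longleftrightarrow> i < n" "MT i \<in> tset n \<longleftrightarrow> i < n" "NT i \<in> tset n \<longleftrightarrow> i < n"
  by (auto simp: tset_def)

lemma runs_to_iterate:
  assumes body: "\<And>j. j < n \<Longrightarrow> runs_to c (\<sigma> j) T {\<sigma> (Suc j)}"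
    and guard: "\<And>j. j \<le> n \<Longrightarrow> g (view (\<sigma> j)) \<longleftrightarrow> j < n"
  shows "runs_to (While g c) (\<sigma> 0) (n * (T + 1) + 1) {\<sigma> n}"
proof -
  \<comment> \<open>The induction is on the number of rounds still to come, because the rule for
    loops unfolds the first round.\<close>
  have "runs_to (While g c) (\<sigma> (n - j)) (j * (T + 1) + 1) {\<sigma> n}" if "j \<le> n" for j
    using that
  proof (induction j)
    case 0
    then show ?case using runs_to_While_done[of g "\<sigma> n"] guard by simp
  next
    case (Suc j)
    then have "Suc (n - Suc j) = n - j" by simp
    then have "runs_to c (\<sigma> (n - Suc j)) T {\<sigma> (n - j)}" using body[of "n - Suc j"] Suc.prems by simp
    moreover have "g (view (\<sigma> (n - Suc j)))" using guard[of "n - Suc j"] Suc.prems by simp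
    ultimately have "runs_to (While g c) (\<sigma> (n - Suc j)) (T + (j * (T + 1) + 1) + 1) {\<sigma> n}"
      using Suc by (intro runs_to_While_step1) auto
    then show ?case by (rule runs_to_mono) simp
  qed
  from this[of n] show ?thesis by simp
qed

subsection \<open>Counters, registers and one-way tapes\<close>

text \<open>A counter is a tape whose only nonblank cell is cell 0; its value is the head position.\<close>

definition ctr :: "nat \<Rightarrow> tape" where
  "ctr n = (\<lambda>i. if i = 0 then 1 else 0, n)"

definition at_zero :: "tp \<Rightarrow> view \<Rightarrow> bool" where
  "at_zero x v \<longleftrightarrow> v x = 1"

text \<open>The tape with contents \<open>l\<close> whose head stands at the beginning of the suffix \<open>r\<close> of \<open>l\<close>.\<close>

definition rtape :: "nat list \<Rightarrow> nat list \<Rightarrow> tape" where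
  "rtape l r = (cells l, length l - length r)"

lemma scan_ctr: "scan (ctr n) = (if n = 0 then 1 else 0)"
  by (simp add: scan_def ctr_def)

lemma scan_reg [simp]: "scan (reg a) = a"
  by (simp add: scan_def reg_def)

lemma scan_rtape:
  assumes "suffix r l"
  shows "scan (rtape l r) = (case r of [] \<Rightarrow> 0 | a # _ \<Rightarrow> a)"
  using assms by (auto simp: suffix_def scan_def rtape_def cells_def nth_append split: list.splits)

lemma upd_ctr [simp]: "upd (ctr n) (scan (ctr n)) d = ctr (nat (int n + d))"
  by (auto simp: upd_def ctr_def scan_def fun_eq_iff)

lemma upd_reg [simp]: "upd (reg a) b 0 = reg b"
  by (auto simp: upd_def reg_def fun_eq_iff)

lemma upd_reg_ctr: "upd (reg 0) 1 0 = ctr 0"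
  by (auto simp: upd_def reg_def ctr_def fun_eq_iff)

lemma upd_scan [simp]: "upd x (scan x) 0 = x"
  by (cases x) (auto simp: upd_def scan_def)

lemma upd_scan_move: "upd x (scan x) d = (fst x, nat (int (snd x) + d))"
  by (cases x) (auto simp: upd_def scan_def)

lemma upd_rtape:
  assumes "suffix (a # r) l"
  shows "upd (rtape l (a # r)) (scan (rtape l (a # r))) 1 = rtape l r"
  using suffix_length_le[of "a # r" l] assms by (simp add: upd_scan_move) (simp add: rtape_def)

lemma cells_append: "(cells l)(length l := a) = cells (l @ [a])"
  by (auto simp: cells_def fun_eq_iff nth_append)

definition shift :: "int \<Rightarrow> nat \<Rightarrow> tape \<Rightarrow> tape" where
  "shift d n x = (fst x, if d = 1 then snd x + n else if d = -1 then snd x - n else snd x)"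

lemma shift_simps [simp]: "shift 0 n x = x" "shift 1 n (ctr k) = ctr (k + n)" "shift (-1) n (ctr k) = ctr (k - n)"
  "shift d 0 x = x"
  by (simp_all add: shift_def ctr_def)

abbreviation Drain :: "tp \<Rightarrow> prog \<Rightarrow> prog" where
  "Drain x c \<equiv> While (\<lambda>v. \<not> at_zero x v) c"

lemma at_zero_ctr: "s x = ctr n \<Longrightarrow> at_zero x (view s) \<longleftrightarrow> n = 0"
  by (simp add: at_zero_def view_def scan_ctr)

text \<open>One move vector repeated \<open>n\<close> times acts on all tapes in parallel, so the
  same loop transfers a counter to others and rewinds data tapes. The truncated subtraction in
  \<open>shift\<close> is what left moves amount to at the edge.\<close>

lemma runs_to_Drain_Move:
  assumes "s x = ctr n" "m x = -1" "\<And>y. m y \<in> {-1, 0, 1}"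
  shows "runs_to (Drain x (Move m)) s (2 * n + 1) {\<lambda>y. shift (m y) n (s y)}"
proof -
  let ?\<sigma> = "\<lambda>j y. shift (m y) j (s y)"
  have "runs_to (Drain x (Move m)) (?\<sigma> 0) (n * (1 + 1) + 1) {?\<sigma> n}"
  proof (rule runs_to_iterate)
    fix j assume "j < n"
    show "runs_to (Move m) (?\<sigma> j) 1 {?\<sigma> (Suc j)}"
    proof (rule runs_to_Upd, rule ext)
      fix y
      show "?\<sigma> (Suc j) y = eff (?\<sigma> j) (view (?\<sigma> j)) m y"
        using assms(3)[of y] by (auto simp: eff_def view_def upd_scan_move shift_def)
    qed
  next
    fix j assume "j \<le> n"
    then show "(\<not> at_zero x (view (?\<sigma> j))) \<longleftrightarrow> j < n"
      using assms(1,2) by (auto simp: at_zero_ctr[of _ _ "n - j"])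
  qed
  from runs_to_mono[OF this, of "2 * n + 1"] show ?thesis by simp
qed

subsection \<open>Complements of deterministic machines\<close>

text \<open>For a well-formed machine these are the situations in which a run ends without
  acceptance. Query states are left out because a query always has a successor; the old rejecting
  state is included.\<close>

definition undef_keys :: "tm \<Rightarrow> (nat \<times> nat list) set" where
  "undef_keys M = {(q, rd). q < tm_states M \<and> q \<noteq> tm_acc M \<and> q \<noteq> tm_qry M \<and>
     length rd = tm_tapes M \<and> set rd \<subseteq> {..<tm_syms M} \<and> (\<forall>q' wr mv. (q, rd, q', wr, mv) \<notin> tm_delta M)}"

text \<open>A deterministic machine rejects by getting stuck; the complement moves to a fresh accepting
  state instead, while the old accepting state takes the role of the rejecting one.\<close>

definition co_tm :: "tm \<Rightarrow> tm" where
  "co_tm M = M\<lparr> tm_states := Suc (tm_states M), tm_acc := tm_states M, tm_rej := tm_acc M,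
     tm_delta := tm_delta M \<union> (\<lambda>(q, rd). (q, rd, tm_states M, rd, replicate (tm_tapes M) 0)) ` undef_keys M \<rparr>"

lemma co_tm_sel [simp]:
  "tm_states (co_tm M) = Suc (tm_states M)" "tm_syms (co_tm M) = tm_syms M" "tm_tapes (co_tm M) = tm_tapes M"
  "tm_start (co_tm M) = tm_start M" "tm_acc (co_tm M) = tm_states M" "tm_rej (co_tm M) = tm_acc M"
  "tm_qry (co_tm M) = tm_qry M" "tm_yes (co_tm M) = tm_yes M" "tm_no (co_tm M) = tm_no M"
  by (simp_all add: co_tm_def)

lemma co_tm_delta:
  "d \<in> tm_delta (co_tm M) \<longleftrightarrow> d \<in> tm_delta M \<or>
     (\<exists>q rd. (q, rd) \<in> undef_keys M \<and> d = (q, rd, tm_states M, rd, replicate (tm_tapes M) 0))"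
  by (auto simp: co_tm_def)

lemma wf_delta:
  assumes "wf_tm M" "(q, rd, q', wr, mv) \<in> tm_delta M"
  shows "q < tm_states M" "q \<noteq> tm_acc M" "q \<noteq> tm_rej M" "q \<noteq> tm_qry M" "q' < tm_states M"
    "length rd = tm_tapes M" "length wr = tm_tapes M" "length mv = tm_tapes M"
    "\<And>s. s \<in> set rd \<Longrightarrow> s < tm_syms M" "\<And>s. s \<in> set wr \<Longrightarrow> s < tm_syms M"
    "\<And>m. m \<in> set mv \<Longrightarrow> m \<in> {-1, 0, 1}"
  using assms unfolding wf_tm_def by fast+

lemma wf_co_tm:
  assumes wf: "wf_tm M"
  shows "wf_tm (co_tm M)"
proof -
  have "undef_keys M \<subseteq> {..<tm_states M} \<times> {l. set l \<subseteq> {..<tm_syms M} \<and> length l = tm_tapes M}"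
    by (auto simp: undef_keys_def)
  then have "finite (undef_keys M)"
    by (rule finite_subset) (auto intro!: finite_lists_length_eq)
  moreover have "finite (tm_delta M)" using wf by (simp add: wf_tm_def)
  ultimately have fin: "finite (tm_delta (co_tm M))" by (simp add: co_tm_def)
  have B: "\<forall>(q, rd, q', wr, mv) \<in> tm_delta (co_tm M).
        q < tm_states (co_tm M) \<and> q \<notin> {tm_acc (co_tm M), tm_rej (co_tm M), tm_qry (co_tm M)} \<and> q' < tm_states (co_tm M) \<and>
        length rd = tm_tapes (co_tm M) \<and> length wr = tm_tapes (co_tm M) \<and> length mv = tm_tapes (co_tm M) \<and>
        (\<forall>s \<in> set rd. s < tm_syms (co_tm M)) \<and> (\<forall>s \<in> set wr. s < tm_syms (co_tm M)) \<and>
        (\<forall>m \<in> set mv. m \<in> {-1, 0, 1})"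
  proof (clarsimp, goal_cases)
    case (1 q rd q' wr mv)
    from 1 consider "(q, rd, q', wr, mv) \<in> tm_delta M"
      | "(q, rd) \<in> undef_keys M" "q' = tm_states M" "wr = rd" "mv = replicate (tm_tapes M) 0"
      by (auto simp: co_tm_delta)
    then show ?case
    proof cases
      case 1
      show ?thesis using wf_delta[OF wf 1] by (auto simp: less_Suc_eq)
    next
      case 2
      then show ?thesis by (auto simp: undef_keys_def)
    qed
  qed
  have "tm_syms M \<ge> 4" "tm_tapes M \<ge> 2" "tm_start M < tm_states M" "tm_acc M < tm_states M"
    "tm_qry M < tm_states M" "tm_yes M < tm_states M" "tm_no M < tm_states M" "tm_acc M \<noteq> tm_qry M"
    using wf by (auto simp: wf_tm_def)
  then show ?thesis using fin B unfolding wf_tm_def by simp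
qed

lemma det_co_tm:
  assumes "deterministic_tm M"
  shows "deterministic_tm (co_tm M)"
proof -
  have *: "q' = p' \<and> wr = wr2 \<and> mv = mv2"
    if "(q, rd, q', wr, mv) \<in> tm_delta M" "(q, rd, p', wr2, mv2) \<in> tm_delta M" for q rd q' wr mv p' wr2 mv2
    using assms that unfolding deterministic_tm_def by fast
  have "q' = p' \<and> wr = wr2 \<and> mv = mv2"
    if "(q, rd, q', wr, mv) \<in> tm_delta (co_tm M)" "(q, rd, p', wr2, mv2) \<in> tm_delta (co_tm M)"
    for q rd q' wr mv p' wr2 mv2
    using that * unfolding co_tm_delta by (auto simp: undef_keys_def)
  then show ?thesis unfolding deterministic_tm_def by fast
qed

definition mconf_ok :: "tm \<Rightarrow> nat \<times> (nat \<Rightarrow> tape) \<Rightarrow> bool" where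
  "mconf_ok M x \<longleftrightarrow> fst x < tm_states M \<and> (\<forall>i j. fst (snd x i) j < tm_syms M)"

lemma mconf_ok_mstep:
  assumes wf: "wf_tm M" and x: "mconf_ok M x" and st: "mstep M Ob x y"
  shows "mconf_ok M y"
proof (cases "fst x = tm_qry M")
  case True
  then show ?thesis using assms by (auto simp: mstep_def mconf_ok_def wf_tm_def)
next
  case False
  then obtain rd q' wr mv where d: "(fst x, rd, q', wr, mv) \<in> tm_delta M"
    and y: "y = (q', \<lambda>i. if i < tm_tapes M then upd (snd x i) (wr ! i) (mv ! i) else snd x i)"
    using st by (auto simp: mstep_def)
  have "wr ! i < tm_syms M" if "i < tm_tapes M" for i
    using wf_delta(7,10)[OF wf d] that by (metis nth_mem)
  then show ?thesis using x wf_delta(5)[OF wf d] by (auto simp: y mconf_ok_def upd_def)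
qed

lemma mstep_det:
  assumes "deterministic_tm M" "mstep M Ob x y" "mstep M Ob x z"
  shows "y = z"
proof (cases "fst x = tm_qry M")
  case False
  let ?rd = "map (\<lambda>i. scan (snd x i)) [0..<tm_tapes M]"
  obtain q wr mv where 1: "(fst x, ?rd, q, wr, mv) \<in> tm_delta M"
    "y = (q, \<lambda>i. if i < tm_tapes M then upd (snd x i) (wr ! i) (mv ! i) else snd x i)"
    using assms(2) False by (auto simp: mstep_def)
  obtain q' wr' mv' where 2: "(fst x, ?rd, q', wr', mv') \<in> tm_delta M"
    "z = (q', \<lambda>i. if i < tm_tapes M then upd (snd x i) (wr' ! i) (mv' ! i) else snd x i)"
    using assms(3) False by (auto simp: mstep_def)
  have "q = q'" "wr = wr'" "mv = mv'"
    using assms(1) 1(1) 2(1) unfolding deterministic_tm_def by fast+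
  then show ?thesis unfolding 1(2) 2(2) by (simp only:)
qed (use assms in \<open>simp add: mstep_def\<close>)

lemma no_mstep_acc:
  assumes "wf_tm M" "fst x = tm_acc M"
  shows "\<not> mstep M Ob x y"
  using assms wf_delta(2)[OF assms(1)] by (auto simp: mstep_def wf_tm_def)

text \<open>The complement copies every step of \<open>M\<close> and adds a step only where
  \<open>M\<close> is stuck outside its accepting state. That this added step exists relies on
  \<open>mconf_ok\<close>, by which the symbols read lie in the alphabet.\<close>

lemma mstep_co_tm:
  assumes wf: "wf_tm M" and x: "mconf_ok M x"
  shows "mstep M Ob x y \<Longrightarrow> mstep (co_tm M) Ob x y"
    and "mstep (co_tm M) Ob x y \<Longrightarrow> mstep M Ob x z \<Longrightarrow> mstep M Ob x y"
    and "mstep (co_tm M) Ob x y \<Longrightarrow> (\<And>z. \<not> mstep M Ob x z) \<Longrightarrow> fst y = tm_states M \<and> fst x \<noteq> tm_acc M"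
    and "(\<And>z. \<not> mstep M Ob x z) \<Longrightarrow> fst x \<noteq> tm_acc M \<Longrightarrow> \<exists>y. mstep (co_tm M) Ob x y \<and> fst y = tm_states M"
proof -
  let ?rd = "map (\<lambda>i. scan (snd x i)) [0..<tm_tapes M]"
  let ?y = "\<lambda>q wr mv. (q, \<lambda>i. if i < tm_tapes M then upd (snd x i) (wr ! i) (mv ! i) else snd x i)"
  show "mstep M Ob x y \<Longrightarrow> mstep (co_tm M) Ob x y"
    unfolding mstep_def co_tm_sel co_tm_delta by (auto split: if_splits)
  show "mstep M Ob x y" if 1: "mstep (co_tm M) Ob x y" and 2: "mstep M Ob x z"
  proof (cases "fst x = tm_qry M")
    case False
    then obtain q wr mv where "(fst x, ?rd, q, wr, mv) \<in> tm_delta M" using 2 by (auto simp: mstep_def)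
    then have "(fst x, ?rd) \<notin> undef_keys M" by (auto simp: undef_keys_def)
    then show ?thesis using 1 False unfolding mstep_def co_tm_sel co_tm_delta by auto
  qed (use 1 in \<open>simp add: mstep_def\<close>)
  show "fst y = tm_states M \<and> fst x \<noteq> tm_acc M" if 1: "mstep (co_tm M) Ob x y" and 2: "\<And>z. \<not> mstep M Ob x z"
  proof -
    have nq: "fst x \<noteq> tm_qry M" using 2 unfolding mstep_def by (metis (no_types, lifting))
    have nd: "(fst x, ?rd, q, wr, mv) \<notin> tm_delta M" for q wr mv
      using 2[of "?y q wr mv"] nq unfolding mstep_def by auto
    show ?thesis using 1 nq nd unfolding mstep_def co_tm_sel co_tm_delta
      by (auto simp: undef_keys_def)
  qed
  show "\<exists>y. mstep (co_tm M) Ob x y \<and> fst y = tm_states M" if 2: "\<And>z. \<not> mstep M Ob x z" and na: "fst x \<noteq> tm_acc M"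
  proof -
    have nq: "fst x \<noteq> tm_qry M" using 2 unfolding mstep_def by (metis (no_types, lifting))
    have nd: "(fst x, ?rd, q, wr, mv) \<notin> tm_delta M" for q wr mv
      using 2[of "?y q wr mv"] nq unfolding mstep_def by auto
    have "(fst x, ?rd) \<in> undef_keys M"
      using nq nd na x by (auto simp: undef_keys_def mconf_ok_def scan_def)
    then have d: "(fst x, ?rd, tm_states M, ?rd, replicate (tm_tapes M) 0) \<in> tm_delta (co_tm M)"
      unfolding co_tm_delta by blast
    have "mstep (co_tm M) Ob x (?y (tm_states M) ?rd (replicate (tm_tapes M) 0))"
      using d nq unfolding mstep_def co_tm_sel by auto
    then show ?thesis by (meson fst_conv)
  qed
qed

text \<open>Determinism makes the run unique, so failing to accept means that this one run gets
  stuck elsewhere. Exchanging acceptance and being stuck is then a complement, at the price of one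
  more step.\<close>

lemma co_tm_runs:
  assumes wf: "wf_tm M" and det: "deterministic_tm M"
  shows "mconf_ok M x \<Longrightarrow> bounded_runs (mstep M Ob) x T \<Longrightarrow>
    bounded_runs (mstep (co_tm M) Ob) x (Suc T) \<and>
    (reaches (mstep (co_tm M) Ob) (\<lambda>x. fst x = tm_states M) x \<longleftrightarrow> \<not> reaches (mstep M Ob) (\<lambda>x. fst x = tm_acc M) x)"
proof (induction T arbitrary: x rule: less_induct)
  case (less T)
  have nS: "fst x \<noteq> tm_states M" using less.prems(1) by (auto simp: mconf_ok_def)
  show ?case
  proof (cases "\<exists>z. mstep M Ob x z")
    case True
    then obtain z where z: "mstep M Ob x z" by blast
    obtain T' where T': "T = Suc T'" "bounded_runs (mstep M Ob) z T'"
      using bounded_runs_stepE[OF less.prems(2) z] .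
    have IH: "bounded_runs (mstep (co_tm M) Ob) z (Suc T') \<and>
      (reaches (mstep (co_tm M) Ob) (\<lambda>x. fst x = tm_states M) z \<longleftrightarrow> \<not> reaches (mstep M Ob) (\<lambda>x. fst x = tm_acc M) z)"
      using less.IH[of T' z] T' mconf_ok_mstep[OF wf less.prems(1) z] by simp
    have u: "mstep M Ob x y \<longleftrightarrow> y = z" for y using mstep_det[OF det z] z by blast
    have uc: "mstep (co_tm M) Ob x y \<longleftrightarrow> y = z" for y
      using mstep_co_tm(1,2)[OF wf less.prems(1)] u by blast
    have "fst x \<noteq> tm_acc M" using no_mstep_acc[OF wf] z by blast
    then have "reaches (mstep M Ob) (\<lambda>x. fst x = tm_acc M) x \<longleftrightarrow> reaches (mstep M Ob) (\<lambda>x. fst x = tm_acc M) z"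
      by (subst reaches_unfold) (simp add: u)
    moreover have "reaches (mstep (co_tm M) Ob) (\<lambda>x. fst x = tm_states M) x \<longleftrightarrow>
        reaches (mstep (co_tm M) Ob) (\<lambda>x. fst x = tm_states M) z"
      using nS by (subst reaches_unfold) (simp add: uc)
    ultimately show ?thesis using IH T'(1) by (simp add: bounded_runs_Suc[of _ x] uc)
  next
    case False
    then have st: "\<And>z. \<not> mstep M Ob x z" by blast
    have r: "reaches (mstep M Ob) (\<lambda>x. fst x = tm_acc M) x \<longleftrightarrow> fst x = tm_acc M"
      by (subst reaches_unfold) (simp add: st)
    have S: "\<not> mstep (co_tm M) Ob y z" if "fst y = tm_states M" for y z
      by (rule no_mstep_acc[OF wf_co_tm[OF wf]]) (simp add: that)
    have c1: "mstep (co_tm M) Ob x y \<Longrightarrow> fst y = tm_states M \<and> fst x \<noteq> tm_acc M" for y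
      using mstep_co_tm(3)[OF wf less.prems(1)] st by blast
    have "bounded_runs (mstep (co_tm M) Ob) x (Suc T)"
      unfolding bounded_runs_Suc using c1 S by (blast intro: bounded_runs_stuck)
    moreover have "reaches (mstep (co_tm M) Ob) (\<lambda>x. fst x = tm_states M) y" if "fst y = tm_states M" for y
      using that by (subst reaches_unfold) simp
    then have "reaches (mstep (co_tm M) Ob) (\<lambda>x. fst x = tm_states M) x \<longleftrightarrow> fst x \<noteq> tm_acc M"
      using nS c1 mstep_co_tm(4)[OF wf less.prems(1) st] by (subst reaches_unfold) blast
    ultimately show ?thesis using r by simp
  qed
qed

lemma mconf_ok_minit: "wf_tm M \<Longrightarrow> set inp \<subseteq> {..<4} \<Longrightarrow> mconf_ok M (minit M inp)"
proof -
  assume wf: "wf_tm M" and i: "set inp \<subseteq> {..<4}"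
  have "cells inp j < tm_syms M" for j
  proof (cases "j < length inp")
    case True
    then have "inp ! j \<in> {..<4}" using i nth_mem by blast
    then show ?thesis using True wf by (auto simp: cells_def wf_tm_def)
  qed (use wf in \<open>auto simp: cells_def wf_tm_def\<close>)
  then show ?thesis using wf by (auto simp: mconf_ok_def minit_def reg_def wf_tm_def)
qed

lemma set_enc: "set (enc x) \<subseteq> {..<4}"
  by (auto simp: enc_def enc_bit_def)

lemma set_enc3: "set (enc3 w t u) \<subseteq> {..<4}"
  using set_enc by (auto simp: enc3_def)

text \<open>Both directions rely on it: a certificate \<open>v\<close> witnesses the negation of
  \<open>S\<close>, and the search in NEXP looks for a \<open>v\<close> that violates
  \<open>S\<close>.\<close>

lemma polytime_pred3_not:
  assumes "polytime_pred3 R"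
  shows "polytime_pred3 (\<lambda>w t u. \<not> R w t u)"
proof -
  obtain M p where wf: "wf_tm M" and det: "deterministic_tm M" and
    M: "\<And>w t u. time_bounded M {} (enc3 w t u) (poly p (length w + length t + length u)) \<and>
              (R w t u \<longleftrightarrow> accepts M {} (enc3 w t u))"
    using assms unfolding polytime_pred3_def by blast
  have "time_bounded (co_tm M) {} (enc3 w t u) (poly (p + 1) (length w + length t + length u)) \<and>
      (\<not> R w t u \<longleftrightarrow> accepts (co_tm M) {} (enc3 w t u))" for w t u
  proof -
    have e: "minit (co_tm M) = minit M" by (simp add: minit_def fun_eq_iff)
    have M': "bounded_runs (mstep M {}) (minit M (enc3 w t u)) (poly p (length w + length t + length u))"
      "R w t u \<longleftrightarrow> reaches (mstep M {}) (\<lambda>x. fst x = tm_acc M) (minit M (enc3 w t u))"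
      using M[of w t u] unfolding accepts_iff_mstep[OF wf] time_bounded_iff_mstep[OF wf] by simp_all
    show ?thesis
      using co_tm_runs[OF wf det mconf_ok_minit[OF wf set_enc3[of w t u]] M'(1)] M'(2)
      unfolding accepts_iff_mstep[OF wf] time_bounded_iff_mstep[OF wf]
        accepts_iff_mstep[OF wf_co_tm[OF wf]] time_bounded_iff_mstep[OF wf_co_tm[OF wf]] e co_tm_sel
      by simp
  qed
  then show ?thesis unfolding polytime_pred3_def using wf_co_tm[OF wf] det_co_tm[OF det] by blast
qed

subsection \<open>Machines embedded into programs\<close>

text \<open>The state of the machine becomes one symbol in the register \<open>Rg r\<close>. This is
  why the alphabet of a program must also accommodate the state numbers of the machines that it
  simulates.\<close>

definition put :: "(nat \<Rightarrow> tp) \<Rightarrow> nat \<Rightarrow> nat \<times> (nat \<Rightarrow> tape) \<Rightarrow> store \<Rightarrow> store" where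
  "put b r x s = (\<lambda>z. if z = Rg r then reg (fst x) else if z \<in> range b then snd x (inv b z) else s z)"

lemma inj_blocks [simp]: "inj MT" "inj NT"
  by (simp_all add: inj_def)

lemma put_simps [simp]:
  "put b r x s (Rg r) = reg (fst x)"
  "put MT r x s (MT i) = snd x i" "put NT r x s (NT i) = snd x i"
  "put MT r x s (NT i) = s (NT i)" "put NT r x s (MT i) = s (MT i)"
  "j \<noteq> r \<Longrightarrow> put MT r x s (Rg j) = s (Rg j)" "j \<noteq> r \<Longrightarrow> put NT r x s (Rg j) = s (Rg j)"
  "put MT r x s Inp = s Inp" "put NT r x s Inp = s Inp"
  "put MT r x s Qry = s Qry" "put NT r x s Qry = s Qry"
  by (auto simp: put_def)

definition is_block :: "(nat \<Rightarrow> tp) \<Rightarrow> bool" where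
  "is_block b \<longleftrightarrow> b = MT \<or> b = NT"

lemma is_block_simps [simp]: "is_block MT" "is_block NT"
  by (auto simp: is_block_def)

lemma block_simps [simp]:
  assumes "is_block b"
  shows "inj b" "inv b (b i) = i" "put b r x s (b i) = snd x i" "b i \<noteq> Rg j" "b i \<noteq> Inp" "b i \<noteq> Qry"
    "Rg j \<notin> range b" "Inp \<notin> range b" "Rg j \<noteq> b i" "b i = b j \<longleftrightarrow> i = j" "b i \<in> tset n \<longleftrightarrow> i < n"
  using assms by (auto simp: is_block_def)

lemma put_other: "z \<noteq> Rg r \<Longrightarrow> z \<notin> range b \<Longrightarrow> put b r x s z = s z"
  by (simp add: put_def)

lemma put_upd: "z \<noteq> Rg r \<Longrightarrow> z \<notin> range b \<Longrightarrow> put b r x (s(z := t)) = (put b r x s)(z := t)"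
  by (auto simp: put_def fun_eq_iff)

lemma reg_eq_iff [simp]: "reg a = reg c \<longleftrightarrow> a = c"
  by (metis scan_reg)

type_synonym instr = "nat \<times> nat list \<times> nat \<times> nat list \<times> int list"

text \<open>Partial, because a choice string may name an instruction that does not apply; such a run
  fails.\<close>

definition fire :: "nat \<Rightarrow> instr \<Rightarrow> nat \<times> (nat \<Rightarrow> tape) \<Rightarrow> (nat \<times> (nat \<Rightarrow> tape)) option" where
  "fire k = (\<lambda>(q, rd, q', wr, mv) x.
     if fst x = q \<and> (\<forall>i<k. scan (snd x i) = rd ! i)
     then Some (q', \<lambda>i. if i < k then upd (snd x i) (wr ! i) (mv ! i) else snd x i) else None)"

lemma mstep_fire:
  assumes wf: "wf_tm M" and "fst x \<noteq> tm_qry M"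
  shows "mstep M Ob x y \<longleftrightarrow> (\<exists>d\<in>tm_delta M. fire (tm_tapes M) d x = Some y)"
proof -
  have *: "rd = map (\<lambda>i. scan (snd x i)) [0..<tm_tapes M] \<longleftrightarrow> (\<forall>i<tm_tapes M. scan (snd x i) = rd ! i)"
    if "length rd = tm_tapes M" for rd
    using that by (auto simp: list_eq_iff_nth_eq)
  show ?thesis
  proof
    assume "mstep M Ob x y"
    then obtain rd q' wr mv where d: "(fst x, rd, q', wr, mv) \<in> tm_delta M"
      and "rd = map (\<lambda>i. scan (snd x i)) [0..<tm_tapes M]"
      and "y = (q', \<lambda>i. if i < tm_tapes M then upd (snd x i) (wr ! i) (mv ! i) else snd x i)"
      using assms(2) by (auto simp: mstep_def)
    then show "\<exists>d\<in>tm_delta M. fire (tm_tapes M) d x = Some y"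
      by (intro bexI[OF _ d]) (auto simp: fire_def)
  next
    assume "\<exists>d\<in>tm_delta M. fire (tm_tapes M) d x = Some y"
    then obtain q rd q' wr mv where d: "(q, rd, q', wr, mv) \<in> tm_delta M"
      and f: "fire (tm_tapes M) (q, rd, q', wr, mv) x = Some y" by auto
    then show "mstep M Ob x y"
      using assms(2) *[OF wf_delta(6)[OF wf d]] by (auto simp: mstep_def fire_def split: if_splits)
  qed
qed

text \<open>The moves \<open>e\<close> act outside the simulated block within the same step, so that
  clocks and the reading head of a choice string advance together with the instruction.\<close>

definition fire_act :: "(nat \<Rightarrow> tp) \<Rightarrow> nat \<Rightarrow> nat \<Rightarrow> (instr \<Rightarrow> moves) \<Rightarrow> instr \<Rightarrow> view \<Rightarrow> (view \<times> moves) set" where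
  "fire_act b r k e = (\<lambda>d v. case d of (q, rd, q', wr, mv) \<Rightarrow>
     if v (Rg r) = q \<and> (\<forall>i<k. v (b i) = rd ! i)
     then {(\<lambda>z. if z = Rg r then q' else if z \<in> b ` {..<k} then wr ! inv b z else v z,
            \<lambda>z. if z \<in> b ` {..<k} then mv ! inv b z else e d z)} else {})"

definition bump :: "moves \<Rightarrow> store \<Rightarrow> store" where
  "bump m s = eff s (view s) m"

lemma bump_0 [simp]: "bump (\<lambda>_. 0) s = s"
  by (simp add: bump_def)

lemma fire_act_eff:
  assumes b: "is_block b" and e: "\<And>i. e d (b i) = 0" "e d (Rg r) = 0"
  shows "{eff (put b r x s) w m | w m. (w, m) \<in> fire_act b r k e d (view (put b r x s))} =
    (case fire k d x of None \<Rightarrow> {} | Some y \<Rightarrow> {put b r y (bump (e d) s)})"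
proof -
  obtain q rd q' wr mv where d: "d = (q, rd, q', wr, mv)" by (metis prod_cases5)
  have v: "view (put b r x s) (b i) = scan (snd x i)" "view (put b r x s) (Rg r) = fst x" for i
    using b by (auto simp: view_def)
  show ?thesis
  proof (cases "fst x = q \<and> (\<forall>i<k. scan (snd x i) = rd ! i)")
    case True
    define W where "W = (\<lambda>z. if z = Rg r then q' else if z \<in> b ` {..<k} then wr ! inv b z else view (put b r x s) z)"
    define N where "N = (\<lambda>z. if z \<in> b ` {..<k} then mv ! inv b z else e d z)"
    have E: "eff (put b r x s) W N z = put b r (q', \<lambda>i. if i < k then upd (snd x i) (wr ! i) (mv ! i) else snd x i) (bump (e d) s) z" for z
    proof (cases "z \<in> range b")
      case True
      then obtain i where "z = b i" by blast
      then show ?thesis using b e by (auto simp: W_def N_def eff_def view_def image_iff)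
    next
      case False
      then have "z \<notin> b ` {..<k}" by blast
      then show ?thesis using False e b by (auto simp: W_def N_def eff_def put_def bump_def view_def)
    qed
    have "fire_act b r k e d (view (put b r x s)) = {(W, N)}"
      using True by (simp add: d fire_act_def v W_def N_def cong del: if_weak_cong)
    moreover have "fire k d x = Some (q', \<lambda>i. if i < k then upd (snd x i) (wr ! i) (mv ! i) else snd x i)"
      using True by (simp add: d fire_def)
    ultimately show ?thesis using ext[of "eff (put b r x s) W N", OF E] by simp
  next
    case False
    then show ?thesis by (auto simp: d fire_act_def fire_def v)
  qed
qed

lemma runs_to_fire:
  assumes "is_block b" "\<And>i. e d (b i) = 0" "e d (Rg r) = 0"
  shows "runs_to (Act (fire_act b r k e d)) (put b r x s) 1
    (case fire k d x of None \<Rightarrow> {} | Some y \<Rightarrow> {put b r y (bump (e d) s)})"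
  using runs_to_Act[of "fire_act b r k e d" "put b r x s"] fire_act_eff[where e = e and d = d, OF assms, of x s k] by simp

lemma act_ok_fire:
  assumes wf: "wf_tm M" and d: "d \<in> tm_delta M" and b: "is_block b"
    and n: "tm_states M \<le> n" "tm_syms M \<le> n" "tm_tapes M \<le> n" "r < n" and e: "moves_ok n (e d)"
  shows "act_ok n (fire_act b r (tm_tapes M) e d)"
proof -
  obtain q rd q' wr mv where d': "d = (q, rd, q', wr, mv)" by (metis prod_cases5)
  note w = wf_delta[OF wf d[unfolded d']]
  have 1: "wr ! i < n" if "i < tm_tapes M" for i using w(7,10) n that by (metis nth_mem less_le_trans)
  have 2: "mv ! i \<in> {-1, 0, 1}" if "i < tm_tapes M" for i using w(8,11) that by (metis nth_mem)
  have 3: "z \<in> tset n" if "z \<in> b ` {..<tm_tapes M}" for z using that b n by auto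
  show ?thesis
    unfolding act_ok_def
  proof (intro allI impI)
    fix v w m assume v: "view_ok n v" and "(w, m) \<in> fire_act b r (tm_tapes M) e d v"
    then have wm: "w = (\<lambda>z. if z = Rg r then q' else if z \<in> b ` {..<tm_tapes M} then wr ! inv b z else v z)"
      "m = (\<lambda>z. if z \<in> b ` {..<tm_tapes M} then mv ! inv b z else e d z)"
      by (auto simp: fire_act_def d' split: if_splits)
    have "q' < n" using w(5) n by simp
    then have "view_ok n w" using v 1 3 n b unfolding wm view_ok_def by (auto simp: image_iff)
    moreover have "moves_ok n m"
      unfolding moves_ok_def
    proof (intro conjI allI impI)
      fix z show "m z \<in> {-1, 0, 1}"
      proof (cases "z \<in> b ` {..<tm_tapes M}")
        case True
        then obtain i where "z = b i" "i < tm_tapes M" by blast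
        then show ?thesis using 2[of i] b by (simp add: wm)
      next
        case False
        then show ?thesis using e by (simp add: wm moves_ok_def)
      qed
    qed (use e 3 in \<open>auto simp: wm moves_ok_def\<close>)
    ultimately show "view_ok n w \<and> moves_ok n m" by blast
  qed
qed

text \<open>The simulated machines have the empty oracle, hence a query amounts to a jump to the
  state for the answer no.\<close>

definition sim :: "tm \<Rightarrow> (nat \<Rightarrow> tp) \<Rightarrow> nat \<Rightarrow> prog" where
  "sim M b r = While (\<lambda>v. v (Rg r) \<noteq> tm_acc M)
     (Cond (\<lambda>v. v (Rg r) = tm_qry M) (Write (Rg r) (tm_no M))
       (Act (\<lambda>v. \<Union>d\<in>tm_delta M. fire_act b r (tm_tapes M) (\<lambda>_ _. 0) d v)))"

lemma prog_ok_sim: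
  assumes "wf_tm M" "is_block b" "tm_states M \<le> n" "tm_syms M \<le> n" "tm_tapes M \<le> n" "r < n"
  shows "prog_ok n (sim M b r)"
proof -
  have "tm_no M < n" using assms by (auto simp: wf_tm_def)
  moreover have "act_ok n (\<lambda>v. \<Union>d\<in>tm_delta M. fire_act b r (tm_tapes M) (\<lambda>_ _. 0) d v)"
    using act_ok_fire[OF assms(1) _ assms(2-6), of _ "\<lambda>_ _. 0"] unfolding act_ok_def by (simp, blast)
  ultimately show ?thesis using assms(6) by (auto simp: sim_def intro!: prog_ok_Upd)
qed

lemma view_put [simp]: "view (put b r x s) (Rg r) = fst x"
  by (simp add: view_def)

lemma runs_to_Write_put: "is_block b \<Longrightarrow> runs_to (Write (Rg r) a) (put b r x s) 1 {put b r (a, snd x) s}"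
  by (rule runs_to_Upd) (auto simp: fun_eq_iff eff_def put_def view_def)

text \<open>A simulated step costs three: the loop test, the test for the query state and the
  action. The additional 3 covers the end of the run, which is either a last loop test or a round
  that gets stuck.\<close>

lemma runs_to_sim:
  assumes wf: "wf_tm M" and b: "is_block b"
  shows "bounded_runs (mstep M {}) x T \<Longrightarrow>
    runs_to (sim M b r) (put b r x s) (3 * T + 3)
      {put b r y s | y. (mstep M {})\<^sup>*\<^sup>* x y \<and> fst y = tm_acc M}"
proof (induction T arbitrary: x rule: less_induct)
  case (less T)
  let ?X = "\<lambda>x. {put b r y s | y. (mstep M {})\<^sup>*\<^sup>* x y \<and> fst y = tm_acc M}"
  show ?case
  proof (cases "fst x = tm_acc M")
    case True
    have "y = x" if "(mstep M {})\<^sup>*\<^sup>* x y" for y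
      using that no_mstep_acc[OF wf True] by (metis converse_rtranclpE)
    then have "(mstep M {})\<^sup>*\<^sup>* x y \<and> fst y = tm_acc M \<longleftrightarrow> y = x" for y using True by blast
    then have "?X x = {put b r x s}" by (cases x) simp
    moreover have "runs_to (sim M b r) (put b r x s) 1 {put b r x s}"
      unfolding sim_def by (rule runs_to_While_done) (simp add: True)
    ultimately show ?thesis by (auto intro: runs_to_mono)
  next
    case False
    let ?c = "Cond (\<lambda>v. v (Rg r) = tm_qry M) (Write (Rg r) (tm_no M))
       (Act (\<lambda>v. \<Union>d\<in>tm_delta M. fire_act b r (tm_tapes M) (\<lambda>_ _. 0) d v))"
    have body: "runs_to ?c (put b r x s) (1 + 1) {put b r y s | y. mstep M {} x y}"
    proof (rule runs_to_Cond, cases "fst x = tm_qry M")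
      case True
      have "{put b r y s | y. mstep M {} x y} = {put b r (tm_no M, snd x) s}"
        using True by (auto simp: mstep_def)
      then show "runs_to (if view (put b r x s) (Rg r) = tm_qry M then Write (Rg r) (tm_no M)
         else Act (\<lambda>v. \<Union>d\<in>tm_delta M. fire_act b r (tm_tapes M) (\<lambda>_ _. 0) d v)) (put b r x s) 1
         {put b r y s | y. mstep M {} x y}"
        using True runs_to_Write_put[OF b] by simp
    next
      case False
      let ?a = "\<lambda>v. \<Union>d\<in>tm_delta M. fire_act b r (tm_tapes M) (\<lambda>_ _. 0) d v"
      have "{eff (put b r x s) w m | w m. (w, m) \<in> ?a (view (put b r x s))} =
        (\<Union>d\<in>tm_delta M. {eff (put b r x s) w m | w m. (w, m) \<in> fire_act b r (tm_tapes M) (\<lambda>_ _. 0) d (view (put b r x s))})"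
        by blast
      also have "\<dots> = (\<Union>d\<in>tm_delta M. case fire (tm_tapes M) d x of None \<Rightarrow> {} | Some y \<Rightarrow> {put b r y s})"
        using fire_act_eff[OF b, of "\<lambda>_ _. 0" _ r x s "tm_tapes M"] by (simp cong: option.case_cong)
      also have "\<dots> = {put b r y s | y. mstep M {} x y}"
        unfolding mstep_fire[OF wf False] by (auto split: option.splits, blast)
      finally show "runs_to (if view (put b r x s) (Rg r) = tm_qry M then Write (Rg r) (tm_no M) else Act ?a) (put b r x s) 1
         {put b r y s | y. mstep M {} x y}"
        using False runs_to_Act[of ?a "put b r x s"] by simp
    qed
    show ?thesis
    proof (cases T)
      case 0
      have none: "\<not> mstep M {} x y" for y using less.prems bounded_runs_stepE 0 by (metis nat.distinct(1))
      then have "y = x" if "(mstep M {})\<^sup>*\<^sup>* x y" for y using that by (metis converse_rtranclpE)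
      then have "\<not> ((mstep M {})\<^sup>*\<^sup>* x y \<and> fst y = tm_acc M)" for y using False by blast
      then have "?X x = {}" by blast
      moreover have "runs_to (sim M b r) (put b r x s) (1 + 1 + 1) {}"
        unfolding sim_def using none body False by (intro runs_to_While_step0) auto
      ultimately show ?thesis by (auto intro: runs_to_mono)
    next
      case (Suc T')
      \<comment> \<open>\<open>runs_to_While_step\<close> indexes outcomes by stores, so a
        configuration has to be recovered from its store; hence the injectivity of
        \<open>put\<close> below.\<close>
      let ?I = "\<lambda>u. {put b r z s | y z. u = put b r y s \<and> mstep M {} x y \<and> (mstep M {})\<^sup>*\<^sup>* y z \<and> fst z = tm_acc M}"
      have inj: "put b r y s = put b r z s \<Longrightarrow> y = z" for y z
      proof (rule prod_eqI)
        assume e: "put b r y s = put b r z s"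
        show "fst y = fst z" using fun_cong[OF e, of "Rg r"] by simp
        show "snd y = snd z"
        proof
          fix i show "snd y i = snd z i" using fun_cong[OF e, of "b i"] b by simp
        qed
      qed
      have "runs_to (sim M b r) (put b r x s) (1 + 1 + (3 * T' + 3) + 1) (\<Union>u\<in>{put b r y s | y. mstep M {} x y}. ?I u)"
        unfolding sim_def
      proof (rule runs_to_While_step[OF _ body])
        fix u assume "u \<in> {put b r y s | y. mstep M {} x y}"
        then obtain y where y: "u = put b r y s" "mstep M {} x y" by blast
        have "bounded_runs (mstep M {}) y T'" using less.prems y(2) unfolding Suc bounded_runs_Suc by blast
        then have "runs_to (sim M b r) u (3 * T' + 3) (?X y)" using less.IH[of T' y] Suc y by simp
        moreover have "?I u = ?X y" unfolding y(1) using inj y(2) by blast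
        ultimately show "runs_to (While (\<lambda>v. v (Rg r) \<noteq> tm_acc M) ?c) u (3 * T' + 3) (?I u)"
          unfolding sim_def by simp
      qed (use False in simp)
      moreover have "(\<Union>u\<in>{put b r y s | y. mstep M {} x y}. ?I u) = ?X x"
      proof -
        have "(\<Union>u\<in>{put b r y s | y. mstep M {} x y}. ?I u) = (\<Union>y\<in>{y. mstep M {} x y}. ?I (put b r y s))"
          by blast
        also have "\<dots> = (\<Union>y\<in>{y. mstep M {} x y}. ?X y)"
          by (rule SUP_cong) (use inj in blast)+
        also have "\<dots> = {put b r z s | z. \<exists>y. mstep M {} x y \<and> (mstep M {})\<^sup>*\<^sup>* y z \<and> fst z = tm_acc M}"
          by blast
        finally have e: "(\<Union>u\<in>{put b r y s | y. mstep M {} x y}. ?I u) =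
          {put b r z s | z. \<exists>y. mstep M {} x y \<and> (mstep M {})\<^sup>*\<^sup>* y z \<and> fst z = tm_acc M}" .
        have "(mstep M {})\<^sup>*\<^sup>* x z \<and> fst z = tm_acc M \<longleftrightarrow>
            (\<exists>y. mstep M {} x y \<and> (mstep M {})\<^sup>*\<^sup>* y z \<and> fst z = tm_acc M)" for z
          using False by (metis converse_rtranclpE converse_rtranclp_into_rtranclp)
        then show ?thesis unfolding e by simp
      qed
      ultimately show ?thesis using Suc by (auto intro: runs_to_mono)
    qed
  qed
qed

lemma reaches_rtranclp: "reaches r P x \<longleftrightarrow> (\<exists>y. r\<^sup>*\<^sup>* x y \<and> P y)"
  unfolding reaches_def by (metis rtranclp_power)

subsection \<open>Choice strings\<close>

text \<open>The string \<open>0\<^sup>j1\<close> selects the instruction with index \<open>j\<close> of a list.\<close>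

fun pick :: "instr list \<Rightarrow> bool list \<Rightarrow> (instr \<times> bool list) option" where
  "pick (d # ds) (True # bs) = Some (d, bs)"
| "pick (d # ds) (False # bs) = pick ds bs"
| "pick _ _ = None"

lemma pick_length: "pick ds bs = Some (d, bs') \<Longrightarrow> length bs' < length bs"
  by (induction ds bs rule: pick.induct) auto

lemma pick_mem: "pick ds bs = Some (d, bs') \<Longrightarrow> d \<in> set ds"
  by (induction ds bs rule: pick.induct) auto

lemma pick_suffix: "pick ds bs = Some (d, bs') \<Longrightarrow> suffix bs' bs"
  by (induction ds bs rule: pick.induct) (auto simp: suffix_Cons)

text \<open>Index words are prefix-free, so the word for \<open>d\<close> acts in the same way in
  front of any rest and words can be concatenated along a run. The length is the index plus one,
  hence at most \<open>length ds\<close>.\<close>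

lemma pick_complete: "d \<in> set ds \<Longrightarrow> \<exists>bs. length bs \<le> length ds \<and> (\<forall>rest. pick ds (bs @ rest) = Some (d, rest))"
proof (induction ds)
  case (Cons e ds)
  show ?case
  proof (cases "d = e")
    case True
    then show ?thesis by (intro exI[of _ "[True]"]) auto
  next
    case False
    then obtain bs where "length bs \<le> length ds" "\<forall>rest. pick ds (bs @ rest) = Some (d, rest)"
      using Cons by auto
    then show ?thesis by (intro exI[of _ "False # bs"]) auto
  qed
qed simp

definition move1 :: "tp \<Rightarrow> int \<Rightarrow> moves" where
  "move1 x d = (\<lambda>_. 0)(x := d)"

definition turn :: "tape \<Rightarrow> int \<Rightarrow> tape" where
  "turn t d = (fst t, nat (int (snd t) + d))"

lemma turn_ctr [simp]: "turn (ctr n) d = ctr (nat (int n + d))"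
  by (simp add: turn_def ctr_def)

lemma bump_move1: "bump (move1 x d) s = s(x := turn (s x) d)"
  by (auto simp: bump_def move1_def eff_def view_def upd_scan_move turn_def fun_eq_iff)

lemma bump_move2: "x \<noteq> y \<Longrightarrow> bump ((move1 x d)(y := d')) s = s(x := turn (s x) d, y := turn (s y) d')"
  by (auto simp: bump_def move1_def eff_def view_def upd_scan_move turn_def fun_eq_iff)

lemma runs_to_Move: "runs_to (Move m) s 1 {bump m s}"
  by (rule runs_to_Upd) (simp add: bump_def)

lemma turn_rtape: "suffix (a # r) l \<Longrightarrow> turn (rtape l (a # r)) 1 = rtape l r"
  using upd_rtape[of a r l] by (simp add: upd_scan_move turn_def)

text \<open>\<open>guided\<close> reads the index of an instruction from the tape \<open>src\<close> and fires this instruction; meanwhile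
  the head of tape \<open>c\<close> moves by \<open>h\<close>.\<close>

fun guided :: "(nat \<Rightarrow> tp) \<Rightarrow> nat \<Rightarrow> nat \<Rightarrow> tp \<Rightarrow> tp \<Rightarrow> (instr \<Rightarrow> int) \<Rightarrow> instr list \<Rightarrow> prog" where
  "guided b r k src c h [] = Fail"
| "guided b r k src c h (d # ds) =
     Cond (\<lambda>v. v src = 2) (Act (fire_act b r k (\<lambda>d. (move1 c (h d))(src := 1)) d))
       (Cond (\<lambda>v. v src = 1) (Seq (Move (move1 src 1)) (guided b r k src c h ds)) Fail)"

lemma prog_det_guided: "prog_det (guided b r k src c h ds)"
  by (induction ds) (auto simp: fire_act_def split: if_splits)

lemma prog_ok_guided:
  assumes "wf_tm M" "set ds \<subseteq> tm_delta M" "is_block b" "tm_states M \<le> n" "tm_syms M \<le> n" "tm_tapes M \<le> n" "r < n"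
    and "\<And>d. d \<in> set ds \<Longrightarrow> h d \<in> {-1, 0, 1}" "src \<in> tset n" "c \<in> tset n"
  shows "prog_ok n (guided b r (tm_tapes M) src c h ds)"
  using assms
proof (induction ds)
  case (Cons d ds)
  have "act_ok n (fire_act b r (tm_tapes M) (\<lambda>d. (move1 c (h d))(src := 1)) d)"
    using Cons.prems by (intro act_ok_fire) (auto simp: move1_def)
  then show ?case using Cons by (auto simp: move1_def intro!: prog_ok_Upd)
qed simp

lemma enc_simps [simp]: "enc [] = []" "enc (x # xs) = enc_bit x # enc xs" "enc (xs @ ys) = enc xs @ enc ys" "length (enc xs) = length xs"
  by (simp_all add: enc_def)

text \<open>Passing over an instruction costs four steps: two tests, a sequencing step and a move.
  The additional 1 is the failure at the end of the list.\<close>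

lemma runs_to_guided:
  assumes b: "is_block b" and src: "src \<noteq> Rg r" "src \<notin> range b" "c \<noteq> Rg r" "c \<notin> range b" "c \<noteq> src"
  shows "s src = rtape l (enc bs) \<Longrightarrow> suffix (enc bs) l \<Longrightarrow>
    runs_to (guided b r k src c h ds) (put b r x s) (4 * length ds + 1)
      (case pick ds bs of None \<Rightarrow> {} | Some (d, bs') \<Rightarrow>
        (case fire k d x of None \<Rightarrow> {} | Some y \<Rightarrow> {put b r y (s(c := turn (s c) (h d), src := rtape l (enc bs')))}))"
proof (induction ds arbitrary: bs s)
  case Nil
  then show ?case using runs_to_Fail by simp
next
  case (Cons d ds)
  have v: "view (put b r x s) src = (case bs of [] \<Rightarrow> 0 | a # _ \<Rightarrow> enc_bit a)"
    using src Cons.prems scan_rtape[OF Cons.prems(2)] by (simp add: view_def put_other split: list.splits)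
  let ?e = "\<lambda>d. (move1 c (h d))(src := 1)"
  show ?case
  proof (cases bs)
    case Nil
    have "runs_to (Cond (\<lambda>v. v src = 1) (Seq (Move (move1 src 1)) (guided b r k src c h ds)) Fail) (put b r x s) (1 + 1) {}"
      by (rule runs_to_Cond) (use v Nil runs_to_Fail in simp)
    then have "runs_to (guided b r k src c h (d # ds)) (put b r x s) (1 + 1 + 1) {}"
      unfolding guided.simps by (intro runs_to_Cond) (use v Nil in simp)
    then show ?thesis using Nil by (auto intro: runs_to_mono)
  next
    case (Cons a bs')
    note bs = Cons
    have suf: "suffix (enc bs') l" using Cons.prems(2) bs by (auto intro: suffix_ConsD)
    have tn: "turn (s src) 1 = rtape l (enc bs')"
      using Cons.prems bs by (simp add: turn_rtape)
    show ?thesis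
    proof (cases a)
      case True
      have eq: "bump (?e d) s = s(c := turn (s c) (h d), src := rtape l (enc bs'))"
        using src tn by (simp add: bump_move2)
      have e0: "?e d (b i) = 0" "?e d (Rg r) = 0" for i using src by (auto simp: move1_def)
      have "runs_to (Act (fire_act b r k ?e d)) (put b r x s) 1
          (case fire k d x of None \<Rightarrow> {} | Some y \<Rightarrow> {put b r y (bump (?e d) s)})"
        by (rule runs_to_fire[where e = ?e and d = d, OF b e0])
      then have "runs_to (guided b r k src c h (d # ds)) (put b r x s) (1 + 1)
          (case fire k d x of None \<Rightarrow> {} | Some y \<Rightarrow> {put b r y (bump (?e d) s)})"
        unfolding guided.simps by (intro runs_to_Cond) (use v bs True in \<open>simp add: enc_bit_def\<close>)
      then show ?thesis
        unfolding eq by (rule runs_to_eq) (use bs True in simp_all)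
    next
      case False
      have "runs_to (Move (move1 src 1)) (put b r x s) 1 {put b r x (s(src := rtape l (enc bs')))}"
        using runs_to_Move[of "move1 src 1" "put b r x s"] src tn by (simp add: bump_move1 put_upd put_other)
      moreover have "runs_to (guided b r k src c h ds) (put b r x (s(src := rtape l (enc bs')))) (4 * length ds + 1)
         (case pick ds bs' of None \<Rightarrow> {} | Some (d, bs'') \<Rightarrow>
        (case fire k d x of None \<Rightarrow> {} | Some y \<Rightarrow> {put b r y (s(c := turn (s c) (h d), src := rtape l (enc bs'')))}))"
      proof -
        have "(s(src := t))(c := turn ((s(src := t)) c) i, src := t') = s(c := turn (s c) i, src := t')" for t t' i
          using src by (auto simp: fun_eq_iff)
        then show ?thesis
          using Cons.IH[of "s(src := rtape l (enc bs'))" bs', OF _ suf] by (simp only: fun_upd_same refl simp_thms)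
      qed
      ultimately have "runs_to (Seq (Move (move1 src 1)) (guided b r k src c h ds)) (put b r x s) (1 + (4 * length ds + 1) + 1)
          (case pick ds bs' of None \<Rightarrow> {} | Some (d, bs'') \<Rightarrow>
        (case fire k d x of None \<Rightarrow> {} | Some y \<Rightarrow> {put b r y (s(c := turn (s c) (h d), src := rtape l (enc bs'')))}))"
        by (rule runs_to_Seq1)
      then have "runs_to (Cond (\<lambda>v. v src = 1) (Seq (Move (move1 src 1)) (guided b r k src c h ds)) Fail) (put b r x s) (1 + (4 * length ds + 1) + 1 + 1)
          (case pick ds bs' of None \<Rightarrow> {} | Some (d, bs'') \<Rightarrow>
        (case fire k d x of None \<Rightarrow> {} | Some y \<Rightarrow> {put b r y (s(c := turn (s c) (h d), src := rtape l (enc bs'')))}))"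
        by (intro runs_to_Cond) (use v bs False in \<open>simp add: enc_bit_def\<close>)
      then have "runs_to (guided b r k src c h (d # ds)) (put b r x s) (1 + (4 * length ds + 1) + 1 + 1 + 1)
          (case pick ds bs' of None \<Rightarrow> {} | Some (d, bs'') \<Rightarrow>
        (case fire k d x of None \<Rightarrow> {} | Some y \<Rightarrow> {put b r y (s(c := turn (s c) (h d), src := rtape l (enc bs'')))}))"
        unfolding guided.simps by (intro runs_to_Cond) (use v bs False in \<open>simp add: enc_bit_def\<close>)
      then show ?thesis using bs False by (auto intro: runs_to_mono)
    qed
  qed
qed

subsection \<open>Simulation of a nondeterministic machine along a choice string\<close>

lemma suffix_enc: "suffix a b \<Longrightarrow> suffix (enc a) (enc b)"
  by (auto simp: suffix_def)

lemma reg_0: "reg 0 = (\<lambda>_. 0, 0)"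
  by (auto simp: reg_def)

text \<open>A bound on everything that a simulated machine may have touched. Its tapes can contain
  blanks amid data, so only such a bound tells a later cleaning how far to go.\<close>

definition tidy :: "nat \<Rightarrow> nat \<Rightarrow> nat \<times> (nat \<Rightarrow> tape) \<Rightarrow> bool" where
  "tidy k n x \<longleftrightarrow> (\<forall>i. snd (snd x i) \<le> n \<and> (\<forall>p\<ge>n. fst (snd x i) p = 0)) \<and> (\<forall>i\<ge>k. snd x i = reg 0)"

lemma tidy_fire:
  assumes wf: "wf_tm M" and d: "d \<in> tm_delta M" and f: "fire (tm_tapes M) d x = Some y" and x: "tidy (tm_tapes M) n x"
  shows "tidy (tm_tapes M) (Suc n) y"
proof -
  obtain q rd q' wr mv where d': "d = (q, rd, q', wr, mv)" by (metis prod_cases5)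
  have y: "y = (q', \<lambda>i. if i < tm_tapes M then upd (snd x i) (wr ! i) (mv ! i) else snd x i)"
    using f by (auto simp: fire_def d' split: if_splits)
  have "mv ! i \<le> 1" if "i < tm_tapes M" for i
  proof -
    have "mv ! i \<in> {-1, 0, 1}"
      using wf_delta(8,11)[OF wf d[unfolded d']] that by (metis nth_mem)
    then show ?thesis by auto
  qed
  moreover have "snd (snd x i) \<le> n" "p \<ge> n \<Longrightarrow> fst (snd x i) p = 0" for i p
    using x by (auto simp: tidy_def)
  ultimately have "snd (snd y i) \<le> Suc n \<and> (\<forall>p\<ge>Suc n. fst (snd y i) p = 0)" for i
  proof (cases "i < tm_tapes M")
    case True
    then have "int (snd (snd x i)) + mv ! i \<le> int (Suc n)"
      using \<open>\<And>i. i < tm_tapes M \<Longrightarrow> mv ! i \<le> 1\<close>[OF True] \<open>\<And>i. snd (snd x i) \<le> n\<close>[of i] by simp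
    then show ?thesis
      using True \<open>\<And>i. snd (snd x i) \<le> n\<close>[of i] \<open>\<And>p i. p \<ge> n \<Longrightarrow> fst (snd x i) p = 0\<close>
      by (auto simp: y upd_def)
  next
    case False
    then show ?thesis
      using \<open>\<And>i. snd (snd x i) \<le> n\<close>[of i] \<open>\<And>p i. p \<ge> n \<Longrightarrow> fst (snd x i) p = 0\<close>
      by (auto simp: y le_SucI)
  qed
  then show ?thesis using x by (auto simp: tidy_def y)
qed

lemma tidy_mono: "tidy k n x \<Longrightarrow> n \<le> m \<Longrightarrow> tidy k m x"
  by (auto simp: tidy_def intro: le_trans)

text \<open>The unread rest is returned so that certificates for several queries can follow one
  another in one string. A query step consumes a bit as well, although it offers no choice: thus
  every step shortens the string, which gives termination and makes its length a time bound.\<close>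

function guided_run :: "tm \<Rightarrow> instr list \<Rightarrow> nat \<times> (nat \<Rightarrow> tape) \<Rightarrow> bool list \<Rightarrow> bool list option" where
  "guided_run M ds x bs =
     (if fst x = tm_acc M then Some bs
      else if fst x = tm_qry M then
        (case bs of True # bs' \<Rightarrow> guided_run M ds (tm_no M, snd x) bs' | _ \<Rightarrow> None)
      else (case pick ds bs of None \<Rightarrow> None
        | Some (d, bs') \<Rightarrow> (case fire (tm_tapes M) d x of None \<Rightarrow> None | Some y \<Rightarrow> guided_run M ds y bs')))"
  by pat_completeness auto
termination
  by (relation "measure (\<lambda>(M, ds, x, bs). length bs)") (auto dest: pick_length)

declare guided_run.simps [simp del]

lemma guided_run_sound:
  assumes wf: "wf_tm M" and ds: "set ds = tm_delta M"
  shows "guided_run M ds x bs = Some bs' \<Longrightarrow> reaches (mstep M {}) (\<lambda>x. fst x = tm_acc M) x \<and> suffix bs' bs"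
proof (induction "length bs" arbitrary: x bs rule: less_induct)
  case less
  show ?case
  proof (cases "fst x = tm_acc M")
    case True
    then show ?thesis using less.prems by (subst reaches_unfold) (simp add: guided_run.simps[of M ds x])
  next
    case na: False
    show ?thesis
    proof (cases "fst x = tm_qry M")
      case True
      then obtain bs1 where bs: "bs = True # bs1" "guided_run M ds (tm_no M, snd x) bs1 = Some bs'"
        using less.prems na by (auto simp: guided_run.simps[of M ds x] split: list.splits bool.splits)
      have "mstep M {} x (tm_no M, snd x)" using True by (simp add: mstep_def)
      moreover have "reaches (mstep M {}) (\<lambda>x. fst x = tm_acc M) (tm_no M, snd x) \<and> suffix bs' bs1"
        using less.hyps[of bs1] bs by simp
      ultimately show ?thesis using bs(1) by (subst reaches_unfold) (auto simp: suffix_Cons)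
    next
      case False
      then obtain d bs1 y where p: "pick ds bs = Some (d, bs1)" "fire (tm_tapes M) d x = Some y"
        "guided_run M ds y bs1 = Some bs'"
        using less.prems na by (auto simp: guided_run.simps[of M ds x] split: option.splits)
      have "mstep M {} x y" using mstep_fire[OF wf False] pick_mem[OF p(1)] ds p(2) by blast
      moreover have "reaches (mstep M {}) (\<lambda>x. fst x = tm_acc M) y \<and> suffix bs' bs1"
        using less.hyps[OF pick_length[OF p(1)] p(3)] .
      ultimately show ?thesis using pick_suffix[OF p(1)] suffix_order.trans
        by (subst reaches_unfold) blast
    qed
  qed
qed

text \<open>A step takes at most \<open>length ds\<close> bits for an instruction, or one bit for a
  query; the successor covers the second case even when there are no instructions.\<close>

lemma guided_run_complete:
  assumes wf: "wf_tm M" and ds: "set ds = tm_delta M"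
  shows "(mstep M {} ^^ n) x y \<Longrightarrow> fst y = tm_acc M \<Longrightarrow>
    \<exists>bs. length bs \<le> n * Suc (length ds) \<and> (\<forall>rest. guided_run M ds x (bs @ rest) = Some rest)"
proof (induction n arbitrary: x)
  case 0
  then show ?case by (intro exI[of _ "[]"]) (simp add: guided_run.simps)
next
  case (Suc n)
  then obtain z where z: "mstep M {} x z" "(mstep M {} ^^ n) z y" unfolding relpowp_Suc_iff by blast
  obtain bs where bs: "length bs \<le> n * Suc (length ds)" "\<And>rest. guided_run M ds z (bs @ rest) = Some rest"
    using Suc.IH[OF z(2) Suc.prems(2)] by blast
  have na: "fst x \<noteq> tm_acc M" using no_mstep_acc[OF wf] z(1) by blast
  show ?case
  proof (cases "fst x = tm_qry M")
    case True
    then have "z = (tm_no M, snd x)" using z(1) by (simp add: mstep_def)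
    then show ?thesis using bs True na
      by (intro exI[of _ "True # bs"]) (auto simp: guided_run.simps[of M ds x])
  next
    case False
    then obtain d where d: "d \<in> set ds" "fire (tm_tapes M) d x = Some z"
      using z(1) mstep_fire[OF wf] ds by blast
    obtain cs where cs: "length cs \<le> length ds" "\<And>rest. pick ds (cs @ rest) = Some (d, rest)"
      using pick_complete[OF d(1)] by blast
    show ?thesis using bs cs d na False
      by (intro exI[of _ "cs @ bs"]) (auto simp: guided_run.simps[of M ds x])
  qed
qed

definition guided_sim :: "tm \<Rightarrow> instr list \<Rightarrow> (nat \<Rightarrow> tp) \<Rightarrow> nat \<Rightarrow> tp \<Rightarrow> tp \<Rightarrow> prog" where
  "guided_sim M ds b r src c = While (\<lambda>v. v (Rg r) \<noteq> tm_acc M)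
     (Cond (\<lambda>v. v (Rg r) = tm_qry M)
        (Cond (\<lambda>v. v src = 2) (Upd (\<lambda>v. v(Rg r := tm_no M)) ((move1 c 1)(src := 1))) Fail)
        (guided b r (tm_tapes M) src c (\<lambda>_. 1) ds))"

text \<open>The counter \<open>c\<close> is a clock. Heads move by at most one cell per simulated
  step while the clock advances by one, so its value remains a valid bound in \<open>tidy\<close>.
  Every round consumes a symbol of the string, which bounds the number of rounds.\<close>

lemma runs_to_guided_sim:
  assumes wf: "wf_tm M" and ds: "set ds = tm_delta M"
    and b: "is_block b" and src: "src \<noteq> Rg r" "src \<notin> range b" "c \<noteq> Rg r" "c \<notin> range b" "c \<noteq> src"
  shows "s src = rtape l (enc bs) \<Longrightarrow> suffix (enc bs) l \<Longrightarrow> s c = ctr e \<Longrightarrow> tidy (tm_tapes M) e x \<Longrightarrow>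
    (case guided_run M ds x bs of
      None \<Rightarrow> runs_to (guided_sim M ds b r src c) (put b r x s) (Suc (length bs) * (4 * length ds + 6)) {}
    | Some bs' \<Rightarrow> \<exists>y j. runs_to (guided_sim M ds b r src c) (put b r x s) (Suc (length bs) * (4 * length ds + 6))
        {put b r y (s(c := ctr (e + j), src := rtape l (enc bs')))} \<and> j \<le> length bs \<and> tidy (tm_tapes M) (e + j) y)"
proof (induction "length bs" arbitrary: x bs s e rule: less_induct)
  case less
  let ?D = "4 * length ds + 6"
  let ?g = "\<lambda>v. v (Rg r) \<noteq> tm_acc M"
  let ?q = "Cond (\<lambda>v. v src = 2) (Upd (\<lambda>v. v(Rg r := tm_no M)) ((move1 c 1)(src := 1))) Fail"
  let ?c = "Cond (\<lambda>v. v (Rg r) = tm_qry M) ?q (guided b r (tm_tapes M) src c (\<lambda>_. 1) ds)"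
  show ?case
  proof (cases "fst x = tm_acc M")
    case True
    have "runs_to (guided_sim M ds b r src c) (put b r x s) 1 {put b r x s}"
      unfolding guided_sim_def by (rule runs_to_While_done) (simp add: True)
    then have "runs_to (guided_sim M ds b r src c) (put b r x s) (Suc (length bs) * ?D) {put b r x (s(c := ctr e, src := rtape l (enc bs)))}"
      by (rule runs_to_eq) (use less.prems in \<open>auto simp: fun_upd_idem\<close>)
    then have "\<exists>y j. runs_to (guided_sim M ds b r src c) (put b r x s) (Suc (length bs) * ?D)
        {put b r y (s(c := ctr (e + j), src := rtape l (enc bs)))} \<and> j \<le> length bs \<and> tidy (tm_tapes M) (e + j) y"
      using less.prems(4) by (intro exI[of _ x] exI[of _ 0]) simp
    then show ?thesis using True by (simp add: guided_run.simps[of M ds x])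
  next
    case na: False
    have g: "?g (view (put b r x s))" using na by simp
    \<comment> \<open>\<open>stuck\<close> and \<open>continue\<close> package the two ways in which
      a round can end; the case analysis below then only has to exhibit the effect of the loop
      body.\<close>
    have stuck: ?thesis if "guided_run M ds x bs = None" "runs_to ?c (put b r x s) (4 * length ds + 3) {}"
    proof -
      have "runs_to (guided_sim M ds b r src c) (put b r x s) (4 * length ds + 3 + 1) {}"
        unfolding guided_sim_def by (rule runs_to_While_step0[where g = ?g, OF g that(2)])
      then show ?thesis using that(1) by (auto intro: runs_to_mono)
    qed
    have continue: ?thesis
      if eq: "guided_run M ds x bs = guided_run M ds y bs1" and lt: "length bs1 < length bs" and suf: "suffix bs1 bs"
        and t: "tidy (tm_tapes M) (Suc e) y"
        and r: "runs_to ?c (put b r x s) (4 * length ds + 3) {put b r y (s(c := ctr (Suc e), src := rtape l (enc bs1)))}" for y bs1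
    proof -
      let ?s = "s(c := ctr (Suc e), src := rtape l (enc bs1))"
      have "suffix (enc bs1) l" using suffix_enc[OF suf] less.prems(2) suffix_order.trans by blast
      note IH = less.hyps[OF lt, of ?s "Suc e" y, OF _ this _ t]
      have T: "4 * length ds + 3 + Suc (length bs1) * ?D + 1 \<le> Suc (length bs) * ?D"
      proof -
        have "Suc (length bs1) * ?D + ?D \<le> Suc (length bs) * ?D"
          using mult_le_mono1[of "Suc (Suc (length bs1))" "Suc (length bs)" ?D] lt by simp
        then show ?thesis by simp
      qed
      have W: "runs_to (guided_sim M ds b r src c) (put b r x s) (Suc (length bs) * ?D) Y"
        if "runs_to (guided_sim M ds b r src c) (put b r y ?s) (Suc (length bs1) * ?D) Y" for Y
        using runs_to_While_step1[where g = ?g, OF g r that[unfolded guided_sim_def]] T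
        unfolding guided_sim_def by (rule runs_to_mono)
      show ?thesis
      proof (cases "guided_run M ds y bs1")
        case None
        then show ?thesis using IH W src by (simp add: eq)
      next
        case (Some bs')
        then obtain z j where z: "runs_to (guided_sim M ds b r src c) (put b r y ?s) (Suc (length bs1) * ?D)
            {put b r z (?s(c := ctr (Suc e + j), src := rtape l (enc bs')))}"
          "j \<le> length bs1" "tidy (tm_tapes M) (Suc e + j) z" using IH src by auto
        have e: "?s(c := ctr (Suc e + j), src := rtape l (enc bs')) = s(c := ctr (e + Suc j), src := rtape l (enc bs'))"
          using src by (auto simp: fun_eq_iff)
        show ?thesis
          using W[OF z(1)] z(2,3) lt unfolding eq Some option.case e
          by (intro exI[of _ z] exI[of _ "Suc j"]) simp
      qed
    qed
    have v: "view (put b r x s) src = (case bs of [] \<Rightarrow> 0 | a # _ \<Rightarrow> enc_bit a)"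
      using src less.prems(1) scan_rtape[OF less.prems(2)] by (simp add: view_def put_other split: list.splits)
    show ?thesis
    proof (cases "fst x = tm_qry M")
      case True
      show ?thesis
      proof (cases "\<exists>bs1. bs = True # bs1")
        case True
        then obtain bs1 where bs: "bs = True # bs1" by blast
        let ?y = "(tm_no M, snd x)"
        let ?s = "s(c := ctr (Suc e), src := rtape l (enc bs1))"
        have tn: "turn (rtape l (2 # enc bs1)) 1 = rtape l (enc bs1)"
          using less.prems(2) by (intro turn_rtape) (simp add: bs enc_bit_def)
        have "runs_to (Upd (\<lambda>v. v(Rg r := tm_no M)) ((move1 c 1)(src := 1))) (put b r x s) 1 {put b r ?y ?s}"
        proof (rule runs_to_Upd, rule ext)
          fix z
          show "put b r ?y ?s z = eff (put b r x s) ((view (put b r x s))(Rg r := tm_no M)) ((move1 c 1)(src := 1)) z"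
            using src less.prems bs tn
            by (cases "z = Rg r"; cases "z \<in> range b"; cases "z = src"; cases "z = c")
              (auto simp: eff_def put_def view_def move1_def upd_scan_move turn_def enc_bit_def ctr_def nat_add_distrib)
        qed
        then have "runs_to ?q (put b r x s) (1 + 1) {put b r ?y ?s}"
          by (intro runs_to_Cond) (use v bs in \<open>simp add: enc_bit_def\<close>)
        then have "runs_to ?c (put b r x s) (1 + 1 + 1) {put b r ?y ?s}"
          by (intro runs_to_Cond) (use \<open>fst x = tm_qry M\<close> in simp)
        then have "runs_to ?c (put b r x s) (4 * length ds + 3) {put b r ?y ?s}" by (rule runs_to_mono) simp
        moreover have "tidy (tm_tapes M) (Suc e) ?y"
          using tidy_mono[OF less.prems(4), of "Suc e"] by (simp add: tidy_def)
        ultimately show ?thesis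
          using \<open>fst x = tm_qry M\<close> na bs
          by (intro continue[of ?y bs1]) (auto simp: guided_run.simps[of M ds x] suffix_Cons)
      next
        case False
        then have "runs_to ?q (put b r x s) (1 + 1) {}"
          by (intro runs_to_Cond) (use v runs_to_Fail in \<open>auto simp: enc_bit_def split: list.splits\<close>)
        then have "runs_to ?c (put b r x s) (1 + 1 + 1) {}"
          by (intro runs_to_Cond) (use True in simp)
        then have "runs_to ?c (put b r x s) (4 * length ds + 3) {}" by (rule runs_to_mono) simp
        then show ?thesis using True False na
          by (intro stuck) (auto simp: guided_run.simps[of M ds x] split: list.splits bool.splits)
      qed
    next
      case False
      have "runs_to (guided b r (tm_tapes M) src c (\<lambda>_. 1) ds) (put b r x s) (4 * length ds + 1)
        (case pick ds bs of None \<Rightarrow> {} | Some (d, bs') \<Rightarrow>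
        (case fire (tm_tapes M) d x of None \<Rightarrow> {} | Some y \<Rightarrow> {put b r y (s(c := turn (s c) 1, src := rtape l (enc bs')))}))"
        by (rule runs_to_guided[where b = b and s = s and l = l and bs = bs, OF b src less.prems(1,2)])
      then have "runs_to ?c (put b r x s) (4 * length ds + 1 + 1)
        (case pick ds bs of None \<Rightarrow> {} | Some (d, bs') \<Rightarrow>
        (case fire (tm_tapes M) d x of None \<Rightarrow> {} | Some y \<Rightarrow> {put b r y (s(c := turn (s c) 1, src := rtape l (enc bs')))}))"
        by (intro runs_to_Cond) (use False in simp)
      then have r: "runs_to ?c (put b r x s) (4 * length ds + 3)
        (case pick ds bs of None \<Rightarrow> {} | Some (d, bs') \<Rightarrow>
        (case fire (tm_tapes M) d x of None \<Rightarrow> {} | Some y \<Rightarrow> {put b r y (s(c := turn (s c) 1, src := rtape l (enc bs')))}))"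
        by (rule runs_to_mono) simp
      show ?thesis
      proof (cases "\<exists>d bs1 y. pick ds bs = Some (d, bs1) \<and> fire (tm_tapes M) d x = Some y")
        case True
        then obtain d bs1 y where p: "pick ds bs = Some (d, bs1)" "fire (tm_tapes M) d x = Some y" by blast
        have "turn (s c) 1 = ctr (Suc e)" using less.prems(3) by (simp add: nat_add_distrib)
        then show ?thesis
          using p False na r pick_length[OF p(1)] pick_suffix[OF p(1)] tidy_fire[OF wf _ p(2) less.prems(4)] pick_mem[OF p(1)] ds
          by (intro continue[of y bs1]) (auto simp: guided_run.simps[of M ds x])
      next
        case nf: False
        then have "(case pick ds bs of None \<Rightarrow> {} | Some (d, bs') \<Rightarrow>
        (case fire (tm_tapes M) d x of None \<Rightarrow> {} | Some y \<Rightarrow> {put b r y (s(c := turn (s c) 1, src := rtape l (enc bs')))})) = {}"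
          by (auto split: option.splits)
        then show ?thesis using nf False na r
          by (intro stuck) (auto simp: guided_run.simps[of M ds x] split: option.splits)
      qed
    qed
  qed
qed

subsection \<open>Loading, copying and clearing tapes\<close>

lemma bump_apply: "bump m s z = turn (s z) (m z)"
  by (simp add: bump_def eff_def view_def upd_scan_move turn_def)

lemma upd_scan_turn: "upd x (scan x) d = turn x d"
  by (simp add: upd_scan_move turn_def)

lemma turn_pair: "turn (f, h) d = (f, nat (int h + d))"
  by (simp add: turn_def)

lemma turn_0 [simp]: "turn t 0 = t"
  by (simp add: turn_def)

lemma shift_pair [simp]: "shift (-1) n (f, h) = (f, h - n)" "shift 1 n (f, h) = (f, h + n)"
  by (simp_all add: shift_def)

lemma rtape_Nil [simp]: "rtape l [] = (cells l, length l)"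
  by (simp add: rtape_def)

lemma upd_rtape_end: "upd (cells l, length l) a 1 = (cells (l @ [a]), Suc (length l))"
  by (simp add: upd_def cells_append nat_add_distrib)

definition load :: "tp \<Rightarrow> prog" where
  "load t = Seq (While (\<lambda>v. v Inp \<noteq> 3) (Upd (\<lambda>v. v(t := v Inp)) ((move1 Inp 1)(t := 1, Rg 0 := 1))))
     (Seq (Move (move1 Inp 1)) (Drain (Rg 0) (Move ((move1 (Rg 0) (-1))(t := -1)))))"

lemma enc_bit_range: "enc_bit a = 1 \<or> enc_bit a = 2"
  by (simp add: enc_bit_def)

lemma suffix_drop': "suffix r l \<Longrightarrow> suffix (drop j r) l"
  using suffix_drop suffix_order.trans by blast

lemma runs_to_load:
  assumes s: "s Inp = rtape l (enc w @ 3 # r)" "suffix (enc w @ 3 # r) l" "s t = reg 0" "s (Rg 0) = ctr 0"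
    and t: "t \<noteq> Inp" "t \<noteq> Rg 0"
  shows "runs_to (load t) s (4 * length w + 5) {s(Inp := rtape l r, t := (cells (enc w), 0))}"
proof -
  let ?n = "length w"
  let ?\<sigma> = "\<lambda>j. s(Inp := rtape l (drop j (enc w) @ 3 # r), t := (cells (take j (enc w)), j), Rg 0 := ctr j)"
  let ?g = "\<lambda>v::view. v Inp \<noteq> 3"
  have suf: "suffix (drop j (enc w) @ 3 # r) l" for j
    using suffix_drop'[OF s(2), of j] s(2)
    by (metis append_take_drop_id suffix_order.trans suffix_appendI suffix_append suffix_drop same_suffix_suffix)
  have sc: "view (?\<sigma> j) Inp = (if j < ?n then enc_bit (w ! j) else 3)" if "j \<le> ?n" for j
    using scan_rtape[OF suf[of j]] that t
    by (cases "j < ?n") (simp_all add: view_def Cons_nth_drop_Suc[symmetric] enc_def)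
  have "runs_to (While ?g (Upd (\<lambda>v. v(t := v Inp)) ((move1 Inp 1)(t := 1, Rg 0 := 1)))) (?\<sigma> 0) (?n * (1 + 1) + 1) {?\<sigma> ?n}"
  proof (rule runs_to_iterate)
    fix j assume j: "j < ?n"
    then have d: "drop j (enc w) = enc_bit (w ! j) # drop (Suc j) (enc w)"
      by (simp add: Cons_nth_drop_Suc[symmetric] enc_def)
    have tk: "take (Suc j) (enc w) = take j (enc w) @ [enc_bit (w ! j)]"
      using j by (simp add: take_Suc_conv_app_nth enc_def)
    have tn: "turn (rtape l (drop j (enc w) @ 3 # r)) 1 = rtape l (drop (Suc j) (enc w) @ 3 # r)"
      using suf[of j] unfolding d append_Cons by (rule turn_rtape)
    have up: "upd (cells (take j (enc w)), j) (enc_bit (w ! j)) 1 = (cells (take (Suc j) (enc w)), Suc j)"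
      using upd_rtape_end[of "take j (enc w)" "enc_bit (w ! j)"] j unfolding tk by simp
    have up2: "upd (rtape l (drop j (enc w) @ 3 # r)) (enc_bit (w ! j)) 1 = rtape l (drop (Suc j) (enc w) @ 3 # r)"
      using sc[of j] j t upd_scan_turn[of "rtape l (drop j (enc w) @ 3 # r)" 1] tn by (simp add: view_def)
    show "runs_to (Upd (\<lambda>v. v(t := v Inp)) ((move1 Inp 1)(t := 1, Rg 0 := 1))) (?\<sigma> j) 1 {?\<sigma> (Suc j)}"
    proof (rule runs_to_Upd, rule ext)
      fix z
      let ?v = "view (?\<sigma> j)"
      have "?v z = scan (?\<sigma> j z)" for z by (simp add: view_def)
      then show "?\<sigma> (Suc j) z = eff (?\<sigma> j) (?v(t := ?v Inp)) ((move1 Inp 1)(t := 1, Rg 0 := 1)) z"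
        using t sc[of j] j up up2
        by (cases "z = t"; cases "z = Inp"; cases "z = Rg 0")
          (simp_all add: eff_def move1_def upd_scan_turn nat_add_distrib)
    qed
  next
    fix j assume "j \<le> ?n"
    then show "?g (view (?\<sigma> j)) \<longleftrightarrow> j < ?n" using sc[of j] enc_bit_range[of "w ! j"] by auto
  qed
  moreover have "?\<sigma> 0 = s" using s t by (auto simp: fun_eq_iff reg_0 cells_def)
  ultimately have 1: "runs_to (While ?g (Upd (\<lambda>v. v(t := v Inp)) ((move1 Inp 1)(t := 1, Rg 0 := 1)))) s (?n * (1 + 1) + 1)
      {s(Inp := rtape l (3 # r), t := (cells (enc w), ?n), Rg 0 := ctr ?n)}"
    by simp
  have 2: "runs_to (Move (move1 Inp 1)) (s(Inp := rtape l (3 # r), t := (cells (enc w), ?n), Rg 0 := ctr ?n)) 1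
      {s(Inp := rtape l r, t := (cells (enc w), ?n), Rg 0 := ctr ?n)}"
    using runs_to_Move[of "move1 Inp 1" "s(Inp := rtape l (3 # r), t := (cells (enc w), ?n), Rg 0 := ctr ?n)"] t
      turn_rtape[of 3 r l] suf[of ?n] unfolding bump_move1 by (simp add: fun_upd_twist)
  have 3: "runs_to (Drain (Rg 0) (Move ((move1 (Rg 0) (-1))(t := -1)))) (s(Inp := rtape l r, t := (cells (enc w), ?n), Rg 0 := ctr ?n)) (2 * ?n + 1)
      {s(Inp := rtape l r, t := (cells (enc w), 0))}"
  proof (rule runs_to_eq[OF runs_to_Drain_Move[where n = ?n]])
    show "{\<lambda>y. shift (((move1 (Rg 0) (- 1))(t := - 1)) y) ?n ((s(Inp := rtape l r, t := (cells (enc w), ?n), Rg 0 := ctr ?n)) y)} =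
      {s(Inp := rtape l r, t := (cells (enc w), 0))}"
      using s t by (auto simp: fun_eq_iff move1_def)
  qed (use t in \<open>auto simp: move1_def\<close>)
  show ?thesis
    unfolding load_def by (rule runs_to_mono[OF runs_to_Seq1[OF 1 runs_to_Seq1[OF 2 3]]]) simp
qed

text \<open>The blank cells from \<open>B\<close> on guarantee that the \<open>LEAST\<close> in
  \<open>tape_word\<close> exists.\<close>

lemma tape_word_props:
  assumes "\<forall>p\<ge>B. f p = 0"
  shows "length (tape_word f) \<le> B" "i < length (tape_word f) \<Longrightarrow> f i = enc_bit (tape_word f ! i)"
    "f (length (tape_word f)) \<notin> {1, 2}"
proof -
  let ?n = "LEAST n. f n \<notin> {1, 2}"
  have B: "f B \<notin> {1, 2}" using assms by simp
  have len: "length (tape_word f) = ?n" by (simp add: tape_word_def)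
  show "length (tape_word f) \<le> B" unfolding len by (rule Least_le[where P = "\<lambda>n. f n \<notin> {1, 2}", OF B])
  show "f (length (tape_word f)) \<notin> {1, 2}" unfolding len by (rule LeastI[of "\<lambda>n. f n \<notin> {1, 2}", OF B])
  assume i: "i < length (tape_word f)"
  then have "f i \<in> {1, 2}" using not_less_Least[of i "\<lambda>n. f n \<notin> {1, 2}"] unfolding len by blast
  then show "f i = enc_bit (tape_word f ! i)" using i by (auto simp: tape_word_def enc_bit_def)
qed

text \<open>Tape \<open>MT 1\<close> is rewound by means of the counter \<open>Rg 3\<close>, which shadows its head position. The counter
  \<open>Rg 2\<close> records how far the tapes of the block \<open>NT\<close> may have been written.\<close>

definition copy_query :: prog where
  "copy_query = Seq (Drain (Rg 3) (Move ((move1 (Rg 3) (-1))(Rg 1 := 1, MT 1 := -1))))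
     (Seq (While (\<lambda>v. v (MT 1) = 1 \<or> v (MT 1) = 2)
            (Upd (\<lambda>v. v(NT 0 := v (MT 1))) ((move1 (MT 1) 1)(NT 0 := 1, Rg 0 := 1, Rg 2 := 1))))
     (Seq (Drain (Rg 0) (Move ((move1 (Rg 0) (-1))(MT 1 := -1, NT 0 := -1))))
          (Drain (Rg 1) (Move ((move1 (Rg 1) (-1))(Rg 3 := 1, MT 1 := 1))))))"

lemma runs_to_copy_query:
  assumes f: "\<forall>p\<ge>B. f p = 0" "h \<le> B"
    and s: "s (MT 1) = (f, h)" "s (Rg 3) = ctr h" "s (Rg 1) = ctr 0" "s (Rg 0) = ctr 0" "s (Rg 2) = ctr e" "s (NT 0) = reg 0"
  shows "runs_to copy_query s (8 * B + 7)
    {s(NT 0 := (cells (enc (tape_word f)), 0), Rg 2 := ctr (e + length (tape_word f)))}"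
proof -
  let ?z = "tape_word f"
  let ?n = "length ?z"
  note z = tape_word_props[OF f(1)]
  let ?s1 = "s(Rg 3 := ctr 0, Rg 1 := ctr h, MT 1 := (f, 0))"
  have 1: "runs_to (Drain (Rg 3) (Move ((move1 (Rg 3) (-1))(Rg 1 := 1, MT 1 := -1)))) s (2 * h + 1) {?s1}"
  proof (rule runs_to_eq[OF runs_to_Drain_Move[where n = h]])
    show "{\<lambda>y. shift (((move1 (Rg 3) (- 1))(Rg 1 := 1, MT 1 := - 1)) y) h (s y)} = {?s1}"
      using s by (auto simp: fun_eq_iff move1_def)
  qed (use s in \<open>auto simp: move1_def\<close>)
  let ?\<sigma> = "\<lambda>j. ?s1(MT 1 := (f, j), NT 0 := (cells (take j (enc ?z)), j), Rg 0 := ctr j, Rg 2 := ctr (e + j))"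
  let ?m = "(move1 (MT 1) 1)(NT 0 := 1, Rg 0 := 1, Rg 2 := 1)"
  let ?g = "\<lambda>v::view. v (MT 1) = 1 \<or> v (MT 1) = 2"
  have "runs_to (While ?g (Upd (\<lambda>v. v(NT 0 := v (MT 1))) ?m)) (?\<sigma> 0) (?n * (1 + 1) + 1) {?\<sigma> ?n}"
  proof (rule runs_to_iterate)
    fix j assume j: "j < ?n"
    have tk: "take (Suc j) (enc ?z) = take j (enc ?z) @ [enc_bit (?z ! j)]"
      using j by (simp add: take_Suc_conv_app_nth enc_def)
    have up: "upd (cells (take j (enc ?z)), j) (f j) 1 = (cells (take (Suc j) (enc ?z)), Suc j)"
      using upd_rtape_end[of "take j (enc ?z)" "enc_bit (?z ! j)"] j z(2)[OF j] unfolding tk by simp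
    have up2: "upd (f, j) (f j) 1 = (f, Suc j)" by (simp add: upd_def nat_add_distrib)
    show "runs_to (Upd (\<lambda>v. v(NT 0 := v (MT 1))) ?m) (?\<sigma> j) 1 {?\<sigma> (Suc j)}"
    proof (rule runs_to_Upd, rule ext)
      fix y
      let ?v = "view (?\<sigma> j)"
      have v: "?v y = scan (?\<sigma> j y)" for y by (simp add: view_def)
      have "?v (MT 1) = f j" by (simp add: view_def scan_def)
      then show "?\<sigma> (Suc j) y = eff (?\<sigma> j) (?v(NT 0 := ?v (MT 1))) ?m y"
        using up up2 v
        by (cases "y = NT 0"; cases "y = MT 1"; cases "y = Rg 0"; cases "y = Rg 2")
          (simp_all add: eff_def move1_def upd_scan_turn turn_pair nat_add_distrib)
    qed
  next
    fix j assume "j \<le> ?n"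
    moreover have "view (?\<sigma> j) (MT 1) = f j" by (simp add: view_def scan_def)
    ultimately show "?g (view (?\<sigma> j)) \<longleftrightarrow> j < ?n" 
      using z(2)[of j] z(3) enc_bit_range[of "?z ! j"] by (cases "j < ?n") auto
  qed
  moreover have "?\<sigma> 0 = ?s1" using s by (auto simp: fun_eq_iff reg_0 cells_def)
  ultimately have 2: "runs_to (While ?g (Upd (\<lambda>v. v(NT 0 := v (MT 1))) ?m)) ?s1 (?n * (1 + 1) + 1) {?\<sigma> ?n}" by simp
  let ?s3 = "?s1(NT 0 := (cells (enc ?z), 0), Rg 2 := ctr (e + ?n))"
  have 3: "runs_to (Drain (Rg 0) (Move ((move1 (Rg 0) (-1))(MT 1 := -1, NT 0 := -1)))) (?\<sigma> ?n) (2 * ?n + 1) {?s3}"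
  proof (rule runs_to_eq[OF runs_to_Drain_Move[where n = ?n]])
    show "{\<lambda>y. shift (((move1 (Rg 0) (- 1))(MT 1 := - 1, NT 0 := - 1)) y) ?n (?\<sigma> ?n y)} = {?s3}"
      using s by (auto simp: fun_eq_iff move1_def)
  qed (auto simp: move1_def)
  \<comment> \<open>The oracle machine goes on after the check, so the head of its query tape and
    the shadow counter return to their former position.\<close>
  have 4: "runs_to (Drain (Rg 1) (Move ((move1 (Rg 1) (-1))(Rg 3 := 1, MT 1 := 1)))) ?s3 (2 * h + 1)
      {s(NT 0 := (cells (enc ?z), 0), Rg 2 := ctr (e + ?n))}"
  proof (rule runs_to_eq[OF runs_to_Drain_Move[where n = h]])
    show "{\<lambda>y. shift (((move1 (Rg 1) (- 1))(Rg 3 := 1, MT 1 := 1)) y) h (?s3 y)} = {s(NT 0 := (cells (enc ?z), 0), Rg 2 := ctr (e + ?n))}"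
      using s by (auto simp: fun_eq_iff move1_def)
  qed (auto simp: move1_def)
  show ?thesis
    unfolding copy_query_def
    by (rule runs_to_mono[OF runs_to_Seq1[OF 1 runs_to_Seq1[OF 2 runs_to_Seq1[OF 3 4]]]]) (use f(2) z(1) in simp)
qed

text \<open>Three passes of equal length: heads home, erase rightwards, heads home again.
  \<open>Rg 0\<close> keeps the value of \<open>Rg 2\<close> for the second pass, which restores it
  for the third.\<close>

definition clear_block :: "nat \<Rightarrow> prog" where
  "clear_block k = (let b = (\<lambda>d z. if z \<in> NT ` {..<k} then d else (0::int)) in
     Seq (Drain (Rg 2) (Move ((b (-1))(Rg 2 := -1, Rg 0 := 1))))
    (Seq (Drain (Rg 0) (Upd (\<lambda>v z. if z \<in> NT ` {..<k} then 0 else v z) ((b 1)(Rg 0 := -1, Rg 2 := 1))))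
         (Drain (Rg 2) (Move ((b (-1))(Rg 2 := -1))))))"

lemma runs_to_clear_block:
  assumes tidy: "\<And>i. i < k \<Longrightarrow> snd (s (NT i)) \<le> n" "\<And>i p. i < k \<Longrightarrow> p \<ge> n \<Longrightarrow> fst (s (NT i)) p = 0"
    and s: "s (Rg 2) = ctr n" "s (Rg 0) = ctr 0"
  shows "runs_to (clear_block k) s (6 * n + 5) {(\<lambda>z. if z \<in> NT ` {..<k} then reg 0 else s z)(Rg 2 := ctr 0)}"
proof -
  let ?B = "NT ` {..<k}"
  let ?b = "\<lambda>d z. if z \<in> ?B then d else (0::int)"
  let ?\<sigma> = "\<lambda>j. (\<lambda>z. if z \<in> ?B then (\<lambda>p. if p < j then 0 else fst (s z) p, j) else s z)(Rg 0 := ctr (n - j), Rg 2 := ctr j)"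
  have 1: "runs_to (Drain (Rg 2) (Move ((?b (-1))(Rg 2 := -1, Rg 0 := 1)))) s (2 * n + 1) {?\<sigma> 0}"
  proof (rule runs_to_eq[OF runs_to_Drain_Move[where n = n]])
    show "{\<lambda>y. shift (((?b (-1))(Rg 2 := -1, Rg 0 := 1)) y) n (s y)} = {?\<sigma> 0}"
      using s tidy(1) by (auto simp: fun_eq_iff shift_def[of "-1" n "s _"])
  qed (use s in auto)
  have 2: "runs_to (Drain (Rg 0) (Upd (\<lambda>v z. if z \<in> ?B then 0 else v z) ((?b 1)(Rg 0 := -1, Rg 2 := 1)))) (?\<sigma> 0) (n * (1 + 1) + 1) {?\<sigma> n}"
  proof (rule runs_to_iterate)
    fix j assume j: "j < n"
    show "runs_to (Upd (\<lambda>v z. if z \<in> ?B then 0 else v z) ((?b 1)(Rg 0 := -1, Rg 2 := 1))) (?\<sigma> j) 1 {?\<sigma> (Suc j)}"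
    proof (rule runs_to_Upd, rule ext)
      fix z
      let ?v = "view (?\<sigma> j)"
      have v: "?v z = scan (?\<sigma> j z)" for z by (simp add: view_def)
      show "?\<sigma> (Suc j) z = eff (?\<sigma> j) (\<lambda>z. if z \<in> ?B then 0 else ?v z) ((?b 1)(Rg 0 := -1, Rg 2 := 1)) z"
      proof (cases "z \<in> ?B")
        case True
        then have "z \<noteq> Rg 0" "z \<noteq> Rg 2" by auto
        then show ?thesis using True by (auto simp: eff_def upd_def fun_eq_iff nat_add_distrib)
      next
        case False
        have "nat (int (n - j) - 1) = n - Suc j" by simp
        then show ?thesis using False v
          by (cases "z = Rg 0"; cases "z = Rg 2") (simp_all add: eff_def nat_add_distrib)
      qed
    qed
  next
    fix j assume "j \<le> n"
    then show "(\<not> at_zero (Rg 0) (view (?\<sigma> j))) \<longleftrightarrow> j < n"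
      by (auto simp: at_zero_ctr[of _ _ "n - j"])
  qed
  have 3: "runs_to (Drain (Rg 2) (Move ((?b (-1))(Rg 2 := -1)))) (?\<sigma> n) (2 * n + 1)
      {(\<lambda>z. if z \<in> ?B then reg 0 else s z)(Rg 2 := ctr 0)}"
  proof (rule runs_to_eq[OF runs_to_Drain_Move[where n = n]])
    show "{\<lambda>y. shift (((?b (-1))(Rg 2 := -1)) y) n (?\<sigma> n y)} = {(\<lambda>z. if z \<in> ?B then reg 0 else s z)(Rg 2 := ctr 0)}"
      using s tidy(2) by (auto simp: fun_eq_iff reg_0)
  qed auto
  show ?thesis
    unfolding clear_block_def Let_def
    by (rule runs_to_mono[OF runs_to_Seq1[OF 1 runs_to_Seq1[OF 2 3]]]) simp
qed

subsection \<open>Verification of an oracle computation\<close>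

text \<open>Allocation of the auxiliary tapes: \<open>Rg 0\<close> and \<open>Rg 1\<close> are scratch counters, \<open>Rg 2\<close> is the clock of the
  simulation of the oracle machine, \<open>Rg 3\<close> shadows the head of the query tape, \<open>Rg 4\<close> holds the string \<open>t\<close>,
  \<open>Rg 5\<close> and \<open>Rg 6\<close> hold the states of the two simulated machines and \<open>Rg 7\<close> is a flag.\<close>

definition vstore :: "tape \<Rightarrow> tape \<Rightarrow> nat \<Rightarrow> nat \<Rightarrow> nat \<times> (nat \<Rightarrow> tape) \<Rightarrow> nat \<times> (nat \<Rightarrow> tape) \<Rightarrow> store" where
  "vstore inp tau p fl x y = (\<lambda>z. case z of Inp \<Rightarrow> inp | Qry \<Rightarrow> reg 0 | MT i \<Rightarrow> snd x i | NT i \<Rightarrow> snd y i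
     | Rg i \<Rightarrow> if i < 3 then ctr 0 else if i = 3 then ctr p else if i = 4 then tau else if i = 5 then reg (fst x)
         else if i = 6 then reg (fst y) else if i = 7 then reg fl else reg 0)"

lemma vstore_simps [simp]:
  "vstore inp tau p fl x y Inp = inp" "vstore inp tau p fl x y Qry = reg 0"
  "vstore inp tau p fl x y (MT i) = snd x i" "vstore inp tau p fl x y (NT i) = snd y i"
  "vstore inp tau p fl x y (Rg 0) = ctr 0" "vstore inp tau p fl x y (Rg (Suc 0)) = ctr 0" "vstore inp tau p fl x y (Rg 2) = ctr 0"
  "vstore inp tau p fl x y (Rg 3) = ctr p" "vstore inp tau p fl x y (Rg 4) = tau" "vstore inp tau p fl x y (Rg 5) = reg (fst x)"
  "vstore inp tau p fl x y (Rg 6) = reg (fst y)" "vstore inp tau p fl x y (Rg 7) = reg fl"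
  by (simp_all add: vstore_def)

lemma store_eqI:
  assumes "s Inp = s' Inp" "s Qry = s' Qry" "\<And>i. s (Rg i) = s' (Rg i)" "\<And>i. s (MT i) = s' (MT i)" "\<And>i. s (NT i) = s' (NT i)"
  shows "s = (s' :: store)"
proof
  fix z show "s z = s' z" using assms by (cases z) auto
qed

lemma put_Rg: "is_block b \<Longrightarrow> put b r x s (Rg j) = (if j = r then reg (fst x) else s (Rg j))"
  by (simp add: put_def)

lemma vstore_put:
  "put MT 5 x' (vstore inp tau p fl x y) = vstore inp tau p fl x' y"
  "put NT 6 y' (vstore inp tau p fl x y) = vstore inp tau p fl x y'"
  by (rule store_eqI; simp add: put_Rg; simp add: vstore_def)+

lemma vstore_upd:
  "(vstore inp tau p fl x y)(Inp := inp') = vstore inp' tau p fl x y"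
  "(vstore inp tau p fl x y)(Rg 4 := tau') = vstore inp tau' p fl x y"
  "(vstore inp tau p fl x y)(Rg 3 := ctr p') = vstore inp tau p' fl x y"
  by (rule store_eqI; simp; simp add: vstore_def)+

abbreviation blank_conf :: "tm \<Rightarrow> nat \<times> (nat \<Rightarrow> tape)" where
  "blank_conf N \<equiv> (tm_start N, \<lambda>_. reg 0)"

text \<open>\<open>verify b x bs us\<close> runs the oracle machine \<open>M\<close> along the string \<open>bs\<close> of choices and oracle answers.
  The queries with answer \<open>b\<close> are checked against \<open>N\<close> with choices from \<open>us\<close>; for \<open>b = True\<close> all of these
  checks have to succeed, for \<open>b = False\<close> a bit of \<open>us\<close> tells whether a query is checked, and the first
  successful check ends the run.\<close>

function verify :: "tm \<Rightarrow> instr list \<Rightarrow> tm \<Rightarrow> instr list \<Rightarrow> bool \<Rightarrow> nat \<times> (nat \<Rightarrow> tape) \<Rightarrow> bool list \<Rightarrow> bool list \<Rightarrow> bool" where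
  "verify M ds N es b x bs us =
     (if fst x = tm_acc M then b
      else if fst x = tm_qry M then
        (case bs of [] \<Rightarrow> False | a # bs' \<Rightarrow>
           (let x' = (if a then tm_yes M else tm_no M, snd x) in
            if a \<noteq> b then verify M ds N es b x' bs' us
            else (case us of [] \<Rightarrow> False
              | False # us' \<Rightarrow> \<not> b \<and> verify M ds N es b x' bs' us'
              | True # us' \<Rightarrow> (case guided_run N es (minit N (enc (tape_word (fst (snd x 1))))) us' of
                  None \<Rightarrow> False | Some us'' \<Rightarrow> \<not> b \<or> verify M ds N es b x' bs' us''))))
      else (case pick ds bs of None \<Rightarrow> False
        | Some (d, bs') \<Rightarrow> (case fire (tm_tapes M) d x of None \<Rightarrow> False | Some y \<Rightarrow> verify M ds N es b y bs' us)))"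
  by pat_completeness auto
termination
  by (relation "measure (\<lambda>(M, ds, N, es, b, x, bs, us). length bs)") (auto dest: pick_length)

declare verify.simps [simp del]

text \<open>With \<open>b\<close> false, a successful check raises the flag \<open>Rg 7\<close> and
  pretends acceptance in order to leave the main loop. Genuine acceptance leaves the flag at 0, and
  \<open>verifier\<close> then fails.\<close>

definition check :: "tm \<Rightarrow> tm \<Rightarrow> instr list \<Rightarrow> bool \<Rightarrow> prog" where
  "check M N es b = Cond (\<lambda>v. v Inp = 2)
     (Seq (Move (move1 Inp 1)) (Seq copy_query (Seq (guided_sim N es NT 6 Inp (Rg 2))
       (Seq (clear_block (tm_tapes N)) (Seq (Write (Rg 6) (tm_start N))
         (if b then Skip else Upd (\<lambda>v. v(Rg 7 := 1, Rg 5 := tm_acc M)) (\<lambda>_. 0)))))))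
     (Cond (\<lambda>v. v Inp = 1) (if b then Fail else Move (move1 Inp 1)) Fail)"

definition answer :: "tm \<Rightarrow> tm \<Rightarrow> instr list \<Rightarrow> bool \<Rightarrow> prog" where
  "answer M N es b =
     Cond (\<lambda>v. v (Rg 4) = 2)
       (Seq (Upd (\<lambda>v. v(Rg 5 := tm_yes M)) (move1 (Rg 4) 1)) (if b then check M N es b else Skip))
     (Cond (\<lambda>v. v (Rg 4) = 1)
       (Seq (Upd (\<lambda>v. v(Rg 5 := tm_no M)) (move1 (Rg 4) 1)) (if b then Skip else check M N es b)) Fail)"

definition verify_loop :: "tm \<Rightarrow> instr list \<Rightarrow> tm \<Rightarrow> instr list \<Rightarrow> bool \<Rightarrow> prog" where
  "verify_loop M ds N es b = While (\<lambda>v. v (Rg 5) \<noteq> tm_acc M)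
     (Cond (\<lambda>v. v (Rg 5) = tm_qry M) (answer M N es b)
       (guided MT 5 (tm_tapes M) (Rg 4) (Rg 3) (\<lambda>(q, rd, q', wr, mv). mv ! 1) ds))"

definition verifier :: "tm \<Rightarrow> instr list \<Rightarrow> tm \<Rightarrow> instr list \<Rightarrow> bool \<Rightarrow> prog" where
  "verifier M ds N es b =
     Seq (Upd (\<lambda>v. v(Rg 0 := 1, Rg 1 := 1, Rg 2 := 1, Rg 3 := 1, Rg 5 := tm_start M, Rg 6 := tm_start N)) (\<lambda>_. 0))
    (Seq (load (MT 0)) (Seq (load (Rg 4)) (Seq (verify_loop M ds N es b)
       (if b then Skip else Cond (\<lambda>v. v (Rg 7) = 1) Skip Fail))))"

lemma tidy_minit:
  assumes "wf_tm N"
  shows "tidy (tm_tapes N) (length z) (minit N (enc z))"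
proof -
  have "tm_tapes N \<noteq> 0" using assms by (simp add: wf_tm_def)
  then show ?thesis by (auto simp: tidy_def minit_def reg_0 cells_def)
qed

lemma view_Inp:
  assumes "s Inp = rtape l (enc us)" "suffix (enc us) l"
  shows "view s Inp = (case us of [] \<Rightarrow> 0 | a # _ \<Rightarrow> enc_bit a)"
  using scan_rtape[OF assms(2)] assms(1) by (simp add: view_def split: list.splits)

definition check_result :: "tm \<Rightarrow> tm \<Rightarrow> instr list \<Rightarrow> bool \<Rightarrow> nat list \<Rightarrow> tape \<Rightarrow> nat \<times> (nat \<Rightarrow> tape) \<Rightarrow> bool list \<Rightarrow> store set" where
  "check_result M N es b l tau x us =
     (let st = (\<lambda>us x fl. vstore (rtape l (enc us)) tau (snd (snd x 1)) fl x (blank_conf N)) in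
      case us of [] \<Rightarrow> {}
        | False # us' \<Rightarrow> if b then {} else {st us' x 0}
        | True # us' \<Rightarrow> (case guided_run N es (minit N (enc (tape_word (fst (snd x 1))))) us' of
            None \<Rightarrow> {} | Some us'' \<Rightarrow> {if b then st us'' x 0 else st us'' (tm_acc M, snd x) 1}))"

text \<open>Copying the query costs \<open>8 * B\<close>. Clearing covers the query and one cell per
  simulated step, hence \<open>6 * B + 6 * U\<close>. The product pays for the replay along the
  certificate.\<close>

definition check_time :: "instr list \<Rightarrow> nat \<Rightarrow> nat \<Rightarrow> nat" where
  "check_time es B U = 14 * B + 6 * U + Suc U * (4 * length es + 6) + 25"

lemma runs_to_check:
  assumes wf: "wf_tm N" and es: "set es = tm_delta N"
    and us: "suffix (enc us) l" and B: "\<forall>p\<ge>B. fst (snd x 1) p = 0" "snd (snd x 1) \<le> B"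
  shows "runs_to (check M N es b) (vstore (rtape l (enc us)) tau (snd (snd x 1)) 0 x (blank_conf N))
    (check_time es B (length us)) (check_result M N es b l tau x us)"
proof -
  let ?S = "\<lambda>us. vstore (rtape l (enc us)) tau (snd (snd x 1)) 0 x (blank_conf N)"
  note v = view_Inp[of "?S us" l us, OF _ us, simplified]
  show ?thesis
  proof (cases us)
    case Nil
    have "runs_to (Cond (\<lambda>v. v Inp = 1) (if b then Fail else Move (move1 Inp 1)) Fail) (?S us) (1 + 1) {}"
      by (intro runs_to_Cond) (use v Nil runs_to_Fail in simp)
    then have "runs_to (check M N es b) (?S us) (1 + 1 + 1) {}"
      unfolding check_def by (intro runs_to_Cond) (use v Nil in simp)
    then show ?thesis by (rule runs_to_eq) (simp_all add: Nil check_result_def check_time_def)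
  next
    case (Cons a us')
    have mv: "runs_to (Move (move1 Inp 1)) (?S us) 1 {?S us'}"
      using runs_to_Move[of "move1 Inp 1" "?S us"] turn_rtape[of "enc_bit a" "enc us'" l] us
      by (simp add: Cons bump_move1 vstore_upd)
    show ?thesis
    proof (cases a)
      case False
      have "runs_to (if b then Fail else Move (move1 Inp 1)) (?S us) 1 (if b then {} else {?S us'})"
        using runs_to_Fail mv by simp
      then have "runs_to (Cond (\<lambda>v. v Inp = 1) (if b then Fail else Move (move1 Inp 1)) Fail) (?S us) (1 + 1) (if b then {} else {?S us'})"
        by (intro runs_to_Cond) (use v Cons False in \<open>simp add: enc_bit_def\<close>)
      then have "runs_to (check M N es b) (?S us) (1 + 1 + 1) (if b then {} else {?S us'})"
        unfolding check_def by (intro runs_to_Cond) (use v Cons False in \<open>simp add: enc_bit_def\<close>)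
      then show ?thesis by (rule runs_to_eq) (simp_all add: Cons False check_result_def check_time_def)
    next
      case True
      let ?z = "tape_word (fst (snd x 1))"
      let ?P = "if b then Skip else Upd (\<lambda>v. v(Rg 7 := 1, Rg 5 := tm_acc M)) (\<lambda>_. 0)"
      have zB: "length ?z \<le> B" using tape_word_props(1)[OF B(1)] .
      let ?s2 = "(?S us')(Rg 2 := ctr (length ?z))"
      \<comment> \<open>With the query word on \<open>NT 0\<close>, the block already is the initial
        configuration of \<open>N\<close> on that word: its other tapes are blank and
        \<open>Rg 6\<close> holds the start state.\<close>
      have s2: "(?S us')(NT 0 := (cells (enc ?z), 0), Rg 2 := ctr (0 + length ?z)) = put NT 6 (minit N (enc ?z)) ?s2"
        by (rule store_eqI; simp add: put_Rg minit_def; simp add: vstore_def)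
      have cq: "runs_to copy_query (?S us') (8 * B + 7) {put NT 6 (minit N (enc ?z)) ?s2}"
        unfolding s2[symmetric] by (rule runs_to_copy_query[OF B]) (simp_all add: prod_eq_iff)
      have suf: "suffix (enc us') l" using us unfolding Cons by (auto intro: suffix_ConsD)
      have nsrc: "Inp \<noteq> Rg 6" "Inp \<notin> range NT" "Rg 2 \<noteq> Rg 6" "Rg 2 \<notin> range NT" "Rg 2 \<noteq> Inp" by auto
      have *: "?s2 Inp = rtape l (enc us')" "?s2 (Rg 2) = ctr (length ?z)" by simp_all
      note gs = runs_to_guided_sim[where s = ?s2, OF wf es is_block_simps(2) nsrc *(1) suf *(2) tidy_minit[OF wf]]
      have enter: "runs_to (check M N es b) (?S us) (check_time es B (length us)) X"
        if "runs_to (Seq (guided_sim N es NT 6 Inp (Rg 2)) (Seq (clear_block (tm_tapes N)) (Seq (Write (Rg 6) (tm_start N)) ?P)))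
           (put NT 6 (minit N (enc ?z)) ?s2) T X" "T + 8 * B + 12 \<le> check_time es B (length us)" for X T
      proof -
        have "runs_to (Seq (Move (move1 Inp 1)) (Seq copy_query (Seq (guided_sim N es NT 6 Inp (Rg 2)) (Seq (clear_block (tm_tapes N)) (Seq (Write (Rg 6) (tm_start N)) ?P)))))
           (?S us) (1 + (8 * B + 7 + T + 1) + 1) X"
          by (rule runs_to_Seq1[OF mv runs_to_Seq1[OF cq that(1)]])
        then have "runs_to (check M N es b) (?S us) (1 + (8 * B + 7 + T + 1) + 1 + 1) X"
          unfolding check_def by (intro runs_to_Cond) (use v Cons True in \<open>simp add: enc_bit_def\<close>)
        then show ?thesis by (rule runs_to_mono) (use that(2) in simp)
      qed
      show ?thesis
      proof (cases "guided_run N es (minit N (enc ?z)) us'")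
        case None
        then have "runs_to (guided_sim N es NT 6 Inp (Rg 2)) (put NT 6 (minit N (enc ?z)) ?s2) (Suc (length us') * (4 * length es + 6)) {}"
          using gs by simp
        then have "runs_to (check M N es b) (?S us) (check_time es B (length us)) {}"
          by (rule enter[OF runs_to_Seq0]) (simp add: Cons check_time_def algebra_simps)
        then show ?thesis using None by (simp add: Cons True check_result_def)
      next
        case (Some us'')
        then obtain y j where g: "runs_to (guided_sim N es NT 6 Inp (Rg 2)) (put NT 6 (minit N (enc ?z)) ?s2) (Suc (length us') * (4 * length es + 6))
            {put NT 6 y (?s2(Rg 2 := ctr (length ?z + j), Inp := rtape l (enc us'')))}"
          and j: "j \<le> length us'" and t: "tidy (tm_tapes N) (length ?z + j) y" using gs by auto
        let ?s3 = "put NT 6 y (?s2(Rg 2 := ctr (length ?z + j), Inp := rtape l (enc us'')))"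
        have "runs_to (clear_block (tm_tapes N)) ?s3 (6 * (length ?z + j) + 5)
            {(\<lambda>z. if z \<in> NT ` {..<tm_tapes N} then reg 0 else ?s3 z)(Rg 2 := ctr 0)}"
          by (rule runs_to_clear_block) (use t in \<open>auto simp: tidy_def\<close>)
        moreover have "(\<lambda>z. if z \<in> NT ` {..<tm_tapes N} then reg 0 else ?s3 z)(Rg 2 := ctr 0) = put NT 6 (fst y, \<lambda>_. reg 0) (?S us'')"
          using t by (intro store_eqI; simp add: put_Rg; auto simp: vstore_def tidy_def inj_image_mem_iff[OF inj_blocks(2)])
        ultimately have c: "runs_to (clear_block (tm_tapes N)) ?s3 (6 * (length ?z + j) + 5) {put NT 6 (fst y, \<lambda>_. reg 0) (?S us'')}"
          by simp
        have w: "runs_to (Write (Rg 6) (tm_start N)) (put NT 6 (fst y, \<lambda>_. reg 0) (?S us'')) 1 {?S us''}"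
          using runs_to_Write_put[of NT 6 "tm_start N" "(fst y, \<lambda>_. reg 0)" "?S us''"] by (simp add: vstore_put)
        let ?R = "if b then ?S us'' else vstore (rtape l (enc us'')) tau (snd (snd x 1)) 1 (tm_acc M, snd x) (blank_conf N)"
        have p: "runs_to ?P (?S us'') 1 {?R}"
        proof (cases b)
          case False
          have "runs_to (Upd (\<lambda>v. v(Rg 7 := 1, Rg 5 := tm_acc M)) (\<lambda>_. 0)) (?S us'') 1 {vstore (rtape l (enc us'')) tau (snd (snd x 1)) 1 (tm_acc M, snd x) (blank_conf N)}"
            by (rule runs_to_Upd, rule store_eqI; simp add: eff_def view_def; simp add: vstore_def)
          then show ?thesis using False by simp
        next
          case True
          then show ?thesis using runs_to_Skip[of "?S us''"] by simp
        qed
        have "runs_to (check M N es b) (?S us) (check_time es B (length us)) {?R}"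
        proof (rule enter[OF runs_to_Seq1[OF g runs_to_Seq1[OF c runs_to_Seq1[OF w p]]]])
          have "6 * (length ?z + j) \<le> 6 * B + 6 * length us'" using zB j by simp
          then show "Suc (length us') * (4 * length es + 6) + (6 * (length ?z + j) + 5 + (1 + 1 + 1) + 1) + 1 + 8 * B + 12 \<le> check_time es B (length us)"
            by (simp add: check_time_def Cons)
        qed
        moreover have "check_result M N es b l tau x us = {?R}"
          using Some by (cases b) (simp_all add: Cons True check_result_def)
        ultimately show ?thesis by (simp only:)
      qed
    qed
  qed
qed

section \<open>Polynomially bounded functions\<close>

definition poly_bounded :: "(nat \<Rightarrow> nat) \<Rightarrow> bool" where
  "poly_bounded f \<longleftrightarrow> (\<exists>q :: nat poly. \<forall>n. f n \<le> poly q n)"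

lemma poly_bounded_const [simp]: "poly_bounded (\<lambda>_. c)"
  unfolding poly_bounded_def by (rule exI[of _ "[:c:]"]) simp

lemma poly_bounded_id [simp]: "poly_bounded (\<lambda>n. n)"
  unfolding poly_bounded_def by (rule exI[of _ "[:0, 1:]"]) simp

lemma poly_bounded_add: "poly_bounded f \<Longrightarrow> poly_bounded g \<Longrightarrow> poly_bounded (\<lambda>n. f n + g n)"
  unfolding poly_bounded_def by (metis add_mono poly_add)

lemma poly_bounded_mult: "poly_bounded f \<Longrightarrow> poly_bounded g \<Longrightarrow> poly_bounded (\<lambda>n. f n * g n)"
  unfolding poly_bounded_def by (metis mult_le_mono poly_mult)

lemma poly_bounded_Suc: "poly_bounded f \<Longrightarrow> poly_bounded (\<lambda>n. Suc (f n))"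
  using poly_bounded_add[of f "\<lambda>_. 1"] by simp

lemmas poly_bounded_intros = poly_bounded_add poly_bounded_mult poly_bounded_Suc poly_bounded_const poly_bounded_id

lemma check_time_mono: "B \<le> B' \<Longrightarrow> U \<le> U' \<Longrightarrow> check_time es B U \<le> check_time es B' U'"
  unfolding check_time_def by (intro add_mono mult_le_mono) auto

section \<open>The main loop of the verifier\<close>

definition head_shift :: "instr \<Rightarrow> int" where
  "head_shift = (\<lambda>(q, rd, q', wr, mv). mv ! 1)"

lemma fire_query_tape:
  assumes wf: "wf_tm M" and d: "d \<in> tm_delta M" and f: "fire (tm_tapes M) d x = Some y"
    and B: "\<forall>p\<ge>B. fst (snd x 1) p = 0" "snd (snd x 1) \<le> B"
  shows "\<forall>p\<ge>Suc B. fst (snd y 1) p = 0" "snd (snd y 1) \<le> Suc B"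
    "snd (snd y 1) = nat (int (snd (snd x 1)) + head_shift d)" "head_shift d \<in> {-1, 0, 1}"
proof -
  obtain q rd q' wr mv where d': "d = (q, rd, q', wr, mv)" by (metis prod_cases5)
  have k: "1 < tm_tapes M" using wf by (simp add: wf_tm_def)
  have y: "snd y 1 = upd (snd x 1) (wr ! 1) (mv ! 1)"
    using f k by (auto simp: fire_def d' split: if_splits)
  show m: "head_shift d \<in> {-1, 0, 1}"
    using wf_delta(8,11)[OF wf d[unfolded d']] k by (auto simp: head_shift_def d')
  then have "mv ! 1 \<le> 1" by (auto simp: head_shift_def d')
  then show "\<forall>p\<ge>Suc B. fst (snd y 1) p = 0" "snd (snd y 1) \<le> Suc B"
    "snd (snd y 1) = nat (int (snd (snd x 1)) + head_shift d)"
    using B unfolding y by (auto simp: upd_def head_shift_def d')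
qed

text \<open>\<open>B\<close> bounds the written part of the query tape. It grows by at most one per
  round, while each round consumes a symbol of \<open>bs\<close>; so \<open>B + length bs\<close>
  never grows, and \<open>K\<close> limits the size of every query of the run.\<close>

lemma runs_to_verify_loop:
  fixes M N ds es b l l'
  defines "st \<equiv> \<lambda>us bs x. vstore (rtape l (enc us)) (rtape l' (enc bs)) (snd (snd x 1)) 0 x (blank_conf N)"
  assumes wf: "wf_tm M" "wf_tm N" and ds: "set ds = tm_delta M" "set es = tm_delta N"
  shows "suffix (enc us) l \<Longrightarrow> suffix (enc bs) l' \<Longrightarrow> \<forall>p\<ge>B. fst (snd x 1) p = 0 \<Longrightarrow> snd (snd x 1) \<le> B \<Longrightarrow>
    B + length bs \<le> K \<Longrightarrow> length us \<le> U \<Longrightarrow>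
    \<exists>X. runs_to (verify_loop M ds N es b) (st us bs x) (Suc (length bs) * (check_time es K U + 4 * length ds + 10)) X \<and>
      (verify M ds N es b x bs us \<longleftrightarrow> (\<exists>s'\<in>X. b \<or> scan (s' (Rg 7)) = 1))"
proof (induction "length bs" arbitrary: x bs us B rule: less_induct)
  case less
  let ?W = "check_time es K U + 4 * length ds + 10"
  let ?loop = "verify_loop M ds N es b"
  let ?g = "\<lambda>v. v (Rg 5) \<noteq> tm_acc M"
  let ?step = "guided MT 5 (tm_tapes M) (Rg 4) (Rg 3) (\<lambda>(q, rd, q', wr, mv). mv ! 1) ds"
  let ?c = "Cond (\<lambda>v. v (Rg 5) = tm_qry M) (answer M N es b) ?step"
  have view5: "view (st us bs x) (Rg 5) = fst x" for us bs x by (simp add: st_def view_def)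
  show ?case
  proof (cases "fst x = tm_acc M")
    case True
    have "runs_to ?loop (st us bs x) 1 {st us bs x}"
      unfolding verify_loop_def by (rule runs_to_While_done) (simp add: view5 True)
    then have "runs_to ?loop (st us bs x) (Suc (length bs) * ?W) {st us bs x}" by (rule runs_to_mono) simp
    then show ?thesis
      using True by (intro exI[of _ "{st us bs x}"]) (simp add: verify.simps[of M] st_def)
  next
    case na: False
    have g: "?g (view (st us bs x))" using na by (simp add: view5)
    have stuck: ?thesis if "\<not> verify M ds N es b x bs us" "runs_to ?c (st us bs x) (?W - 1) {}"
    proof -
      have "runs_to ?loop (st us bs x) (?W - 1 + 1) {}"
        unfolding verify_loop_def by (rule runs_to_While_step0[where g = ?g, OF g that(2)])
      then have "runs_to ?loop (st us bs x) (Suc (length bs) * ?W) {}" by (rule runs_to_mono) simp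
      then show ?thesis using that(1) by blast
    qed
    have finish: ?thesis
      if "\<not> b" "verify M ds N es b x bs us" "bs \<noteq> []"
        and r: "runs_to ?c (st us bs x) (?W - 1) {s'}" and s': "s' (Rg 5) = reg (tm_acc M)" "s' (Rg 7) = reg 1" for s'
    proof -
      have "runs_to ?loop s' 1 {s'}"
        unfolding verify_loop_def by (rule runs_to_While_done) (simp add: s' view_def)
      then have "runs_to ?loop (st us bs x) (?W - 1 + 1 + 1) {s'}"
        unfolding verify_loop_def by (rule runs_to_While_step1[where g = ?g, OF g r])
      then have "runs_to ?loop (st us bs x) (Suc (length bs) * ?W) {s'}"
      proof (rule runs_to_mono)
        \<comment> \<open>The loop test after the final check exceeds the budget of one round; a
          nonempty \<open>bs\<close> provides the budget of a second round.\<close>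
        show "?W - 1 + 1 + 1 \<le> Suc (length bs) * ?W" using that(3) by (cases bs) simp_all
      qed
      then show ?thesis using that s' by (intro exI[of _ "{s'}"]) simp
    qed
    have continue: ?thesis
      if eq: "verify M ds N es b x bs us = verify M ds N es b y bs' us'" and lt: "length bs' < length bs"
        and suf: "suffix bs' bs" "suffix us' us"
        and y: "\<forall>p\<ge>Suc B. fst (snd y 1) p = 0" "snd (snd y 1) \<le> Suc B"
        and r: "runs_to ?c (st us bs x) (?W - 1) {st us' bs' y}" for y bs' us'
    proof -
      have "length us' \<le> U" using suffix_length_le[OF suf(2)] less.prems(6) by simp
      moreover have "suffix (enc us') l" "suffix (enc bs') l'"
        using suffix_enc[OF suf(1)] suffix_enc[OF suf(2)] less.prems(1,2) suffix_order.trans by blast+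
      moreover have "Suc B + length bs' \<le> K" using less.prems(5) lt by simp
      ultimately obtain X where X: "runs_to ?loop (st us' bs' y) (Suc (length bs') * ?W) X"
        "verify M ds N es b y bs' us' \<longleftrightarrow> (\<exists>s'\<in>X. b \<or> scan (s' (Rg 7)) = 1)"
        using less.hyps[OF lt, of us' "Suc B" y] y by blast
      have "runs_to ?loop (st us bs x) (?W - 1 + Suc (length bs') * ?W + 1) X"
        using runs_to_While_step1[where g = ?g, OF g r X(1)[unfolded verify_loop_def]] unfolding verify_loop_def .
      then have "runs_to ?loop (st us bs x) (Suc (length bs) * ?W) X"
      proof (rule runs_to_mono)
        have "Suc (length bs') * ?W + ?W \<le> Suc (length bs) * ?W"
          using mult_le_mono1[of "Suc (Suc (length bs'))" "Suc (length bs)" ?W] lt by simp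
        then show "?W - 1 + Suc (length bs') * ?W + 1 \<le> Suc (length bs) * ?W" by simp
      qed
      then show ?thesis using X(2) eq by blast
    qed
    have ct: "check_time es B (length us) \<le> check_time es K U"
      using less.prems(5,6) by (intro check_time_mono) auto
    show ?thesis
    proof (cases "fst x = tm_qry M")
      case True
      have v4: "view (st us bs x) (Rg 4) = (case bs of [] \<Rightarrow> 0 | a # _ \<Rightarrow> enc_bit a)"
        using scan_rtape[OF less.prems(2)] by (simp add: st_def view_def split: list.splits)
      show ?thesis
      proof (cases bs)
        case Nil
        have "runs_to (Cond (\<lambda>v. v (Rg 4) = 1)
           (Seq (Upd (\<lambda>v. v(Rg 5 := tm_no M)) (move1 (Rg 4) 1)) (if b then Skip else check M N es b)) Fail) (st us bs x) (1 + 1) {}"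
          by (intro runs_to_Cond) (use v4 Nil runs_to_Fail in simp)
        then have "runs_to (answer M N es b) (st us bs x) (1 + 1 + 1) {}"
          unfolding answer_def by (intro runs_to_Cond) (use v4 Nil in simp)
        then have "runs_to ?c (st us bs x) (1 + 1 + 1 + 1) {}"
          by (intro runs_to_Cond) (use True in \<open>simp add: view5\<close>)
        then have "runs_to ?c (st us bs x) (?W - 1) {}" by (rule runs_to_mono) simp
        then show ?thesis using True na Nil by (intro stuck) (simp_all add: verify.simps[of M])
      next
        case (Cons a bs')
        let ?x = "(if a then tm_yes M else tm_no M, snd x)"
        have suf: "suffix (enc bs') l'" using less.prems(2) unfolding Cons by (auto intro: suffix_ConsD)
        have tn: "turn (rtape l' (enc_bit a # enc bs')) 1 = rtape l' (enc bs')"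
          using less.prems(2) unfolding Cons by (intro turn_rtape) simp
        have v: "view (st us bs x) z = scan (st us bs x z)" for z by (simp add: view_def)
        have other: "st us bs' ?x z = st us bs x z" if "z \<noteq> Rg 4" "z \<noteq> Rg 5" for z
          using that by (cases z) (auto simp: st_def vstore_def)
        have u: "runs_to (Upd (\<lambda>v. v(Rg 5 := fst ?x)) (move1 (Rg 4) 1)) (st us bs x) 1 {st us bs' ?x}"
        proof (rule runs_to_Upd, rule ext)
          fix z
          have "upd (rtape l' (enc_bit a # enc bs')) (scan (rtape l' (enc_bit a # enc bs'))) 1 = rtape l' (enc bs')"
            using tn by (simp add: upd_scan_turn)
          note up = this
          show "st us bs' ?x z = eff (st us bs x) ((view (st us bs x))(Rg 5 := fst ?x)) (move1 (Rg 4) 1) z"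
          proof (cases "z = Rg 4 \<or> z = Rg 5")
            case True
            then show ?thesis using up by (cases a) (auto simp: eff_def view_def move1_def st_def Cons)
          next
            case False
            then have "eff (st us bs x) ((view (st us bs x))(Rg 5 := fst ?x)) (move1 (Rg 4) 1) z = st us bs x z"
              by (simp add: eff_def v move1_def)
            then show ?thesis using other[of z] False by simp
          qed
        qed
        let ?d = "if a = b then check M N es b else Skip"
        let ?X = "if a = b then check_result M N es b l (rtape l' (enc bs')) ?x us else {st us bs' ?x}"
        have "runs_to ?d (st us bs' ?x) (check_time es K U) ?X"
        proof (cases "a = b")
          case True
          have "runs_to (check M N es b) (st us bs' ?x) (check_time es B (length us)) (check_result M N es b l (rtape l' (enc bs')) ?x us)"
            unfolding st_def using less.prems(3,4) by (intro runs_to_check[OF wf(2) ds(2) less.prems(1)]) simp_all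
          then have "runs_to (check M N es b) (st us bs' ?x) (check_time es K U) (check_result M N es b l (rtape l' (enc bs')) ?x us)"
            using ct by (rule runs_to_mono)
          then show ?thesis using True by simp
        next
          case False
          have "runs_to Skip (st us bs' ?x) (check_time es K U) {st us bs' ?x}"
            by (rule runs_to_mono[OF runs_to_Skip]) (simp add: check_time_def)
          then show ?thesis using False by simp
        qed
        then have sq: "runs_to (Seq (Upd (\<lambda>v. v(Rg 5 := fst ?x)) (move1 (Rg 4) 1)) ?d) (st us bs x) (1 + check_time es K U + 1) ?X"
          by (rule runs_to_Seq1[OF u])
        have "runs_to (answer M N es b) (st us bs x) (1 + check_time es K U + 1 + 1 + 1) ?X"
        proof (cases a)
          case True
          have "runs_to (answer M N es b) (st us bs x) (1 + check_time es K U + 1 + 1) ?X"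
            unfolding answer_def by (intro runs_to_Cond) (use v4 Cons True sq in \<open>cases b; simp add: enc_bit_def\<close>)
          then show ?thesis by (rule runs_to_mono) simp
        next
          case False
          have "runs_to (Cond (\<lambda>v. v (Rg 4) = 1)
             (Seq (Upd (\<lambda>v. v(Rg 5 := tm_no M)) (move1 (Rg 4) 1)) (if b then Skip else check M N es b)) Fail) (st us bs x) (1 + check_time es K U + 1 + 1) ?X"
            by (intro runs_to_Cond) (use v4 Cons False sq in \<open>cases b; simp add: enc_bit_def\<close>)
          then show ?thesis
            unfolding answer_def by (intro runs_to_Cond) (use v4 Cons False in \<open>simp add: enc_bit_def\<close>)
        qed
        then have "runs_to ?c (st us bs x) (1 + check_time es K U + 1 + 1 + 1 + 1) ?X"
          by (intro runs_to_Cond) (use True in \<open>simp add: view5\<close>)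
        then have r: "runs_to ?c (st us bs x) (?W - 1) ?X" by (rule runs_to_mono) simp
        have y: "\<forall>p\<ge>Suc B. fst (snd ?x 1) p = 0" "snd (snd ?x 1) \<le> Suc B" using less.prems(3,4) by auto
        have lt: "length bs' < length bs" "suffix bs' bs" using Cons by (auto simp: suffix_Cons)
        have V: "verify M ds N es b x bs us = (if a \<noteq> b then verify M ds N es b ?x bs' us
            else (case us of [] \<Rightarrow> False
              | False # us' \<Rightarrow> \<not> b \<and> verify M ds N es b ?x bs' us'
              | True # us' \<Rightarrow> (case guided_run N es (minit N (enc (tape_word (fst (snd x 1))))) us' of
                  None \<Rightarrow> False | Some us'' \<Rightarrow> \<not> b \<or> verify M ds N es b ?x bs' us'')))"
          using True na Cons by (simp add: verify.simps[of M ds N es b x] Let_def)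
        show ?thesis
        proof (cases "a = b")
          case False
          then have "verify M ds N es b x bs us = verify M ds N es b ?x bs' us" unfolding V by simp
          then show ?thesis using r False by (intro continue[OF _ lt _ y]) simp_all
        next
          case ab: True
          show ?thesis
          proof (cases us)
            case Nil
            then show ?thesis using r ab V by (intro stuck) (simp_all add: check_result_def)
          next
            case us: (Cons c us')
            have su: "suffix us' us" using us by (simp add: suffix_Cons)
            show ?thesis
            proof (cases c)
              case False
              show ?thesis
              proof (cases b)
                case True
                then show ?thesis using r ab us False V by (intro stuck) (simp_all add: check_result_def)
              next
                case nb: False
                have "?X = {st us' bs' ?x}" using ab us False nb by (simp add: check_result_def st_def)
                moreover have "verify M ds N es b x bs us = verify M ds N es b ?x bs' us'"
                  unfolding V using ab us False nb by simp
                ultimately show ?thesis using r by (intro continue[OF _ lt su y]) simp_all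
              qed
            next
              case c: True
              show ?thesis
              proof (cases "guided_run N es (minit N (enc (tape_word (fst (snd x 1))))) us'")
                case None
                then show ?thesis using r ab us c V by (intro stuck) (simp_all add: check_result_def)
              next
                case (Some us'')
                have "suffix us'' us" using guided_run_sound[OF wf(2) ds(2) Some] su suffix_order.trans by blast
                note su = this
                show ?thesis
                proof (cases b)
                  case True
                  have "?X = {st us'' bs' ?x}" using ab us c True Some by (simp add: check_result_def st_def)
                  moreover have "verify M ds N es b x bs us = verify M ds N es b ?x bs' us''"
                    unfolding V using ab us c True Some by simp
                  ultimately show ?thesis using r by (intro continue[OF _ lt su y]) simp_all
                next
                  case nb: False
                  have "verify M ds N es b x bs us" unfolding V using ab us c nb Some by simp
                  then show ?thesis
                    using r nb ab us c Some Cons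
                    by (intro finish[of "vstore (rtape l (enc us'')) (rtape l' (enc bs')) (snd (snd ?x 1)) 1 (tm_acc M, snd ?x) (blank_conf N)"])
                      (simp_all add: check_result_def)
                qed
              qed
            qed
          qed
        qed
      qed
    next
      case nq: False
      have nsrc: "Rg 4 \<noteq> Rg 5" "Rg 4 \<notin> range MT" "Rg 3 \<noteq> Rg 5" "Rg 3 \<notin> range MT" "Rg 3 \<noteq> Rg 4" by auto
      have *: "st us bs x (Rg 4) = rtape l' (enc bs)" by (simp add: st_def)
      have put: "put MT 5 x (st us bs x) = st us bs x" by (simp add: st_def vstore_put)
      let ?X = "case pick ds bs of None \<Rightarrow> {} | Some (d, bs') \<Rightarrow>
        (case fire (tm_tapes M) d x of None \<Rightarrow> {} | Some y \<Rightarrow>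
          {put MT 5 y ((st us bs x)(Rg 3 := turn (st us bs x (Rg 3)) ((\<lambda>(q, rd, q', wr, mv). mv ! 1) d), Rg 4 := rtape l' (enc bs')))})"
      have "runs_to ?step (put MT 5 x (st us bs x)) (4 * length ds + 1) ?X"
        by (rule runs_to_guided[where b = MT and l = l' and bs = bs and s = "st us bs x", OF is_block_simps(1) nsrc * less.prems(2)])
      then have "runs_to ?c (st us bs x) (4 * length ds + 1 + 1) ?X"
        unfolding put by (intro runs_to_Cond) (use nq in \<open>simp add: view5\<close>)
      then have r: "runs_to ?c (st us bs x) (?W - 1) ?X" by (rule runs_to_mono) simp
      show ?thesis
      proof (cases "\<exists>d bs1 y. pick ds bs = Some (d, bs1) \<and> fire (tm_tapes M) d x = Some y")
        case True
        then obtain d bs1 y where p: "pick ds bs = Some (d, bs1)" "fire (tm_tapes M) d x = Some y" by blast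
        have d: "d \<in> tm_delta M" using pick_mem[OF p(1)] ds(1) by simp
        note q = fire_query_tape[OF wf(1) d p(2) less.prems(3,4)]
        have "put MT 5 y ((st us bs x)(Rg 3 := turn (st us bs x (Rg 3)) (head_shift d), Rg 4 := rtape l' (enc bs1))) = st us bs1 y"
          unfolding st_def using q(3) by (simp add: vstore_upd vstore_put)
        then have "?X = {st us bs1 y}" using p by (simp add: head_shift_def)
        moreover have "verify M ds N es b x bs us = verify M ds N es b y bs1 us"
          using p nq na by (simp add: verify.simps[of M ds N es b x])
        ultimately show ?thesis
          using r pick_length[OF p(1)] pick_suffix[OF p(1)] q(1,2) by (intro continue[of y bs1 us]) simp_all
      next
        case nf: False
        then have "?X = {}" by (auto split: option.splits)
        moreover have "\<not> verify M ds N es b x bs us"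
          using nf nq na by (auto simp: verify.simps[of M ds N es b x] split: option.splits)
        ultimately show ?thesis using r by (intro stuck) simp_all
      qed
    qed
  qed
qed

section \<open>The complete verifier as a polynomial-time predicate\<close>

definition verifier_time :: "instr list \<Rightarrow> instr list \<Rightarrow> nat \<Rightarrow> nat" where
  "verifier_time ds es n = 8 * n + 30 + Suc n * (check_time es n n + 4 * length ds + 10)"

lemma runs_to_verifier:
  assumes wf: "wf_tm M" "wf_tm N" and ds: "set ds = tm_delta M" "set es = tm_delta N"
  shows "\<exists>X. runs_to (verifier M ds N es b) (init_store (enc3 w t u)) (verifier_time ds es (length w + length t + length u)) X \<and>
      (verify M ds N es b (minit M (enc w)) t u \<longleftrightarrow> X \<noteq> {})"
proof -
  let ?l = "enc3 w t u"
  let ?n = "length w + length t + length u"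
  let ?fin = "if b then Skip else Cond (\<lambda>v. v (Rg 7) = 1) Skip Fail"
  have suf: "suffix (enc t @ 3 # enc u) ?l" "suffix (enc u) ?l"
    by (simp_all add: enc3_def suffix_def)
  let ?S = "\<lambda>r tau x. vstore (rtape ?l r) tau 0 0 x (blank_conf N)"
  have 1: "runs_to (Upd (\<lambda>v. v(Rg 0 := 1, Rg 1 := 1, Rg 2 := 1, Rg 3 := 1, Rg 5 := tm_start M, Rg 6 := tm_start N)) (\<lambda>_. 0))
      (init_store ?l) 1 {?S ?l (reg 0) (blank_conf M)}"
  proof (rule runs_to_Upd, rule store_eqI)
    fix i
    show "?S ?l (reg 0) (blank_conf M) (Rg i) = eff (init_store ?l) ((view (init_store ?l))(Rg 0 := 1, Rg 1 := 1, Rg 2 := 1, Rg 3 := 1, Rg 5 := tm_start M, Rg 6 := tm_start N)) (\<lambda>_. 0) (Rg i)"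
      using upd_reg_ctr by (simp add: vstore_def eff_def view_def init_store_def)
  qed (simp_all add: eff_def view_def init_store_def rtape_def)
  have 2: "runs_to (load (MT 0)) (?S ?l (reg 0) (blank_conf M)) (4 * length w + 5) {?S (enc t @ 3 # enc u) (reg 0) (minit M (enc w))}"
  proof -
    have "runs_to (load (MT 0)) (?S ?l (reg 0) (blank_conf M)) (4 * length w + 5)
      {(?S ?l (reg 0) (blank_conf M))(Inp := rtape ?l (enc t @ 3 # enc u), MT 0 := (cells (enc w), 0))}"
      by (rule runs_to_load) (simp_all add: enc3_def)
    moreover have "(?S ?l (reg 0) (blank_conf M))(Inp := rtape ?l (enc t @ 3 # enc u), MT 0 := (cells (enc w), 0))
      = ?S (enc t @ 3 # enc u) (reg 0) (minit M (enc w))"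
      by (rule store_eqI; simp add: minit_def; simp add: vstore_def)
    ultimately show ?thesis by (simp only:)
  qed
  let ?s = "vstore (rtape ?l (enc u)) (rtape (enc t) (enc t)) 0 0 (minit M (enc w)) (blank_conf N)"
  have 3: "runs_to (load (Rg 4)) (?S (enc t @ 3 # enc u) (reg 0) (minit M (enc w))) (4 * length t + 5) {?s}"
  proof -
    have "runs_to (load (Rg 4)) (?S (enc t @ 3 # enc u) (reg 0) (minit M (enc w))) (4 * length t + 5)
      {(?S (enc t @ 3 # enc u) (reg 0) (minit M (enc w)))(Inp := rtape ?l (enc u), Rg 4 := (cells (enc t), 0))}"
      by (rule runs_to_load[OF _ suf(1)]) simp_all
    then show ?thesis by (simp add: vstore_upd rtape_def)
  qed
  have h: "snd (snd (minit M (enc w)) 1) = 0" "\<forall>p\<ge>0. fst (snd (minit M (enc w)) 1) p = 0"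
    by (simp_all add: minit_def reg_0)
  obtain X where X: "runs_to (verify_loop M ds N es b) ?s (Suc (length t) * (check_time es ?n ?n + 4 * length ds + 10)) X"
      "verify M ds N es b (minit M (enc w)) t u \<longleftrightarrow> (\<exists>s'\<in>X. b \<or> scan (s' (Rg 7)) = 1)"
    using runs_to_verify_loop[OF wf ds suf(2) suffix_order.refl h(2), of t ?n ?n b] h(1) by auto
  let ?Y = "\<lambda>s'. if b \<or> scan (s' (Rg 7)) = 1 then {s'} else {}"
  have 5: "runs_to ?fin s' 2 (?Y s')" for s'
  proof (cases b)
    case True
    then show ?thesis using runs_to_mono[OF runs_to_Skip, of 2 s'] by simp
  next
    case False
    have "runs_to (Cond (\<lambda>v. v (Rg 7) = 1) Skip Fail) s' (1 + 1) (?Y s')"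
      using False runs_to_Skip[of s'] runs_to_Fail[of s'] by (intro runs_to_Cond) (simp add: view_def)
    then show ?thesis using False by (simp add: numeral_2_eq_2)
  qed
  have "runs_to (verifier M ds N es b) (init_store ?l) (verifier_time ds es ?n) (\<Union>s'\<in>X. ?Y s')"
    unfolding verifier_def
  proof (rule runs_to_mono[OF runs_to_Seq1[OF 1 runs_to_Seq1[OF 2 runs_to_Seq1[OF 3 runs_to_Seq[OF X(1) 5]]]]])
    \<comment> \<open>Replacing the product by a variable leaves a linear inequality.\<close>
    have aux: "a \<le> b \<Longrightarrow> 1 + (4 * length w + 5 + (4 * length t + 5 + (a + 2 + 1) + 1) + 1) + 1 \<le> 8 * ?n + 30 + b" for a b
      by simp
    have "Suc (length t) * (check_time es ?n ?n + 4 * length ds + 10) \<le> Suc ?n * (check_time es ?n ?n + 4 * length ds + 10)"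
      by (rule mult_le_mono1) simp
    then show "1 + (4 * length w + 5 + (4 * length t + 5 + (Suc (length t) * (check_time es ?n ?n + 4 * length ds + 10) + 2 + 1) + 1) + 1) + 1
        \<le> verifier_time ds es ?n"
      unfolding verifier_time_def by (rule aux)
  qed
  moreover have "verify M ds N es b (minit M (enc w)) t u \<longleftrightarrow> (\<Union>s'\<in>X. ?Y s') \<noteq> {}"
    unfolding X(2) by auto
  ultimately show ?thesis by blast
qed

lemma pacc_final:
  assumes "runs_to p s T X"
  shows "pacc (Ob, [], []) ([p], s) \<longleftrightarrow> X \<noteq> {}" "pbounded (Ob, [], []) ([p], s) T"
proof -
  have "pacc (Ob, [], []) ([], s')" for s' by (subst reaches_unfold) simp
  then show "pacc (Ob, [], []) ([p], s) \<longleftrightarrow> X \<noteq> {}" using assms unfolding runs_to_def by blast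
  have "\<not> pstep (Ob, [], []) ([], s') y" for s' y by (simp add: pstep_def)
  then have "pbounded (Ob, [], []) ([], s') 0" for s' by (rule bounded_runs_stuck)
  then have "pbounded (Ob, [], []) ([p], s) (T + 0)" using assms unfolding runs_to_def by blast
  then show "pbounded (Ob, [], []) ([p], s) T" by simp
qed

text \<open>The size has to accommodate symbols, state numbers and tape indices of both machines;
  the summand 8 provides \<open>Rg 0\<close> to \<open>Rg 7\<close>.\<close>

lemma prog_ok_verifier:
  assumes wf: "wf_tm M" "wf_tm N" and ds: "set ds = tm_delta M" "set es = tm_delta N"
    and n: "n = tm_states M + tm_syms M + tm_tapes M + tm_states N + tm_syms N + tm_tapes N + 8"
  shows "prog_ok n (verifier M ds N es b)"
proof -
  have q: "tm_start M < n" "tm_acc M < n" "tm_yes M < n" "tm_no M < n" "tm_start N < n" "tm_no N < n" "tm_tapes N \<le> n" "8 \<le> n" "0 < n"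
    using wf unfolding n wf_tm_def by auto
  have v: "v x < n" if "view_ok n v" for v x using that by (simp add: view_ok_def)
  have load: "prog_ok n (load t)" if "t \<in> tset n" for t
    using that q v by (auto simp: load_def move1_def intro!: prog_ok_Upd)
  have cq: "prog_ok n copy_query"
    using q v by (auto simp: copy_query_def move1_def intro!: prog_ok_Upd)
  have b: "moves_ok n (\<lambda>z. if z \<in> NT ` {..<tm_tapes N} then d else 0)" if "d \<in> {-1, 0, 1}" for d
    using that q by (auto simp: moves_ok_def)
  have bv: "view_ok n (\<lambda>z. if z \<in> NT ` {..<tm_tapes N} then 0 else v z)" if "view_ok n v" for v
    using that q by (auto simp: view_ok_def)
  have cl: "prog_ok n (clear_block (tm_tapes N))"
    using q v b bv by (auto simp: clear_block_def Let_def intro!: prog_ok_Upd)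
  have gN: "prog_ok n (guided NT 6 (tm_tapes N) Inp (Rg 2) (\<lambda>_. 1) es)"
    by (rule prog_ok_guided[OF wf(2)]) (use ds q in \<open>auto simp: n\<close>)
  have gs: "prog_ok n (guided_sim N es NT 6 Inp (Rg 2))"
    using q v gN by (auto simp: guided_sim_def move1_def intro!: prog_ok_Upd)
  have ck: "prog_ok n (check M N es b)"
    using q v cq cl gs by (auto simp: check_def move1_def intro!: prog_ok_Upd)
  have an: "prog_ok n (answer M N es b)"
    using q v ck by (auto simp: answer_def move1_def intro!: prog_ok_Upd)
  have hs: "head_shift d \<in> {-1, 0, 1}" if "d \<in> tm_delta M" for d
  proof -
    obtain q rd q' wr mv where d': "d = (q, rd, q', wr, mv)" by (metis prod_cases5)
    show ?thesis using wf_delta(8,11)[OF wf(1) that[unfolded d']] wf(1) by (auto simp: head_shift_def d' wf_tm_def)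
  qed
  have gM: "prog_ok n (guided MT 5 (tm_tapes M) (Rg 4) (Rg 3) head_shift ds)"
    by (rule prog_ok_guided[OF wf(1)]) (use ds q hs in \<open>auto simp: n\<close>)
  have "prog_ok n (verify_loop M ds N es b)"
    using an gM by (simp add: verify_loop_def head_shift_def)
  then show ?thesis
    using q v load by (auto simp: verifier_def intro!: prog_ok_Upd)
qed

lemma prog_det_verifier: "prog_det (verifier M ds N es b)"
  by (simp add: verifier_def load_def copy_query_def clear_block_def Let_def guided_sim_def check_def answer_def
      verify_loop_def prog_det_guided)

lemma polytime_verify:
  assumes wf: "wf_tm M" "wf_tm N" and ds: "set ds = tm_delta M" "set es = tm_delta N"
  shows "polytime_pred3 (\<lambda>w t u. verify M ds N es b (minit M (enc w)) t u)"
proof -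
  define n where "n = tm_states M + tm_syms M + tm_tapes M + tm_states N + tm_syms N + tm_tapes N + 8"
  have "n \<ge> 4" by (simp add: n_def)
  then obtain V where V: "wf_tm V" "deterministic_tm V"
    "\<And>Ob inp. set inp \<subseteq> {..<4} \<Longrightarrow> accepts V Ob inp \<longleftrightarrow> pacc (Ob, [], []) ([verifier M ds N es b], init_store inp)"
    "\<And>Ob inp T. set inp \<subseteq> {..<4} \<Longrightarrow> time_bounded V Ob inp T \<longleftrightarrow> pbounded (Ob, [], []) ([verifier M ds N es b], init_store inp) T"
    using compile[OF _ prog_ok_verifier[OF wf ds n_def]] prog_det_verifier by metis
  have "poly_bounded (verifier_time ds es)"
    unfolding verifier_time_def check_time_def by (intro poly_bounded_intros)
  then obtain q where q: "\<And>n. verifier_time ds es n \<le> poly q n" unfolding poly_bounded_def by blast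
  have "time_bounded V {} (enc3 w t u) (poly q (length w + length t + length u)) \<and>
      (verify M ds N es b (minit M (enc w)) t u \<longleftrightarrow> accepts V {} (enc3 w t u))" for w t u
  proof -
    obtain X where X: "runs_to (verifier M ds N es b) (init_store (enc3 w t u)) (verifier_time ds es (length w + length t + length u)) X"
      "verify M ds N es b (minit M (enc w)) t u \<longleftrightarrow> X \<noteq> {}"
      using runs_to_verifier[OF wf ds] by blast
    have "time_bounded V {} (enc3 w t u) (poly q (length w + length t + length u))"
      unfolding V(4)[OF set_enc3] by (rule bounded_runs_mono[OF pacc_final(2)[OF X(1)] q])
    then show ?thesis
      unfolding V(3)[OF set_enc3] pacc_final(1)[OF X(1)] using X(2) by simp
  qed
  then show ?thesis unfolding polytime_pred3_def using V(1,2) by blast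
qed

subsection \<open>From oracle machines to predicates\<close>

lemma poly_nat_mono: "a \<le> b \<Longrightarrow> poly p a \<le> poly (p :: nat poly) b"
  by (induction p) (auto intro: add_mono mult_le_mono)

text \<open>\<open>M\<close> asks the queries and \<open>N\<close> decides the oracle in
  nondeterministic exponential time. Listing the instructions of each machine fixes the meaning of
  the indices in choice strings.\<close>

locale oracle_machine =
  fixes M N :: tm and ds es :: "instr list" and A :: "bool list set" and q :: "nat poly"
  assumes wf: "wf_tm M" "wf_tm N" and ds: "set ds = tm_delta M" "set es = tm_delta N"
    and time: "\<And>z. time_bounded N {} (enc z) (2 ^ poly q (length z))"
    and lang: "\<And>z. z \<in> A \<longleftrightarrow> accepts N {} (enc z)"
begin

text \<open>Steps of \<open>N\<close> on a word of length at most \<open>Z\<close>, times the bits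
  that a step may consume.\<close>

definition cert_len :: "nat \<Rightarrow> nat" where
  "cert_len Z = 2 ^ poly q Z * Suc (length es)"

lemma certificate:
  assumes "z \<in> A" "length z \<le> Z"
  obtains v where "length v \<le> cert_len Z" "\<And>rest. guided_run N es (minit N (enc z)) (v @ rest) = Some rest"
proof -
  obtain n y where n: "(mstep N {} ^^ n) (minit N (enc z)) y" "fst y = tm_acc N"
    using assms(1) lang accepts_iff_mstep[OF wf(2)] unfolding reaches_def by blast
  have "n \<le> 2 ^ poly q (length z)"
    using time[of z] n(1) unfolding time_bounded_iff_mstep[OF wf(2)] bounded_runs_def by blast
  also have "\<dots> \<le> 2 ^ poly q Z" using assms(2) by (intro power_increasing poly_nat_mono) auto
  finally have "n * Suc (length es) \<le> cert_len Z" unfolding cert_len_def by (rule mult_le_mono1)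
  then show ?thesis using guided_run_complete[OF wf(2) ds(2) n] that order.trans by blast
qed

lemma guided_run_mem: "guided_run N es (minit N (enc z)) v = Some v' \<Longrightarrow> z \<in> A"
  using guided_run_sound[OF wf(2) ds(2)] lang accepts_iff_mstep[OF wf(2)] by blast

abbreviation "ver \<equiv> verify M ds N es"

lemma verify_acc: "fst x = tm_acc M \<Longrightarrow> ver b x bs us = b"
  by (simp add: verify.simps[of M])

lemma verify_fire:
  assumes "fst x \<noteq> tm_acc M" "fst x \<noteq> tm_qry M" "pick ds bs = Some (d, bs')" "fire (tm_tapes M) d x = Some y"
  shows "ver b x bs us = ver b y bs' us"
  using assms by (simp add: verify.simps[of M ds N es b x])

abbreviation "answered a x \<equiv> (if a then tm_yes M else tm_no M, snd x)"
abbreviation "query x \<equiv> tape_word (fst (snd x 1))"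

lemma verify_query:
  assumes "fst x = tm_qry M"
  shows "ver b x (a # bs) us = (if a \<noteq> b then ver b (answered a x) bs us
            else (case us of [] \<Rightarrow> False
              | False # us' \<Rightarrow> \<not> b \<and> ver b (answered a x) bs us'
              | True # us' \<Rightarrow> (case guided_run N es (minit N (enc (query x))) us' of
                  None \<Rightarrow> False | Some us'' \<Rightarrow> \<not> b \<or> ver b (answered a x) bs us'')))"
proof -
  have "tm_acc M \<noteq> tm_qry M" using wf(1) by (simp add: wf_tm_def)
  then show ?thesis using assms by (simp add: verify.simps[of M ds N es b x] Let_def)
qed

text \<open>Both strings are read off an accepting run; every yes answer contributes one bit and a
  certificate to \<open>us\<close>. As all answers are correct, no negative answer can be refuted by
  any \<open>v\<close>, of whatever length. Since \<open>B\<close> grows by at most one per step, no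
  query of the run is longer than \<open>Z\<close>.\<close>

lemma verify_complete:
  "(mstep M A ^^ m) x y \<Longrightarrow> fst y = tm_acc M \<Longrightarrow> \<forall>p\<ge>B. fst (snd x 1) p = 0 \<Longrightarrow> snd (snd x 1) \<le> B \<Longrightarrow> B + m \<le> Z \<Longrightarrow>
   \<exists>bs us. length bs \<le> m * Suc (length ds) \<and> length us \<le> m * Suc (cert_len Z) \<and> ver True x bs us \<and> (\<forall>v. \<not> ver False x bs v)"
proof (induction m arbitrary: x B)
  case 0
  then show ?case by (intro exI[of _ "[]"]) (simp add: verify_acc)
next
  case (Suc m)
  obtain z where z: "mstep M A x z" "(mstep M A ^^ m) z y" using Suc.prems(1) unfolding relpowp_Suc_iff by blast
  have na: "fst x \<noteq> tm_acc M" using no_mstep_acc[OF wf(1)] z(1) by blast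
  show ?case
  proof (cases "fst x = tm_qry M")
    case True
    define a where "a \<longleftrightarrow> query x \<in> A"
    have zx: "z = answered a x" using z(1) True by (simp add: mstep_def a_def)
    obtain bs us where IH: "length bs \<le> m * Suc (length ds)" "length us \<le> m * Suc (cert_len Z)"
      "ver True z bs us" "\<And>v. \<not> ver False z bs v"
      using Suc.IH[OF z(2) Suc.prems(2), of B] Suc.prems(3-5) zx by auto
    have len: "length (query x) \<le> Z" using tape_word_props(1)[OF Suc.prems(3)] Suc.prems(5) by simp
    show ?thesis
    proof (cases a)
      case a: True
      then obtain v where v: "length v \<le> cert_len Z" "\<And>rest. guided_run N es (minit N (enc (query x))) (v @ rest) = Some rest"
        using certificate[OF _ len] a_def by blast
      have "ver True x (True # bs) (True # v @ us)" using IH(3) v(2) a by (simp add: verify_query[OF True] zx)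
      moreover have "\<not> ver False x (True # bs) u" for u using IH(4) a by (simp add: verify_query[OF True] zx)
      ultimately show ?thesis using IH(1,2) v(1)
        by (intro exI[of _ "True # bs"] exI[of _ "True # v @ us"]) auto
    next
      case a: False
      have "ver True x (False # bs) us" using IH(3) a by (simp add: verify_query[OF True] zx)
      moreover have "\<not> ver False x (False # bs) u" for u
      proof
        assume *: "ver False x (False # bs) u"
        show False
        proof (cases u)
          case Nil
          then show ?thesis using * by (simp add: verify_query[OF True])
        next
          case (Cons c u')
          have "guided_run N es (minit N (enc (query x))) u' = None"
            using guided_run_mem[of "query x" u'] a a_def by (cases "guided_run N es (minit N (enc (query x))) u'") auto
          then show ?thesis using * IH(4)[of u'] a by (cases c) (simp_all add: Cons verify_query[OF True] zx)
        qed
      qed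
      ultimately show ?thesis using IH(1,2)
        by (intro exI[of _ "False # bs"] exI[of _ us]) auto
    qed
  next
    case False
    then obtain d where d: "d \<in> set ds" "fire (tm_tapes M) d x = Some z"
      using z(1) mstep_fire[OF wf(1)] ds(1) by blast
    obtain cs where cs: "length cs \<le> length ds" "\<And>rest. pick ds (cs @ rest) = Some (d, rest)"
      using pick_complete[OF d(1)] by blast
    have dM: "d \<in> tm_delta M" using d(1) ds(1) by simp
    obtain bs us where IH: "length bs \<le> m * Suc (length ds)" "length us \<le> m * Suc (cert_len Z)"
      "ver True z bs us" "\<And>v. \<not> ver False z bs v"
      using Suc.IH[OF z(2) Suc.prems(2) fire_query_tape(1,2)[OF wf(1) dM d(2) Suc.prems(3,4)]] Suc.prems(5) by auto
    have "ver b x (cs @ bs) u = ver b z bs u" for b u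
      using verify_fire[OF na False cs(2) d(2)] .
    then show ?thesis using IH cs(1) by (intro exI[of _ "cs @ bs"] exI[of _ us]) auto
  qed
qed

text \<open>Wrong answers are detected in the order in which they are given: up to the first wrong answer the
  run is a genuine oracle computation, so its time bound limits the query and hence the length of \<open>v\<close>.\<close>

lemma verify_sound:
  "bounded_runs (mstep M A) x n \<Longrightarrow> \<forall>p\<ge>B. fst (snd x 1) p = 0 \<Longrightarrow> snd (snd x 1) \<le> B \<Longrightarrow> B + n \<le> Z \<Longrightarrow>
   ver True x bs us \<Longrightarrow> (\<And>v. length v \<le> n + Suc (cert_len Z) \<Longrightarrow> \<not> ver False x bs v) \<Longrightarrow>
   reaches (mstep M A) (\<lambda>x. fst x = tm_acc M) x"
proof (induction "length bs" arbitrary: x n B bs us rule: less_induct)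
  case less
  show ?case
  proof (cases "fst x = tm_acc M")
    case True
    then show ?thesis by (subst reaches_unfold) simp
  next
    case na: False
    show ?thesis
    proof (cases "fst x = tm_qry M")
      case True
      obtain a bs' where bs: "bs = a # bs'" using less.prems(5) na True by (cases bs) (auto simp: verify.simps[of M ds N es True x])
      have len: "length (query x) \<le> Z" using tape_word_props(1)[OF less.prems(2)] less.prems(4) by simp
      have "a \<longleftrightarrow> query x \<in> A"
      proof (cases a)
        case True
        \<comment> \<open>A yes answer is genuine because the verification with
          \<open>b = True\<close> has replayed an accepting run of \<open>N\<close> on the
          query.\<close>
        then show ?thesis using less.prems(5) guided_run_mem
          by (auto simp: bs verify_query[OF \<open>fst x = tm_qry M\<close>] split: list.splits bool.splits option.splits)
      next
        case False
        have "query x \<notin> A"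
        proof
          assume "query x \<in> A"
          then obtain v where v: "length v \<le> cert_len Z" "\<And>rest. guided_run N es (minit N (enc (query x))) (v @ rest) = Some rest"
            using certificate[OF _ len] by blast
          \<comment> \<open>A false no answer is refuted by one bit that requests the check,
            followed by the certificate.\<close>
          have "ver False x bs (True # v)" using v(2)[of "[]"] False by (simp add: bs verify_query[OF True])
          then show False using less.prems(6)[of "True # v"] v(1) by simp
        qed
        then show ?thesis using False by simp
      qed
      then have st: "mstep M A x (answered a x)" using True by (simp add: mstep_def)
      obtain n' where n': "n = Suc n'" "bounded_runs (mstep M A) (answered a x) n'"
        using bounded_runs_stepE[OF less.prems(1) st] .
      obtain us' where us': "ver True (answered a x) bs' us'"
        using less.prems(5) by (cases a) (auto simp: bs verify_query[OF True] split: list.splits bool.splits option.splits)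
      have no: "\<not> ver False (answered a x) bs' v" if "length v \<le> n' + Suc (cert_len Z)" for v
      proof (cases a)
        case a: True
        have "ver False x bs v = ver False (answered a x) bs' v" using a by (simp add: bs verify_query[OF True])
        then show ?thesis using less.prems(6)[of v] that n'(1) by simp
      next
        case a: False
        \<comment> \<open>The bit \<open>False\<close> passes over this query, so the refutation of
          a later answer becomes one symbol longer; the decrease of the time bound from
          \<open>n\<close> to \<open>n'\<close> pays for it.\<close>
        have "ver False x bs (False # v) = ver False (answered a x) bs' v" using a by (simp add: bs verify_query[OF True])
        then show ?thesis using less.prems(6)[of "False # v"] that n'(1) by simp
      qed
      have "reaches (mstep M A) (\<lambda>x. fst x = tm_acc M) (answered a x)"
        using less.hyps[of bs' "answered a x" n' B us'] n' less.prems(2-4) us' no by (simp add: bs)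
      then show ?thesis using st by (subst reaches_unfold) blast
    next
      case False
      obtain d bs' y where p: "pick ds bs = Some (d, bs')" "fire (tm_tapes M) d x = Some y"
        using less.prems(5) na False by (auto simp: verify.simps[of M ds N es True x] split: option.splits)
      have dM: "d \<in> tm_delta M" using pick_mem[OF p(1)] ds(1) by simp
      have st: "mstep M A x y" using mstep_fire[OF wf(1) False] dM p(2) by blast
      obtain n' where n': "n = Suc n'" "bounded_runs (mstep M A) y n'"
        using bounded_runs_stepE[OF less.prems(1) st] .
      note e = verify_fire[OF na False p]
      have "reaches (mstep M A) (\<lambda>x. fst x = tm_acc M) y"
      proof (rule less.hyps[OF pick_length[OF p(1)] n'(2) fire_query_tape(1,2)[OF wf(1) dM p(2) less.prems(2,3)]])
        show "\<not> ver False y bs' v" if "length v \<le> n' + Suc (cert_len Z)" for v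
          using less.prems(6)[of v] that n'(1) by (simp add: e)
      qed (use less.prems(4,5) n'(1) e in simp_all)
      then show ?thesis using st by (subst reaches_unfold) blast
    qed
  qed
qed

lemma exists_forall_characterization:
  fixes p :: "nat poly"
  assumes pt: "\<And>x. time_bounded M A (enc x) (poly p (length x))"
  shows "\<exists>P :: nat poly. \<forall>w. accepts M A (enc w) \<longleftrightarrow>
      (\<exists>t. length t \<le> poly P (length w) \<and>
        ((\<exists>u. length u \<le> 2 ^ poly P (length w) \<and> ver True (minit M (enc w)) t u) \<and>
         (\<forall>v. length v \<le> 2 ^ poly P (length w) \<longrightarrow> \<not> ver False (minit M (enc w)) t v)))"
proof -
  \<comment> \<open>The first summand bounds \<open>t\<close> and, being at least \<open>p\<close>,
    also supplies the exponent that absorbs a factor \<open>p\<close>. The second is the exponent of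
    the running time of \<open>N\<close> on the queries. The constant covers the length of index
    words, a successor and a factor 2.\<close>
  define P where "P = p * [:Suc (length ds):] + pcompose q p + [:Suc (Suc (length es)) + 2:]"
  have P: "poly p n * Suc (length ds) \<le> poly P n"
    "poly p n * Suc (cert_len (poly p n)) \<le> 2 ^ poly P n"
    "poly p n + Suc (cert_len (poly p n)) \<le> 2 ^ poly P n" for n
  proof -
    let ?Z = "poly p n" and ?E = "Suc (length es)"
    have e: "poly P n = ?Z * Suc (length ds) + poly q ?Z + (Suc ?E + 2)" by (simp add: P_def poly_pcompose)
    then show "?Z * Suc (length ds) \<le> poly P n" by simp
    have "cert_len ?Z \<le> 2 ^ (poly q ?Z + ?E)"
      unfolding cert_len_def power_add by (intro mult_le_mono2 less_imp_le less_exp)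
    moreover have "1 \<le> (2::nat) ^ (poly q ?Z + ?E)" by (rule one_le_power) simp
    moreover have "(2::nat) ^ (poly q ?Z + ?E + 1) = 2 * 2 ^ (poly q ?Z + ?E)" by (metis Suc_eq_plus1 power_Suc)
    ultimately have c: "Suc (cert_len ?Z) \<le> 2 ^ (poly q ?Z + ?E + 1)" by linarith
    have z: "?Z \<le> 2 ^ ?Z" by (intro less_imp_le less_exp)
    have "2 ^ ?Z * 2 ^ (poly q ?Z + ?E + 1) * 2 = (2::nat) ^ (?Z + (poly q ?Z + ?E + 1) + 1)" by (simp add: power_add)
    also have "\<dots> \<le> 2 ^ poly P n" by (intro power_increasing) (simp_all add: e)
    finally have m: "(2::nat) ^ ?Z * 2 ^ (poly q ?Z + ?E + 1) * 2 \<le> 2 ^ poly P n" .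
    have "?Z * Suc (cert_len ?Z) \<le> 2 ^ ?Z * 2 ^ (poly q ?Z + ?E + 1)" using z c by (rule mult_le_mono)
    then show "?Z * Suc (cert_len ?Z) \<le> 2 ^ poly P n" using m by linarith
    have "a + b \<le> a * b * 2" if "1 \<le> a" "1 \<le> b" for a b :: nat
      using that by (cases a; cases b) auto
    from this[OF one_le_power one_le_power, of 2 2 ?Z "poly q ?Z + ?E + 1"]
    have "(2::nat) ^ ?Z + 2 ^ (poly q ?Z + ?E + 1) \<le> 2 ^ ?Z * 2 ^ (poly q ?Z + ?E + 1) * 2" by simp
    then show "?Z + Suc (cert_len ?Z) \<le> 2 ^ poly P n"
      using z c m by linarith
  qed
  have h: "snd (snd (minit M (enc w)) 1) \<le> 0" "\<forall>p\<ge>0. fst (snd (minit M (enc w)) 1) p = 0" for w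
    by (simp_all add: minit_def reg_0)
  have "accepts M A (enc w) \<longleftrightarrow>
      (\<exists>t. length t \<le> poly P (length w) \<and>
        ((\<exists>u. length u \<le> 2 ^ poly P (length w) \<and> ver True (minit M (enc w)) t u) \<and>
         (\<forall>v. length v \<le> 2 ^ poly P (length w) \<longrightarrow> \<not> ver False (minit M (enc w)) t v)))" (is "_ = ?R") for w
  proof
    let ?Z = "poly p (length w)"
    assume "accepts M A (enc w)"
    then obtain m y where m: "(mstep M A ^^ m) (minit M (enc w)) y" "fst y = tm_acc M"
      unfolding accepts_iff_mstep[OF wf(1)] reaches_def by blast
    have mZ: "m \<le> ?Z"
      using pt[of w] m(1) unfolding time_bounded_iff_mstep[OF wf(1)] bounded_runs_def by blast
    obtain t u where tu: "length t \<le> m * Suc (length ds)" "length u \<le> m * Suc (cert_len ?Z)"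
      "ver True (minit M (enc w)) t u" "\<And>v. \<not> ver False (minit M (enc w)) t v"
      using verify_complete[OF m h(2,1), of ?Z] mZ by auto
    have "length t \<le> poly P (length w)"
      by (rule order.trans[OF tu(1) order.trans[OF mult_le_mono1[OF mZ] P(1)]])
    moreover have "length u \<le> 2 ^ poly P (length w)"
      by (rule order.trans[OF tu(2) order.trans[OF mult_le_mono1[OF mZ] P(2)]])
    ultimately show ?R using tu(3,4) by blast
  next
    let ?Z = "poly p (length w)"
    assume ?R
    then obtain t u where tu: "ver True (minit M (enc w)) t u"
      "\<And>v. length v \<le> 2 ^ poly P (length w) \<Longrightarrow> \<not> ver False (minit M (enc w)) t v" by blast
    have "\<not> ver False (minit M (enc w)) t v" if "length v \<le> ?Z + Suc (cert_len ?Z)" for v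
      by (rule tu(2)[OF order.trans[OF that P(3)]])
    then show "accepts M A (enc w)"
      using verify_sound[OF pt[of w, unfolded time_bounded_iff_mstep[OF wf(1)]] h(2,1), of ?Z] tu(1)
      unfolding accepts_iff_mstep[OF wf(1)] by simp
  qed
  then show ?thesis by blast
qed

end

lemma predicates_of_in_NP_NEXP:
  assumes "in_NP_NEXP L"
  shows "\<exists>(p :: nat poly) R S. polytime_pred3 R \<and> polytime_pred3 S \<and>
       (\<forall>w. w \<in> L \<longleftrightarrow>
          (\<exists>t. length t \<le> poly p (length w) \<and>
             ((\<exists>u. length u \<le> 2 ^ poly p (length w) \<and> R w t u) \<and>
              (\<forall>v. length v \<le> 2 ^ poly p (length w) \<longrightarrow> S w t v))))"
proof -
  obtain A M and p :: "nat poly" where A: "in_NEXP A" and M: "wf_tm M"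
    and tM: "\<And>x. time_bounded M A (enc x) (poly p (length x))" and L: "\<And>x. x \<in> L \<longleftrightarrow> accepts M A (enc x)"
    using assms unfolding in_NP_NEXP_def by blast
  obtain N and q :: "nat poly" where N: "wf_tm N"
    and tN: "\<And>x. time_bounded N {} (enc x) (2 ^ poly q (length x))" "\<And>x. x \<in> A \<longleftrightarrow> accepts N {} (enc x)"
    using A unfolding in_NEXP_def by blast
  have "finite (tm_delta M)" "finite (tm_delta N)" using M N by (auto simp: wf_tm_def)
  then obtain ds es where ds: "set ds = tm_delta M" "set es = tm_delta N" using finite_list by metis
  interpret oracle_machine M N ds es A q by unfold_locales (use M N ds tN in auto)
  obtain P :: "nat poly" where P: "\<forall>w. accepts M A (enc w) \<longleftrightarrow>
      (\<exists>t. length t \<le> poly P (length w) \<and>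
        ((\<exists>u. length u \<le> 2 ^ poly P (length w) \<and> ver True (minit M (enc w)) t u) \<and>
         (\<forall>v. length v \<le> 2 ^ poly P (length w) \<longrightarrow> \<not> ver False (minit M (enc w)) t v)))"
    using exists_forall_characterization[OF tM] by blast
  show ?thesis
    by (intro exI[of _ P] exI[of _ "\<lambda>w t u. ver True (minit M (enc w)) t u"]
        exI[of _ "\<lambda>w t v. \<not> ver False (minit M (enc w)) t v"] conjI)
      (use polytime_verify[OF M N ds] polytime_pred3_not L P in auto)
qed

subsection \<open>A nondeterministic machine for bounded existential witnesses\<close>

text \<open>Decodes a self-delimiting word: each bit is preceded by the marker \<open>True\<close>,
  and a \<open>False\<close> in marker position ends the word but is left unread, to be taken by
  \<open>drop_false\<close>.\<close>

fun unpair :: "bool list \<Rightarrow> (bool list \<times> bool list) option" where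
  "unpair (True # b # y) = (case unpair y of None \<Rightarrow> None | Some (w, r) \<Rightarrow> Some (b # w, r))"
| "unpair [True] = None"
| "unpair [] = Some ([], [])"
| "unpair (False # y) = Some ([], False # y)"

definition double :: "bool list \<Rightarrow> bool list" where
  "double w = concat (map (\<lambda>b. [True, b]) w)"

lemma double_simps [simp]: "double [] = []" "double (b # w) = True # b # double w"
  by (simp_all add: double_def)

lemma unpair_double: "unpair (double w @ False # r) = Some (w, False # r)"
  by (induction w) auto

lemma unpair_length: "unpair y = Some (w, r) \<Longrightarrow> suffix r y \<and> length w \<le> length y"
  by (induction y arbitrary: w r rule: unpair.induct) (auto split: option.splits simp: suffix_Cons)

definition gstore :: "nat \<Rightarrow> nat \<Rightarrow> tape \<Rightarrow> nat \<Rightarrow> nat \<Rightarrow> nat \<Rightarrow> nat \<Rightarrow> nat list \<Rightarrow> store" where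
  "gstore q1 q2 inp m a f g l = (\<lambda>z. case z of Inp \<Rightarrow> inp | Qry \<Rightarrow> reg 0
     | MT i \<Rightarrow> if i = 0 then (cells l, length l) else reg 0 | NT i \<Rightarrow> if i = 0 then (cells l, length l) else reg 0
     | Rg i \<Rightarrow> if i = 0 then ctr m else if i = 1 then ctr a else if i = 2 then ctr 0 else if i = 3 then ctr (length l)
         else if i = 4 then reg f else if i = 5 then reg g else if i = 6 then reg q1 else if i = 7 then reg q2 else reg 0)"

lemma gstore_simps [simp]:
  "gstore q1 q2 inp m a f g l Inp = inp" "gstore q1 q2 inp m a f g l Qry = reg 0"
  "gstore q1 q2 inp m a f g l (MT 0) = (cells l, length l)" "gstore q1 q2 inp m a f g l (NT 0) = (cells l, length l)"
  "gstore q1 q2 inp m a f g l (Rg 0) = ctr m" "gstore q1 q2 inp m a f g l (Rg (Suc 0)) = ctr a" "gstore q1 q2 inp m a f g l (Rg 2) = ctr 0"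
  "gstore q1 q2 inp m a f g l (Rg 3) = ctr (length l)" "gstore q1 q2 inp m a f g l (Rg 4) = reg f" "gstore q1 q2 inp m a f g l (Rg 5) = reg g"
  "gstore q1 q2 inp m a f g l (Rg 6) = reg q1" "gstore q1 q2 inp m a f g l (Rg 7) = reg q2"
  by (simp_all add: gstore_def)

lemma gstore_upd:
  "(gstore q1 q2 inp m a f g l)(Inp := inp') = gstore q1 q2 inp' m a f g l"
  "(gstore q1 q2 inp m a f g l)(Rg 0 := ctr m') = gstore q1 q2 inp m' a f g l"
  "(gstore q1 q2 inp m a f g l)(Rg (Suc 0) := ctr a') = gstore q1 q2 inp m a' f g l"
  by (rule store_eqI; simp; simp add: gstore_def)+

text \<open>The word goes to the input tapes of both machines at once, so the choice between them
  can wait until it is complete; \<open>Rg 3\<close> counts its cells for the rewinding.\<close>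

definition emit :: "(view \<Rightarrow> nat) \<Rightarrow> moves \<Rightarrow> prog" where
  "emit h m = Upd (\<lambda>v. v(MT 0 := h v, NT 0 := h v)) (m(MT 0 := 1, NT 0 := 1, Rg 3 := 1))"

lemma runs_to_emit:
  assumes "m (MT 0) = 0" "m (NT 0) = 0" "m (Rg 3) = 0" "\<And>i. i \<noteq> 0 \<Longrightarrow> m (MT i) = 0" "\<And>i. i \<noteq> 0 \<Longrightarrow> m (NT i) = 0"
    "\<And>i. i \<noteq> 1 \<Longrightarrow> m (Rg i) = 0" "m Qry = 0"
  shows "runs_to (emit h m) (gstore q1 q2 inp n a f g l) 1
    {gstore q1 q2 (turn inp (m Inp)) n (nat (int a + m (Rg 1))) f g (l @ [h (view (gstore q1 q2 inp n a f g l))])}"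
  unfolding emit_def
proof (rule runs_to_Upd)
  let ?s = "gstore q1 q2 inp n a f g l"
  let ?v = "view ?s"
  have v: "?v z = scan (?s z)" for z by (simp add: view_def)
  show "gstore q1 q2 (turn inp (m Inp)) n (nat (int a + m (Rg 1))) f g (l @ [h ?v]) =
    eff ?s (?v(MT 0 := h ?v, NT 0 := h ?v)) (m(MT 0 := 1, NT 0 := 1, Rg 3 := 1))"
  proof (rule store_eqI)
    fix i :: nat
    consider "i = 1" | "i = 3" | "i \<noteq> 1" "i \<noteq> 3" by blast
    then show "gstore q1 q2 (turn inp (m Inp)) n (nat (int a + m (Rg 1))) f g (l @ [h ?v]) (Rg i) =
      eff ?s (?v(MT 0 := h ?v, NT 0 := h ?v)) (m(MT 0 := 1, NT 0 := 1, Rg 3 := 1)) (Rg i)"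
    proof cases
      case 3
      then show ?thesis using assms(6)[of i] by (simp add: eff_def v) (simp add: gstore_def)
    qed (simp_all add: eff_def v upd_scan_turn nat_add_distrib)
  next
    fix i
    show "gstore q1 q2 (turn inp (m Inp)) n (nat (int a + m (Rg 1))) f g (l @ [h ?v]) (MT i) =
      eff ?s (?v(MT 0 := h ?v, NT 0 := h ?v)) (m(MT 0 := 1, NT 0 := 1, Rg 3 := 1)) (MT i)"
      using assms(4)[of i] by (cases "i = 0") (simp_all add: eff_def v upd_rtape_end, simp add: gstore_def)
    show "gstore q1 q2 (turn inp (m Inp)) n (nat (int a + m (Rg 1))) f g (l @ [h ?v]) (NT i) =
      eff ?s (?v(MT 0 := h ?v, NT 0 := h ?v)) (m(MT 0 := 1, NT 0 := 1, Rg 3 := 1)) (NT i)"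
      using assms(5)[of i] by (cases "i = 0") (simp_all add: eff_def v upd_rtape_end, simp add: gstore_def)
  qed (simp_all add: eff_def v upd_scan_turn assms)
qed

definition parse_unary :: prog where
  "parse_unary = While (\<lambda>v. v Inp = 2) (Move ((move1 Inp 1)(Rg 0 := 1)))"

definition skip_false :: prog where
  "skip_false = Cond (\<lambda>v. v Inp = 1) (Move (move1 Inp 1)) Fail"

definition parse_pairs :: prog where
  "parse_pairs = While (\<lambda>v. v Inp = 2) (Seq (Move (move1 Inp 1))
     (Cond (\<lambda>v. v Inp = 1 \<or> v Inp = 2) (emit (\<lambda>v. v Inp) (move1 Inp 1)) Fail))"

definition parse_separator :: prog where
  "parse_separator = Cond (\<lambda>v. v Inp = 1) (emit (\<lambda>_. 3) (move1 Inp 1)) Fail"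

definition drop_false :: "bool list \<Rightarrow> bool list option" where
  "drop_false y = (case y of False # y' \<Rightarrow> Some y' | _ \<Rightarrow> None)"

definition parse :: "bool list \<Rightarrow> (nat \<times> bool list \<times> bool list \<times> bool list) option" where
  "parse y = (case drop_false (dropWhile (\<lambda>b. b) y) of None \<Rightarrow> None | Some y1 \<Rightarrow>
     (case unpair y1 of None \<Rightarrow> None | Some (w, y2) \<Rightarrow>
     (case drop_false y2 of None \<Rightarrow> None | Some y3 \<Rightarrow>
     (case unpair y3 of None \<Rightarrow> None | Some (t, y4) \<Rightarrow>
     (case drop_false y4 of None \<Rightarrow> None | Some y5 \<Rightarrow>
     (case drop_false y5 of None \<Rightarrow> None | Some y6 \<Rightarrow> Some (length (takeWhile (\<lambda>b. b) y), w, t, y6)))))))"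

text \<open>The unary \<open>m\<close> makes the word at least as long as \<open>m\<close>, so that
  \<open>2 ^ m\<close> is exponential in its length. The part \<open>r\<close> comes last because a
  flag can then be added by appending to the query tape.\<close>

definition pack :: "nat \<Rightarrow> bool list \<Rightarrow> bool list \<Rightarrow> bool list \<Rightarrow> bool list" where
  "pack m w t r = replicate m True @ False # double w @ False # double t @ False # False # r"

lemma drop_false_simps [simp]: "drop_false (False # y) = Some y"
  by (simp add: drop_false_def)

lemma drop_false_suffix: "drop_false y = Some y' \<Longrightarrow> suffix y' y"
  by (auto simp: drop_false_def suffix_Cons split: list.splits bool.splits)

lemma drop_false_case: "(case y of False # y' \<Rightarrow> {f y'} | _ \<Rightarrow> {}) = (case drop_false y of None \<Rightarrow> {} | Some y' \<Rightarrow> {f y'})"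
  by (auto simp: drop_false_def split: list.splits bool.splits)

lemma parse_pack: "parse (pack m w t r) = Some (m, w, t, r)"
proof -
  have "dropWhile (\<lambda>b. b) (pack m w t r) = False # double w @ False # double t @ False # False # r"
    "takeWhile (\<lambda>b. b) (pack m w t r) = replicate m True"
    unfolding pack_def by (induction m) simp_all
  then show ?thesis by (simp add: parse_def unpair_double)
qed

text \<open>Stated for every word that can be parsed and not just for packed ones, since the time
  bound of the search must hold on all inputs.\<close>

lemma parse_length:
  assumes "parse y = Some (m, w, t, r)"
  shows "m \<le> length y" "length w \<le> length y" "length t \<le> length y"
proof -
  obtain y1 y2 y3 y4 where p: "drop_false (dropWhile (\<lambda>b. b) y) = Some y1" "unpair y1 = Some (w, y2)"
    "drop_false y2 = Some y3" "unpair y3 = Some (t, y4)" "m = length (takeWhile (\<lambda>b. b) y)"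
    using assms by (auto simp: parse_def split: option.splits)
  have "suffix y1 y" using drop_false_suffix[OF p(1)] suffix_dropWhile suffix_order.trans by blast
  moreover have "suffix y3 y1"
    using drop_false_suffix[OF p(3)] unpair_length[OF p(2)] suffix_order.trans by blast
  ultimately have "length y1 \<le> length y" "length y3 \<le> length y1" by (auto intro: suffix_length_le)
  then show "m \<le> length y" "length w \<le> length y" "length t \<le> length y"
    using unpair_length[OF p(2)] unpair_length[OF p(4)] p(5) by (auto simp: length_takeWhile_le)
qed

lemma runs_to_Seq_option:
  assumes "runs_to c s T (case z of None \<Rightarrow> {} | Some a \<Rightarrow> {f a})" "\<And>a. z = Some a \<Longrightarrow> runs_to d (f a) T' (Y a)"
  shows "runs_to (Seq c d) s (T + T' + 1) (case z of None \<Rightarrow> {} | Some a \<Rightarrow> Y a)"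
proof (cases z)
  case None
  then have "runs_to (Seq c d) s (T + 1) {}" using assms(1) by (intro runs_to_Seq0) simp
  then show ?thesis using None by (auto intro: runs_to_mono)
next
  case (Some a)
  then show ?thesis using assms runs_to_Seq1[of c s T "f a" d T' "Y a"] by simp
qed

definition read_flag :: prog where
  "read_flag = Cond (\<lambda>v. v Inp = 2) (Write (Rg 4) 1) Skip"

definition parser :: prog where
  "parser = Seq parse_unary (Seq skip_false (Seq parse_pairs (Seq parse_separator
     (Seq parse_pairs (Seq parse_separator (Seq skip_false read_flag))))))"

definition flag :: "bool list \<Rightarrow> nat" where
  "flag y = (case y of True # _ \<Rightarrow> 1 | _ \<Rightarrow> 0)"

context
  fixes q1 q2 :: nat and y0 :: "bool list"
begin

abbreviation "gst y m a f g l \<equiv> gstore q1 q2 (rtape (enc y0) (enc y)) m a f g l"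

lemma view_gst: "suffix y y0 \<Longrightarrow> view (gst y m a f g l) Inp = (case y of [] \<Rightarrow> 0 | b # _ \<Rightarrow> enc_bit b)"
  by (rule view_Inp[OF _ suffix_enc]) simp_all

lemma turn_inp: "suffix (b # y) y0 \<Longrightarrow> turn (rtape (enc y0) (enc_bit b # enc y)) 1 = rtape (enc y0) (enc y)"
  using turn_rtape[of "enc_bit b" "enc y" "enc y0"] suffix_enc[of "b # y" y0] by simp

lemma runs_to_parse_unary:
  "suffix y y0 \<Longrightarrow> runs_to parse_unary (gst y m 0 0 0 []) (2 * length y + 1)
    {gst (dropWhile (\<lambda>b. b) y) (m + length (takeWhile (\<lambda>b. b) y)) 0 0 0 []}"
proof (induction y arbitrary: m)
  case Nil
  have "runs_to parse_unary (gst [] m 0 0 0 []) 1 {gst [] m 0 0 0 []}"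
    unfolding parse_unary_def by (rule runs_to_While_done) (use view_gst[OF Nil] in simp)
  then show ?case by simp
next
  case (Cons b y)
  show ?case
  proof (cases b)
    case True
    have "runs_to (Move ((move1 Inp 1)(Rg 0 := 1))) (gst (b # y) m 0 0 0 []) 1 {gst y (Suc m) 0 0 0 []}"
      using runs_to_Move[of "(move1 Inp 1)(Rg 0 := 1)" "gst (b # y) m 0 0 0 []"] turn_inp[OF Cons.prems]
      by (simp add: bump_move2 gstore_upd nat_add_distrib)
    moreover have "runs_to parse_unary (gst y (Suc m) 0 0 0 []) (2 * length y + 1)
        {gst (dropWhile (\<lambda>b. b) y) (Suc m + length (takeWhile (\<lambda>b. b) y)) 0 0 0 []}"
      using Cons by (blast intro: suffix_ConsD)
    ultimately have "runs_to parse_unary (gst (b # y) m 0 0 0 []) (1 + (2 * length y + 1) + 1)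
        {gst (dropWhile (\<lambda>b. b) y) (Suc m + length (takeWhile (\<lambda>b. b) y)) 0 0 0 []}"
      unfolding parse_unary_def by (intro runs_to_While_step1) (use view_gst[OF Cons.prems] True in \<open>simp_all add: enc_bit_def\<close>)
    then show ?thesis by (rule runs_to_eq) (use True in simp_all)
  next
    case False
    have "runs_to parse_unary (gst (b # y) m 0 0 0 []) 1 {gst (b # y) m 0 0 0 []}"
      unfolding parse_unary_def by (rule runs_to_While_done) (use view_gst[OF Cons.prems] False in \<open>simp add: enc_bit_def\<close>)
    then show ?thesis by (rule runs_to_eq) (use False in simp_all)
  qed
qed

lemma runs_to_skip_false:
  "suffix y y0 \<Longrightarrow> runs_to skip_false (gst y m 0 0 0 l) 2 (case y of False # y' \<Rightarrow> {gst y' m 0 0 0 l} | _ \<Rightarrow> {})"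
proof -
  assume y: "suffix y y0"
  have "runs_to (if view (gst y m 0 0 0 l) Inp = 1 then Move (move1 Inp 1) else Fail) (gst y m 0 0 0 l) 1
      (case y of False # y' \<Rightarrow> {gst y' m 0 0 0 l} | _ \<Rightarrow> {})"
  proof (cases "\<exists>y'. y = False # y'")
    case True
    then obtain y' where y': "y = False # y'" by blast
    show ?thesis
      using runs_to_Move[of "move1 Inp 1" "gst y m 0 0 0 l"] turn_inp[of False y'] y view_gst[OF y, of m 0 0 0 l]
      by (simp add: y' bump_move1 gstore_upd enc_bit_def)
  next
    case False
    then have "view (gst y m 0 0 0 l) Inp \<noteq> 1"
      using view_gst[OF y, of m 0 0 0 l] by (cases y) (auto simp: enc_bit_def split: if_splits)
    then show ?thesis using False runs_to_Fail by (auto split: list.splits bool.splits)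
  qed
  from runs_to_Cond[where g = "\<lambda>v. v Inp = 1", OF this] show ?thesis
    unfolding skip_false_def by (simp add: numeral_2_eq_2)
qed

lemma runs_to_parse_pairs:
  "suffix y y0 \<Longrightarrow> runs_to parse_pairs (gst y m 0 0 0 l) (5 * length y + 1)
    (case unpair y of None \<Rightarrow> {} | Some (w, r) \<Rightarrow> {gst r m 0 0 0 (l @ enc w)})"
proof (induction y arbitrary: l rule: unpair.induct)
  case (1 b y)
  have s: "suffix (b # y) y0" "suffix y y0" using 1(2) by (auto dest: suffix_ConsD)
  let ?c = "Cond (\<lambda>v. v Inp = 1 \<or> v Inp = 2) (emit (\<lambda>v. v Inp) (move1 Inp 1)) Fail"
  have a: "runs_to (Move (move1 Inp 1)) (gst (True # b # y) m 0 0 0 l) 1 {gst (b # y) m 0 0 0 l}"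
    using runs_to_Move[of "move1 Inp 1" "gst (True # b # y) m 0 0 0 l"] turn_inp[OF 1(2)]
    by (simp add: bump_move1 gstore_upd)
  have "runs_to (emit (\<lambda>v. v Inp) (move1 Inp 1)) (gst (b # y) m 0 0 0 l) 1 {gst y m 0 0 0 (l @ [enc_bit b])}"
    using runs_to_emit[of "move1 Inp 1" "\<lambda>v. v Inp" q1 q2 "rtape (enc y0) (enc (b # y))" m 0 0 0 l] turn_inp[OF s(1)]
      view_gst[OF s(1)] by (simp add: move1_def)
  then have "runs_to ?c (gst (b # y) m 0 0 0 l) (1 + 1) {gst y m 0 0 0 (l @ [enc_bit b])}"
    by (intro runs_to_Cond) (use view_gst[OF s(1), of m 0 0 0 l] enc_bit_range[of b] in auto)
  then have body: "runs_to (Seq (Move (move1 Inp 1)) ?c) (gst (True # b # y) m 0 0 0 l) (1 + (1 + 1) + 1) {gst y m 0 0 0 (l @ [enc_bit b])}"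
    by (rule runs_to_Seq1[OF a])
  have "runs_to parse_pairs (gst (True # b # y) m 0 0 0 l) (1 + (1 + 1) + 1 + (5 * length y + 1) + 1)
      (case unpair y of None \<Rightarrow> {} | Some (w, r) \<Rightarrow> {gst r m 0 0 0 ((l @ [enc_bit b]) @ enc w)})"
    unfolding parse_pairs_def
    by (rule runs_to_While_step1[OF _ body 1(1)[OF s(2), unfolded parse_pairs_def]])
      (use view_gst[OF 1(2), of m 0 0 0 l] in \<open>simp add: enc_bit_def\<close>)
  then show ?case by (rule runs_to_eq) (auto split: option.splits)
next
  case 2
  have s: "suffix [] y0" by simp
  let ?c = "Cond (\<lambda>v. v Inp = 1 \<or> v Inp = 2) (emit (\<lambda>v. v Inp) (move1 Inp 1)) Fail"
  have a: "runs_to (Move (move1 Inp 1)) (gst [True] m 0 0 0 l) 1 {gst [] m 0 0 0 l}"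
    using runs_to_Move[of "move1 Inp 1" "gst [True] m 0 0 0 l"] turn_inp[OF 2]
    by (simp add: bump_move1 gstore_upd)
  have "runs_to ?c (gst [] m 0 0 0 l) (1 + 1) {}"
    by (intro runs_to_Cond) (use view_gst[OF s, of m 0 0 0 l] runs_to_Fail in simp)
  then have body: "runs_to (Seq (Move (move1 Inp 1)) ?c) (gst [True] m 0 0 0 l) (1 + (1 + 1) + 1) {}"
    by (rule runs_to_Seq1[OF a])
  have "runs_to parse_pairs (gst [True] m 0 0 0 l) (1 + (1 + 1) + 1 + 1) {}"
    unfolding parse_pairs_def
    by (rule runs_to_While_step0[OF _ body]) (use view_gst[OF 2, of m 0 0 0 l] in \<open>simp add: enc_bit_def\<close>)
  then show ?case by (rule runs_to_eq) auto
next
  case 3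
  have "runs_to parse_pairs (gst [] m 0 0 0 l) 1 {gst [] m 0 0 0 l}"
    unfolding parse_pairs_def by (rule runs_to_While_done) (use view_gst[OF 3] in simp)
  then show ?case by simp
next
  case (4 y)
  have "runs_to parse_pairs (gst (False # y) m 0 0 0 l) 1 {gst (False # y) m 0 0 0 l}"
    unfolding parse_pairs_def by (rule runs_to_While_done) (use view_gst[OF 4] in \<open>simp add: enc_bit_def\<close>)
  then show ?case by (rule runs_to_eq) auto
qed

lemma runs_to_parse_separator:
  "suffix y y0 \<Longrightarrow> runs_to parse_separator (gst y m 0 0 0 l) 2 (case y of False # y' \<Rightarrow> {gst y' m 0 0 0 (l @ [3])} | _ \<Rightarrow> {})"
proof -
  assume y: "suffix y y0"
  have "runs_to (if view (gst y m 0 0 0 l) Inp = 1 then emit (\<lambda>_. 3) (move1 Inp 1) else Fail) (gst y m 0 0 0 l) 1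
      (case y of False # y' \<Rightarrow> {gst y' m 0 0 0 (l @ [3])} | _ \<Rightarrow> {})"
  proof (cases "\<exists>y'. y = False # y'")
    case True
    then obtain y' where y': "y = False # y'" by blast
    show ?thesis
      using runs_to_emit[of "move1 Inp 1" "\<lambda>_. 3" q1 q2 "rtape (enc y0) (enc y)" m 0 0 0 l] turn_inp[of False y'] y view_gst[OF y, of m 0 0 0 l]
      by (simp add: y' enc_bit_def move1_def)
  next
    case False
    then have "view (gst y m 0 0 0 l) Inp \<noteq> 1"
      using view_gst[OF y, of m 0 0 0 l] by (cases y) (auto simp: enc_bit_def split: if_splits)
    then show ?thesis using False runs_to_Fail by (auto split: list.splits bool.splits)
  qed
  from runs_to_Cond[where g = "\<lambda>v. v Inp = 1", OF this] show ?thesis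
    unfolding parse_separator_def by (simp add: numeral_2_eq_2)
qed

lemma runs_to_read_flag:
  assumes "suffix y y0"
  shows "runs_to read_flag (gst y m 0 0 0 l) 2 {gst y m 0 (flag y) 0 l}"
proof -
  have "runs_to (if view (gst y m 0 0 0 l) Inp = 2 then Write (Rg 4) 1 else Skip) (gst y m 0 0 0 l) 1 {gst y m 0 (flag y) 0 l}"
  proof (cases "\<exists>y'. y = True # y'")
    case True
    have "runs_to (Write (Rg 4) 1) (gst y m 0 0 0 l) 1 {gst y m 0 1 0 l}"
      by (rule runs_to_Upd, rule store_eqI; simp add: eff_def view_def; simp add: gstore_def)
    then show ?thesis using True view_gst[OF assms, of m 0 0 0 l] by (auto simp: flag_def enc_bit_def)
  next
    case False
    then have "flag y = 0" "view (gst y m 0 0 0 l) Inp \<noteq> 2"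
      using view_gst[OF assms, of m 0 0 0 l] by (auto simp: flag_def enc_bit_def split: list.splits bool.splits if_splits)
    then show ?thesis using runs_to_Skip by simp
  qed
  from runs_to_Cond[where g = "\<lambda>v. v Inp = 2", OF this] show ?thesis
    unfolding read_flag_def by (simp add: numeral_2_eq_2)
qed

lemma runs_to_parser:
  "runs_to parser (gst y0 0 0 0 0 []) (12 * length y0 + 22)
    (case parse y0 of None \<Rightarrow> {} | Some (m, w, t, r) \<Rightarrow> {gst r m 0 (flag r) 0 (enc w @ [3] @ enc t @ [3])})"
proof -
  let ?n = "length y0"
  let ?m = "length (takeWhile (\<lambda>b. b) y0)"
  let ?y = "dropWhile (\<lambda>b. b) y0"
  note sl = suffix_length_le
  have sep: "runs_to parse_separator (gst y m 0 0 0 l) 2 (case drop_false y of None \<Rightarrow> {} | Some y' \<Rightarrow> {gst y' m 0 0 0 (l @ [3])})"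
    if "suffix y y0" for y m l
    using runs_to_parse_separator[OF that, of m l] unfolding drop_false_case .
  have skip: "runs_to skip_false (gst y m 0 0 0 l) 2 (case drop_false y of None \<Rightarrow> {} | Some y' \<Rightarrow> {gst y' m 0 0 0 l})"
    if "suffix y y0" for y m l
    using runs_to_skip_false[OF that, of m l] unfolding drop_false_case .
  have pairs: "runs_to parse_pairs (gst y m 0 0 0 l) (5 * ?n + 1)
      (case unpair y of None \<Rightarrow> {} | Some a \<Rightarrow> {gst (snd a) m 0 0 0 (l @ enc (fst a))})"
    if "suffix y y0" for y m l
    by (rule runs_to_eq[OF runs_to_parse_pairs[OF that]]) (use sl[OF that] in \<open>auto split: option.splits\<close>)
  have 0: "runs_to parse_unary (gst y0 0 0 0 0 []) (2 * ?n + 1) {gst ?y ?m 0 0 0 []}"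
    using runs_to_parse_unary[of y0 0] by simp
  have sy: "suffix ?y y0" by (rule suffix_dropWhile)
  have drop: "drop_false y = Some y' \<Longrightarrow> suffix y y0 \<Longrightarrow> suffix y' y0" for y y'
    using drop_false_suffix suffix_order.trans by blast
  have unp: "unpair y = Some a \<Longrightarrow> suffix y y0 \<Longrightarrow> suffix (snd a) y0" for y a
    using unpair_length[of y "fst a" "snd a"] suffix_order.trans by auto
  have "runs_to parser (gst y0 0 0 0 0 []) (2 * ?n + 1 + (2 + (5 * ?n + 1 + (2 + (5 * ?n + 1 + (2 + (2 + 2 + 1) + 1) + 1) + 1) + 1) + 1) + 1)
    (case drop_false ?y of None \<Rightarrow> {} | Some y1 \<Rightarrow>
     (case unpair y1 of None \<Rightarrow> {} | Some a \<Rightarrow>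
     (case drop_false (snd a) of None \<Rightarrow> {} | Some y3 \<Rightarrow>
     (case unpair y3 of None \<Rightarrow> {} | Some b \<Rightarrow>
     (case drop_false (snd b) of None \<Rightarrow> {} | Some y5 \<Rightarrow>
     (case drop_false y5 of None \<Rightarrow> {} | Some y6 \<Rightarrow> {gst y6 ?m 0 (flag y6) 0 (((([] @ enc (fst a)) @ [3]) @ enc (fst b)) @ [3])}))))))"
    unfolding parser_def
    \<comment> \<open>Each stage asks only that its unread rest be a suffix of the input;
      \<open>drop\<close> and \<open>unp\<close> hand this on from stage to stage.\<close>
    by (assumption | rule sy runs_to_Seq1[OF 0] runs_to_Seq_option[OF skip] runs_to_Seq_option[OF sep] runs_to_Seq_option[OF pairs]
        runs_to_read_flag drop unp)+
  then show ?thesis by (rule runs_to_eq) (auto simp: parse_def split: option.splits)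
qed

end

section \<open>Computing the bound on the witness length by repeated doubling\<close>

definition double_ctr :: prog where
  "double_ctr = Seq (Drain (Rg 1) (Seq (Move ((move1 (Rg 1) (-1))(Rg 2 := 1))) (Move (move1 (Rg 2) 1))))
     (Drain (Rg 2) (Move ((move1 (Rg 2) (-1))(Rg 1 := 1))))"

lemma runs_to_double_ctr:
  assumes s: "s (Rg 1) = ctr a" "s (Rg 2) = ctr 0"
  shows "runs_to double_ctr s (8 * a + 3) {s(Rg 1 := ctr (2 * a))}"
proof -
  let ?\<sigma> = "\<lambda>j. s(Rg 1 := ctr (a - j), Rg 2 := ctr (2 * j))"
  let ?c = "Seq (Move ((move1 (Rg 1) (-1))(Rg 2 := 1))) (Move (move1 (Rg 2) 1))"
  have "runs_to (Drain (Rg 1) ?c) (?\<sigma> 0) (a * (1 + 1 + 1 + 1) + 1) {?\<sigma> a}"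
  proof (rule runs_to_iterate)
    fix j assume j: "j < a"
    let ?s = "s(Rg 1 := ctr (a - Suc j), Rg 2 := ctr (2 * j + 1))"
    have "nat (int (a - j) - 1) = a - Suc j" by simp
    then have 1: "runs_to (Move ((move1 (Rg 1) (-1))(Rg 2 := 1))) (?\<sigma> j) 1 {?s}"
      using runs_to_Move[of "(move1 (Rg 1) (-1))(Rg 2 := 1)" "?\<sigma> j"] by (simp add: bump_move2 fun_upd_twist nat_add_distrib nat_mult_distrib)
    have 2: "runs_to (Move (move1 (Rg 2) 1)) ?s 1 {?\<sigma> (Suc j)}"
      using runs_to_Move[of "move1 (Rg 2) 1" ?s] by (simp add: bump_move1 nat_add_distrib nat_mult_distrib)
    show "runs_to ?c (?\<sigma> j) (1 + 1 + 1) {?\<sigma> (Suc j)}" by (rule runs_to_Seq1[OF 1 2])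
  next
    fix j assume "j \<le> a"
    then show "(\<not> at_zero (Rg 1) (view (?\<sigma> j))) \<longleftrightarrow> j < a" by (auto simp: at_zero_ctr[of _ _ "a - j"])
  qed
  moreover have "?\<sigma> 0 = s" using s by (auto simp: fun_eq_iff)
  ultimately have 1: "runs_to (Drain (Rg 1) ?c) s (a * (1 + 1 + 1 + 1) + 1) {?\<sigma> a}" by (simp only:)
  have 2: "runs_to (Drain (Rg 2) (Move ((move1 (Rg 2) (-1))(Rg 1 := 1)))) (?\<sigma> a) (2 * (2 * a) + 1) {s(Rg 1 := ctr (2 * a))}"
  proof (rule runs_to_eq[OF runs_to_Drain_Move[where n = "2 * a"]])
    show "{\<lambda>y. shift (((move1 (Rg 2) (- 1))(Rg 1 := 1)) y) (2 * a) (?\<sigma> a y)} = {s(Rg 1 := ctr (2 * a))}"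
      using s by (auto simp: fun_eq_iff move1_def)
  qed (auto simp: move1_def)
  show ?thesis
    unfolding double_ctr_def by (rule runs_to_mono[OF runs_to_Seq1[OF 1 2]]) simp
qed

definition exponentiate :: prog where
  "exponentiate = Seq (Move (move1 (Rg 1) 1)) (Drain (Rg 0) (Seq (Move (move1 (Rg 0) (-1))) double_ctr))"

lemma runs_to_exponentiate:
  "runs_to exponentiate (gstore q1 q2 inp m 0 f 0 l) (m * (8 * 2 ^ m + 6) + 3) {gstore q1 q2 inp 0 (2 ^ m) f 0 l}"
proof -
  let ?\<sigma> = "\<lambda>j. gstore q1 q2 inp (m - j) (2 ^ j) f 0 l"
  let ?c = "Seq (Move (move1 (Rg 0) (-1))) double_ctr"
  have 1: "runs_to (Move (move1 (Rg 1) 1)) (gstore q1 q2 inp m 0 f 0 l) 1 {?\<sigma> 0}"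
    using runs_to_Move[of "move1 (Rg 1) 1" "gstore q1 q2 inp m 0 f 0 l"] by (simp add: bump_move1 gstore_upd)
  have 2: "runs_to (Drain (Rg 0) ?c) (?\<sigma> 0) (m * (8 * 2 ^ m + 5 + 1) + 1) {?\<sigma> m}"
  proof (rule runs_to_iterate)
    fix j assume j: "j < m"
    let ?s = "gstore q1 q2 inp (m - Suc j) (2 ^ j) f 0 l"
    have "nat (int (m - j) - 1) = m - Suc j" by simp
    then have a: "runs_to (Move (move1 (Rg 0) (-1))) (?\<sigma> j) 1 {?s}"
      using runs_to_Move[of "move1 (Rg 0) (-1)" "?\<sigma> j"] by (simp add: bump_move1 gstore_upd)
    have b: "runs_to double_ctr ?s (8 * 2 ^ j + 3) {?\<sigma> (Suc j)}"
      using runs_to_double_ctr[of ?s "2 ^ j"] by (simp add: gstore_upd)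
    \<comment> \<open>\<open>runs_to_iterate\<close> wants one bound for all rounds, so every
      doubling is charged as if the counter already had its final value.\<close>
    have "(2::nat) ^ j \<le> 2 ^ m" using j by (intro power_increasing) auto
    then show "runs_to ?c (?\<sigma> j) (8 * 2 ^ m + 5) {?\<sigma> (Suc j)}"
      by (intro runs_to_mono[OF runs_to_Seq1[OF a b]]) simp
  next
    fix j assume "j \<le> m"
    then show "(\<not> at_zero (Rg 0) (view (?\<sigma> j))) \<longleftrightarrow> j < m" by (auto simp: at_zero_ctr[of _ _ "m - j"])
  qed
  show ?thesis
    unfolding exponentiate_def by (rule runs_to_eq[OF runs_to_Seq1[OF 1 2]]) simp_all
qed

text \<open>The guessed symbol is one of the bits 1 and 2, or the blank 0, which ends the
  word.\<close>

definition guess :: "tp \<Rightarrow> prog" where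
  "guess x = Act (\<lambda>v. {(v(x := g), \<lambda>_. 0) | g. g \<le> 2})"

lemma runs_to_guess:
  assumes "s x = reg a"
  shows "runs_to (guess x) s 1 {s(x := reg g) | g. g \<le> 2}"
proof -
  have "eff s ((view s)(x := g)) (\<lambda>_. 0) = s(x := reg g)" for g
    using assms by (auto simp: fun_eq_iff eff_def view_def)
  moreover have "{eff s w m | w m. (w, m) \<in> {((view s)(x := g), \<lambda>_. 0) | g. g \<le> 2}} =
      {eff s ((view s)(x := g)) (\<lambda>_. 0) | g. g \<le> 2}"
    by blast
  ultimately have "{eff s w m | w m. (w, m) \<in> {((view s)(x := g), \<lambda>_. 0) | g. g \<le> 2}} = {s(x := reg g) | g. g \<le> 2}"
    by (simp only:)
  then show ?thesis using runs_to_Act[of "\<lambda>v. {(v(x := g), \<lambda>_. 0) | g. g \<le> 2}" s] by (simp add: guess_def)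
qed

definition guess_loop :: prog where
  "guess_loop = While (\<lambda>v. v (Rg 5) \<noteq> 0) (Cond (at_zero (Rg 1)) Fail
     (Seq (emit (\<lambda>v. v (Rg 5)) (move1 (Rg 1) (-1))) (guess (Rg 5))))"

text \<open>A word of length at most \<open>a\<close> is either empty, matching the guess 0, or a
  bit in front of a shorter word. \<open>H\<close> is arbitrary because both guessing loops,
  \<open>guess_loop\<close> and \<open>put_guess\<close>, lead to such a union.\<close>

lemma guess_union:
  "(\<Union>g\<in>{..2::nat}. if g = 0 then {H []} else {H ((g = 2) # v) | v. length v + 1 \<le> a}) = {H v | v. length v \<le> a}"
proof (intro equalityI subsetI)
  fix s assume "s \<in> (\<Union>g\<in>{..2::nat}. if g = 0 then {H []} else {H ((g = 2) # v) | v. length v + 1 \<le> a})"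
  then obtain g :: nat where "g \<in> {..2}" and g: "s \<in> (if g = 0 then {H []} else {H ((g = 2) # v) | v. length v + 1 \<le> a})"
    by (rule UN_E)
  show "s \<in> {H v | v. length v \<le> a}"
  proof (cases "g = 0")
    case True
    then show ?thesis using g by (intro CollectI exI[of _ "[]"]) simp
  next
    case False
    then obtain v where "s = H ((g = 2) # v)" "length v + 1 \<le> a" using g by auto
    then show ?thesis by (intro CollectI exI[of _ "(g = 2) # v"]) simp
  qed
next
  fix s assume "s \<in> {H v | v. length v \<le> a}"
  then obtain v where v: "s = H v" "length v \<le> a" by auto
  show "s \<in> (\<Union>g\<in>{..2::nat}. if g = 0 then {H []} else {H ((g = 2) # v) | v. length v + 1 \<le> a})"
  proof (cases v)
    case Nil
    then show ?thesis using v by (intro UN_I[of 0]) auto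
  next
    case (Cons b v')
    then show ?thesis using v by (intro UN_I[of "enc_bit b"]) (auto simp: enc_bit_def)
  qed
qed

text \<open>A run that wants another bit although the counter is empty fails, so exactly the words
  within the bound survive.\<close>

lemma runs_to_guess_loop:
  fixes q1 q2 inp f
  defines "G \<equiv> \<lambda>a g l. gstore q1 q2 inp 0 a f g l"
  shows "g \<le> 2 \<Longrightarrow> runs_to guess_loop (G a g l) (5 * a + 3)
    (if g = 0 then {G a 0 l} else {G (a - 1 - length v) 0 (l @ enc ((g = 2) # v)) | v. length v + 1 \<le> a})"
proof (induction a arbitrary: g l)
  case 0
  show ?case
  proof (cases "g = 0")
    case True
    have "runs_to guess_loop (G 0 0 l) 1 {G 0 0 l}"
      unfolding guess_loop_def by (rule runs_to_While_done) (simp add: G_def view_def)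
    then show ?thesis using True by (auto intro: runs_to_mono)
  next
    case False
    have "runs_to (Cond (at_zero (Rg 1)) Fail (Seq (emit (\<lambda>v. v (Rg 5)) (move1 (Rg 1) (-1))) (guess (Rg 5)))) (G 0 g l) (1 + 1) {}"
      by (rule runs_to_Cond) (use runs_to_Fail at_zero_ctr[of "G 0 g l" "Rg 1" 0] in \<open>simp add: G_def\<close>)
    then have "runs_to guess_loop (G 0 g l) (1 + 1 + 1) {}"
      unfolding guess_loop_def using False by (intro runs_to_While_step0) (simp_all add: G_def view_def)
    then show ?thesis using False by (auto intro: runs_to_mono)
  qed
next
  case (Suc a)
  show ?case
  proof (cases "g = 0")
    case True
    have "runs_to guess_loop (G (Suc a) 0 l) 1 {G (Suc a) 0 l}"
      unfolding guess_loop_def by (rule runs_to_While_done) (simp add: G_def view_def)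
    then show ?thesis using True by (auto intro: runs_to_mono)
  next
    case False
    let ?l = "l @ enc [g = 2]"
    have g: "enc [g = 2] = [g]" using False Suc.prems by (auto simp: enc_bit_def)
    have e: "runs_to (emit (\<lambda>v. v (Rg 5)) (move1 (Rg 1) (-1))) (G (Suc a) g l) 1 {G a g ?l}"
      unfolding G_def g using runs_to_emit[of "move1 (Rg 1) (-1)" "\<lambda>v. v (Rg 5)" q1 q2 inp 0 "Suc a" f g l]
      by (simp add: move1_def view_def)
    have gs: "runs_to (guess (Rg 5)) (G a g ?l) 1 {G a g' ?l | g'. g' \<le> 2}"
    proof -
      have "(G a g ?l)(Rg 5 := reg g') = G a g' ?l" for g'
        unfolding G_def by (rule store_eqI; simp; simp add: gstore_def)
      then show ?thesis using runs_to_guess[of "G a g ?l" "Rg 5" g] by (simp add: G_def)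
    qed
    have "runs_to (Cond (at_zero (Rg 1)) Fail (Seq (emit (\<lambda>v. v (Rg 5)) (move1 (Rg 1) (-1))) (guess (Rg 5)))) (G (Suc a) g l) (1 + 1 + 1 + 1) {G a g' ?l | g'. g' \<le> 2}"
      by (rule runs_to_Cond) (use runs_to_Seq1[OF e gs] at_zero_ctr[of "G (Suc a) g l" "Rg 1" "Suc a"] in \<open>simp add: G_def\<close>)
    note body = this
    define H where "H = (\<lambda>v. G (a - length v) 0 (?l @ enc v))"
    define L where "L = (\<lambda>g. if g = 0 then {H []} else {H ((g = (2::nat)) # v) | v. length v + 1 \<le> a})"
    have R: "runs_to guess_loop (G (Suc a) g l) (1 + 1 + 1 + 1 + (5 * a + 3) + 1)
      (\<Union>s'\<in>{G a g' ?l | g'. g' \<le> 2}. L (scan (s' (Rg 5))))"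
      unfolding guess_loop_def
    proof (rule runs_to_While_step[OF _ body])
      fix s' assume "s' \<in> {G a g' ?l | g'. g' \<le> 2}"
      then obtain g' where s': "s' = G a g' ?l" "g' \<le> 2" by blast
      have L: "L g' = (if g' = 0 then {G a 0 ?l} else {G (a - 1 - length v) 0 (?l @ enc ((g' = 2) # v)) | v. length v + 1 \<le> a})"
        by (simp add: L_def H_def)
      have sc: "scan (G a g' ?l (Rg 5)) = g'" by (simp add: G_def)
      show "runs_to (While (\<lambda>v. v (Rg 5) \<noteq> 0) (Cond (at_zero (Rg 1)) Fail
        (Seq (emit (\<lambda>v. v (Rg 5)) (move1 (Rg 1) (-1))) (guess (Rg 5))))) s' (5 * a + 3) (L (scan (s' (Rg 5))))"
        unfolding s' sc L by (rule Suc.IH[OF s'(2), unfolded guess_loop_def])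
    qed (use False in \<open>simp add: G_def view_def\<close>)
    have C: "(\<Union>s'\<in>{G a g' ?l | g'. g' \<le> 2}. F (scan (s' (Rg 5)))) = (\<Union>g'\<in>{..2}. F g')"
      for F :: "nat \<Rightarrow> store set"
    proof -
      have "{G a g' ?l | g'. g' \<le> 2} = (\<lambda>g'. G a g' ?l) ` {..2}" by auto
      then show ?thesis by (simp add: G_def)
    qed
    have D: "(\<Union>g'\<in>{..2}. L g') = {H v | v. length v \<le> a}" unfolding L_def by (rule guess_union)
    show ?thesis using R unfolding C D by (rule runs_to_eq) (use False in \<open>simp_all add: H_def\<close>)
  qed
qed

text \<open>From here on only the existence of an outcome matters, and the final stores of a
  nondeterministic simulation need not be named.\<close>

definition runs_iff :: "prog \<Rightarrow> store \<Rightarrow> nat \<Rightarrow> bool \<Rightarrow> bool" where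
  "runs_iff c s T P \<longleftrightarrow> (\<exists>X. runs_to c s T X \<and> (X \<noteq> {} \<longleftrightarrow> P))"

lemma runs_iffI: "runs_to c s T X \<Longrightarrow> (X \<noteq> {} \<longleftrightarrow> P) \<Longrightarrow> runs_iff c s T P"
  unfolding runs_iff_def by blast

lemma runs_iff_eq: "runs_iff c s T P \<Longrightarrow> T \<le> T' \<Longrightarrow> (P \<longleftrightarrow> Q) \<Longrightarrow> runs_iff c s T' Q"
  unfolding runs_iff_def using runs_to_mono by blast

text \<open>Every valid outcome set yields the same acceptance condition in each context, so merging
  several of them changes nothing. The situation arises when different guesses lead to the same
  store.\<close>

lemma runs_to_Union:
  assumes "I \<noteq> {}" "\<And>i. i \<in> I \<Longrightarrow> runs_to d s T (Y i)"
  shows "runs_to d s T (\<Union>i\<in>I. Y i)"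
proof -
  obtain i where i: "i \<in> I" using assms(1) by blast
  show ?thesis
    unfolding runs_to_def
  proof (intro allI conjI impI)
    fix E k
    have "pacc E (d # k, s) \<longleftrightarrow> (\<exists>s'\<in>Y j. pacc E (k, s'))" if "j \<in> I" for j
      using assms(2)[OF that] unfolding runs_to_def by blast
    then show "pacc E (d # k, s) \<longleftrightarrow> (\<exists>s'\<in>\<Union> (Y ` I). pacc E (k, s'))" using i by blast
    fix T' assume "\<forall>s'\<in>\<Union> (Y ` I). pbounded E (k, s') T'"
    then have "\<forall>s'\<in>Y i. pbounded E (k, s') T'" using i by blast
    then show "pbounded E (d # k, s) (T + T')" using assms(2)[OF i] unfolding runs_to_def by blast
  qed
qed

lemma runs_to_Seq_family:
  assumes "runs_to c s T {f v | v. Q v}" "\<And>v. Q v \<Longrightarrow> runs_to d (f v) T' (Y v)"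
  shows "runs_to (Seq c d) s (T + T' + 1) (\<Union>v\<in>{v. Q v}. Y v)"
proof -
  have "runs_to (Seq c d) s (T + T' + 1) (\<Union>s'\<in>{f v | v. Q v}. \<Union>v\<in>{v. Q v \<and> f v = s'}. Y v)"
    by (rule runs_to_Seq[OF assms(1) runs_to_Union]) (use assms(2) in auto)
  moreover have "(\<Union>s'\<in>{f v | v. Q v}. \<Union>v\<in>{v. Q v \<and> f v = s'}. Y v) = (\<Union>v\<in>{v. Q v}. Y v)" by auto
  ultimately show ?thesis by (simp only:)
qed

lemma runs_iff_Seq:
  assumes c: "runs_to c s T {f v | v. Q v}" and d: "\<And>v. Q v \<Longrightarrow> runs_iff d (f v) T' (P v)"
  shows "runs_iff (Seq c d) s (T + T' + 1) (\<exists>v. Q v \<and> P v)"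
proof -
  have "\<forall>v. \<exists>X. Q v \<longrightarrow> runs_to d (f v) T' X \<and> (X \<noteq> {} \<longleftrightarrow> P v)" using d unfolding runs_iff_def by blast
  then obtain Y where Y: "\<And>v. Q v \<Longrightarrow> runs_to d (f v) T' (Y v)" "\<And>v. Q v \<Longrightarrow> Y v \<noteq> {} \<longleftrightarrow> P v" by metis
  have "(\<Union>v\<in>{v. Q v}. Y v) \<noteq> {} \<longleftrightarrow> (\<exists>v. Q v \<and> Y v \<noteq> {})" by blast
  also have "\<dots> \<longleftrightarrow> (\<exists>v. Q v \<and> P v)"
    by (intro ex_cong1 conj_cong refl Y(2))
  finally show ?thesis using runs_to_Seq_family[OF c Y(1)] by (intro runs_iffI)
qed

lemma runs_iff_Seq1: "runs_to c s T {s'} \<Longrightarrow> runs_iff d s' T' P \<Longrightarrow> runs_iff (Seq c d) s (T + T' + 1) P"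
  unfolding runs_iff_def using runs_to_Seq1 by blast

lemma runs_iff_Seq0: "runs_to c s T {} \<Longrightarrow> runs_iff (Seq c d) s (T + 1) False"
  unfolding runs_iff_def using runs_to_Seq0 by blast

lemma runs_iff_Cond: "runs_iff (if g (view s) then c else d) s T P \<Longrightarrow> runs_iff (Cond g c d) s (T + 1) P"
  unfolding runs_iff_def using runs_to_Cond by blast

lemma runs_to_guess_word:
  "runs_to (Seq (guess (Rg 5)) guess_loop) (gstore q1 q2 inp 0 a f 0 l) (5 * a + 5)
    {gstore q1 q2 inp 0 (a - length v) f 0 (l @ enc v) | v. length v \<le> a}"
proof -
  let ?G = "\<lambda>a g l. gstore q1 q2 inp 0 a f g l"
  define H where "H = (\<lambda>v. ?G (a - length v) 0 (l @ enc v))"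
  define L where "L = (\<lambda>g. if g = 0 then {H []} else {H ((g = (2::nat)) # v) | v. length v + 1 \<le> a})"
  have "(?G a 0 l)(Rg 5 := reg g) = ?G a g l" for g
    by (rule store_eqI; simp; simp add: gstore_def)
  then have gs: "runs_to (guess (Rg 5)) (?G a 0 l) 1 {?G a g l | g. g \<le> 2}"
    using runs_to_guess[of "?G a 0 l" "Rg 5" 0] by simp
  have "L g = (if g = 0 then {?G a 0 l} else {?G (a - 1 - length v) 0 (l @ enc ((g = 2) # v)) | v. length v + 1 \<le> a})" for g
    by (simp add: L_def H_def)
  then have "runs_to guess_loop (?G a g l) (5 * a + 3) (L g)" if "g \<le> 2" for g
    using runs_to_guess_loop[OF that, of q1 q2 inp a f l] by (simp only:)
  from runs_to_Seq_family[OF gs this] have "runs_to (Seq (guess (Rg 5)) guess_loop) (?G a 0 l) (1 + (5 * a + 3) + 1) (\<Union>g\<in>{..2}. L g)"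
    by (simp only: atMost_def)
  then show ?thesis unfolding L_def guess_union by (rule runs_to_eq) (simp_all add: H_def)
qed

definition search :: "tm \<Rightarrow> tm \<Rightarrow> prog" where
  "search M1 M2 =
     Seq (Upd (\<lambda>v. v(Rg 0 := 1, Rg 1 := 1, Rg 2 := 1, Rg 3 := 1, Rg 6 := tm_start M1, Rg 7 := tm_start M2)) (\<lambda>_. 0))
    (Seq parser (Seq exponentiate (Seq (Seq (guess (Rg 5)) guess_loop)
    (Seq (Drain (Rg 3) (Move ((move1 (Rg 3) (-1))(MT 0 := -1, NT 0 := -1))))
      (Cond (\<lambda>v. v (Rg 4) = 1) (sim M2 NT 7) (sim M1 MT 6))))))"

text \<open>\<open>2 * n + 2 ^ n\<close> bounds the total length of the three arguments:
  \<open>w\<close> and \<open>t\<close> are no longer than the query, and \<open>v\<close> has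
  length at most \<open>2 ^ m\<close> with \<open>m\<close> at most \<open>n\<close>.\<close>

definition search_time :: "nat poly \<Rightarrow> nat poly \<Rightarrow> nat \<Rightarrow> nat" where
  "search_time r1 r2 n = 22 * n + 60 + n * (8 * 2 ^ n + 6) + 10 * 2 ^ n + 3 * poly r1 (2 * n + 2 ^ n) + 3 * poly r2 (2 * n + 2 ^ n)"

context
  fixes M1 M2 :: tm and r1 r2 :: "nat poly"
  assumes wf: "wf_tm M1" "wf_tm M2"
    and time: "\<And>w t v. time_bounded M1 {} (enc3 w t v) (poly r1 (length w + length t + length v))"
      "\<And>w t v. time_bounded M2 {} (enc3 w t v) (poly r2 (length w + length t + length v))"
begin

lemma runs_iff_sim:
  assumes "wf_tm M" "is_block b" "time_bounded M {} inp T"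
  shows "runs_iff (sim M b r) (put b r (minit M inp) s) (3 * T + 3) (accepts M {} inp)"
  using runs_to_sim[OF assms(1,2) assms(3)[unfolded time_bounded_iff_mstep[OF assms(1)]]]
  by (rule runs_iffI) (auto simp: accepts_iff_mstep[OF assms(1)] reaches_rtranclp)

lemma runs_iff_final:
  "runs_iff (Seq (Drain (Rg 3) (Move ((move1 (Rg 3) (-1))(MT 0 := -1, NT 0 := -1))))
      (Cond (\<lambda>v. v (Rg 4) = 1) (sim M2 NT 7) (sim M1 MT 6)))
    (gstore (tm_start M1) (tm_start M2) inp 0 a f 0 (enc3 w t v))
    (2 * (length w + length t + length v) + 10 + 3 * poly r1 (length w + length t + length v) + 3 * poly r2 (length w + length t + length v))
    (accepts (if f = 1 then M2 else M1) {} (enc3 w t v))"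
proof -
  let ?l = "enc3 w t v"
  let ?n = "length w + length t + length v"
  let ?s = "gstore (tm_start M1) (tm_start M2) inp 0 a f 0 []"
  \<comment> \<open>Rewinding leaves both machines in their initial configurations, because
    \<open>emit\<close> has filled both input tapes; the flag then selects one of them.\<close>
  let ?W = "put MT 6 (minit M1 ?l) (put NT 7 (minit M2 ?l) ?s)"
  have len: "length ?l = ?n + 2" by (simp add: enc3_def)
  have W: "?W = put NT 7 (minit M2 ?l) (put MT 6 (minit M1 ?l) ?s)"
    by (rule store_eqI; simp add: put_Rg)
  have "runs_to (Drain (Rg 3) (Move ((move1 (Rg 3) (-1))(MT 0 := -1, NT 0 := -1))))
    (gstore (tm_start M1) (tm_start M2) inp 0 a f 0 ?l) (2 * length ?l + 1) {?W}"
  proof (rule runs_to_eq[OF runs_to_Drain_Move[where n = "length ?l"]])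
    let ?m = "(move1 (Rg 3) (-1))(MT 0 := -1, NT 0 := -1)"
    have "(\<lambda>y. shift (?m y) (length ?l) (gstore (tm_start M1) (tm_start M2) inp 0 a f 0 ?l y)) = ?W"
    proof (rule store_eqI)
      fix i
      show "shift (?m (Rg i)) (length ?l) (gstore (tm_start M1) (tm_start M2) inp 0 a f 0 ?l (Rg i)) = ?W (Rg i)"
        by (cases "i = 3"; simp add: put_Rg move1_def; simp add: gstore_def minit_def)
      show "shift (?m (MT i)) (length ?l) (gstore (tm_start M1) (tm_start M2) inp 0 a f 0 ?l (MT i)) = ?W (MT i)"
        by (cases "i = 0"; simp add: move1_def minit_def; simp add: gstore_def)
      show "shift (?m (NT i)) (length ?l) (gstore (tm_start M1) (tm_start M2) inp 0 a f 0 ?l (NT i)) = ?W (NT i)"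
        by (cases "i = 0"; simp add: move1_def minit_def; simp add: gstore_def)
    qed (simp_all add: move1_def)
    then show "{\<lambda>y. shift (?m y) (length ?l) (gstore (tm_start M1) (tm_start M2) inp 0 a f 0 ?l y)} = {?W}" by simp
  qed (auto simp: move1_def)
  note 1 = this
  have v4: "view ?W (Rg 4) = f" by (simp add: view_def put_Rg)
  have "runs_iff (if view ?W (Rg 4) = 1 then sim M2 NT 7 else sim M1 MT 6) ?W (3 * poly r1 ?n + 3 * poly r2 ?n + 3)
    (accepts (if f = 1 then M2 else M1) {} ?l)"
  proof (cases "f = 1")
    case True
    have "runs_iff (sim M2 NT 7) ?W (3 * poly r2 ?n + 3) (accepts M2 {} ?l)"
      unfolding W by (rule runs_iff_sim[OF wf(2) _ time(2)]) simp
    then show ?thesis unfolding v4 using True by (auto intro: runs_iff_eq)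
  next
    case False
    have "runs_iff (sim M1 MT 6) ?W (3 * poly r1 ?n + 3) (accepts M1 {} ?l)"
      by (rule runs_iff_sim[OF wf(1) _ time(1)]) simp
    then show ?thesis unfolding v4 using False by (auto intro: runs_iff_eq)
  qed
  from runs_iff_eq[OF runs_iff_Seq1[OF 1 runs_iff_Cond[where g = "\<lambda>v. v (Rg 4) = 1", OF this]]]
  show ?thesis by (simp add: len)
qed

lemma runs_iff_search:
  "runs_iff (search M1 M2) (init_store (enc y)) (search_time r1 r2 (length y))
    (case parse y of None \<Rightarrow> False | Some (m, w, t, r) \<Rightarrow>
      \<exists>v. length v \<le> 2 ^ m \<and> accepts (if flag r = 1 then M2 else M1) {} (enc3 w t v))"
proof -
  let ?n = "length y"
  let ?g = "gstore (tm_start M1) (tm_start M2)"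
  let ?s = "?g (rtape (enc y) (enc y)) 0 0 0 0 []"
  have 1: "runs_to (Upd (\<lambda>v. v(Rg 0 := 1, Rg 1 := 1, Rg 2 := 1, Rg 3 := 1, Rg 6 := tm_start M1, Rg 7 := tm_start M2)) (\<lambda>_. 0))
      (init_store (enc y)) 1 {?s}"
  proof (rule runs_to_Upd, rule store_eqI)
    fix i
    show "?s (Rg i) = eff (init_store (enc y)) ((view (init_store (enc y)))(Rg 0 := 1, Rg 1 := 1, Rg 2 := 1, Rg 3 := 1, Rg 6 := tm_start M1, Rg 7 := tm_start M2)) (\<lambda>_. 0) (Rg i)"
      using upd_reg_ctr by (simp add: gstore_def eff_def view_def init_store_def)
    show "?s (MT i) = eff (init_store (enc y)) ((view (init_store (enc y)))(Rg 0 := 1, Rg 1 := 1, Rg 2 := 1, Rg 3 := 1, Rg 6 := tm_start M1, Rg 7 := tm_start M2)) (\<lambda>_. 0) (MT i)"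
      by (auto simp: gstore_def eff_def view_def init_store_def reg_0 cells_def upd_def scan_def)
    show "?s (NT i) = eff (init_store (enc y)) ((view (init_store (enc y)))(Rg 0 := 1, Rg 1 := 1, Rg 2 := 1, Rg 3 := 1, Rg 6 := tm_start M1, Rg 7 := tm_start M2)) (\<lambda>_. 0) (NT i)"
      by (auto simp: gstore_def eff_def view_def init_store_def reg_0 cells_def upd_def scan_def)
  qed (simp_all add: eff_def view_def init_store_def rtape_def)
  note p = runs_to_parser[of "tm_start M1" "tm_start M2" y]
  let ?rest = "Seq exponentiate (Seq (Seq (guess (Rg 5)) guess_loop)
    (Seq (Drain (Rg 3) (Move ((move1 (Rg 3) (-1))(MT 0 := -1, NT 0 := -1))))
      (Cond (\<lambda>v. v (Rg 4) = 1) (sim M2 NT 7) (sim M1 MT 6))))"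
  show ?thesis
  proof (cases "parse y")
    case None
    then have "runs_iff (search M1 M2) (init_store (enc y)) (1 + (12 * ?n + 22 + 1) + 1) False"
      unfolding search_def using p by (intro runs_iff_Seq1[OF 1] runs_iff_Seq0) simp
    then show ?thesis by (rule runs_iff_eq) (simp_all add: None search_time_def)
  next
    case (Some a)
    obtain m w t r where a: "parse y = Some (m, w, t, r)" using Some by (metis prod_cases4)
    note pl = parse_length[OF a]
    let ?inp = "rtape (enc y) (enc r)"
    let ?l = "enc w @ [3] @ enc t @ [3]"
    have p': "runs_to parser ?s (12 * ?n + 22) {?g ?inp m 0 (flag r) 0 ?l}" using p a by simp
    let ?N = "2 * ?n + 2 ^ ?n"
    let ?T = "2 * ?N + 10 + 3 * poly r1 ?N + 3 * poly r2 ?N"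
    have sum_mono3: "a \<le> a' \<Longrightarrow> b \<le> b' \<Longrightarrow> c \<le> c' \<Longrightarrow> 2 * a + 10 + 3 * b + 3 * c \<le> 2 * a' + 10 + 3 * b' + 3 * (c' :: nat)"
      for a a' b b' c c' by simp
    have pw: "(2::nat) ^ m \<le> 2 ^ ?n" using pl(1) by (intro power_increasing) auto
    have "runs_iff (Seq (Seq (guess (Rg 5)) guess_loop)
      (Seq (Drain (Rg 3) (Move ((move1 (Rg 3) (-1))(MT 0 := -1, NT 0 := -1))))
      (Cond (\<lambda>v. v (Rg 4) = 1) (sim M2 NT 7) (sim M1 MT 6)))) (?g ?inp 0 (2 ^ m) (flag r) 0 ?l) (5 * 2 ^ m + 5 + ?T + 1)
      (\<exists>v. length v \<le> 2 ^ m \<and> accepts (if flag r = 1 then M2 else M1) {} (enc3 w t v))"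
    proof (rule runs_iff_Seq[OF runs_to_guess_word])
      fix v :: "bool list" assume "length v \<le> 2 ^ m"
      then have le: "length w + length t + length v \<le> ?N" using pl pw by linarith
      have e: "?l @ enc v = enc3 w t v" by (simp add: enc3_def)
      have "2 * (length w + length t + length v) + 10 + 3 * poly r1 (length w + length t + length v) + 3 * poly r2 (length w + length t + length v) \<le> ?T"
        by (rule sum_mono3[OF le poly_nat_mono[OF le] poly_nat_mono[OF le]])
      then show "runs_iff (Seq (Drain (Rg 3) (Move ((move1 (Rg 3) (-1))(MT 0 := -1, NT 0 := -1))))
        (Cond (\<lambda>v. v (Rg 4) = 1) (sim M2 NT 7) (sim M1 MT 6))) (?g ?inp 0 (2 ^ m - length v) (flag r) 0 (?l @ enc v)) ?T
        (accepts (if flag r = 1 then M2 else M1) {} (enc3 w t v))"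
        unfolding e by (rule runs_iff_eq[OF runs_iff_final _ refl])
    qed
    note g = this
    have "runs_iff (search M1 M2) (init_store (enc y))
      (1 + (12 * ?n + 22 + (m * (8 * 2 ^ m + 6) + 3 + (5 * 2 ^ m + 5 + ?T + 1) + 1) + 1) + 1)
      (\<exists>v. length v \<le> 2 ^ m \<and> accepts (if flag r = 1 then M2 else M1) {} (enc3 w t v))"
      unfolding search_def by (intro runs_iff_Seq1[OF 1] runs_iff_Seq1[OF p'] runs_iff_Seq1[OF runs_to_exponentiate] g)
    moreover have A: "m * (8 * 2 ^ m + 6) \<le> ?n * (8 * 2 ^ ?n + 6)"
      using pl(1) pw by (intro mult_le_mono add_mono) auto
    have aux: "a \<le> a' \<Longrightarrow> b \<le> b' \<Longrightarrow> 1 + (12 * k + 22 + (a + 3 + (5 * b + 5 + (2 * (2 * k + b') + 10 + c + d) + 1) + 1) + 1) + 1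
        \<le> 22 * k + 60 + a' + 10 * b' + c + d" for a a' b b' c d k :: nat
      by simp
    have "1 + (12 * ?n + 22 + (m * (8 * 2 ^ m + 6) + 3 + (5 * 2 ^ m + 5 + ?T + 1) + 1) + 1) + 1 \<le> search_time r1 r2 ?n"
      unfolding search_time_def by (rule aux[OF A pw])
    ultimately show ?thesis by (rule runs_iff_eq) (simp add: a)
  qed
qed

end

section \<open>Exponentially bounded functions\<close>

definition exp_bounded :: "(nat \<Rightarrow> nat) \<Rightarrow> bool" where
  "exp_bounded f \<longleftrightarrow> (\<exists>q :: nat poly. \<forall>n. f n \<le> 2 ^ poly q n)"

lemma exp_bounded_poly_bounded: "poly_bounded f \<Longrightarrow> exp_bounded f"
  unfolding exp_bounded_def poly_bounded_def by (meson less_exp less_imp_le order.trans)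

lemma exp_bounded_mult: "exp_bounded f \<Longrightarrow> exp_bounded g \<Longrightarrow> exp_bounded (\<lambda>n. f n * g n)"
  unfolding exp_bounded_def by (metis mult_le_mono poly_add power_add)

lemma exp_bounded_add:
  assumes "exp_bounded f" "exp_bounded g"
  shows "exp_bounded (\<lambda>n. f n + g n)"
proof -
  obtain p q :: "nat poly" where pq: "\<And>n. f n \<le> 2 ^ poly p n" "\<And>n. g n \<le> 2 ^ poly q n"
    using assms unfolding exp_bounded_def by blast
  have "f n + g n \<le> 2 ^ poly (p + q + 1) n" for n
  proof -
    have "f n + g n \<le> 2 ^ (poly p n + poly q n) + 2 ^ (poly p n + poly q n)"
      by (intro add_mono order.trans[OF pq(1)] order.trans[OF pq(2)] power_increasing) auto
    then show ?thesis by simp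
  qed
  then show ?thesis unfolding exp_bounded_def by blast
qed

lemma exp_bounded_power: "exp_bounded (\<lambda>n. 2 ^ n)"
  unfolding exp_bounded_def by (rule exI[of _ "[:0, 1:]"]) simp

text \<open>Horner's form of the polynomial reduces this to sums, products and constants.\<close>

lemma exp_bounded_poly: "exp_bounded f \<Longrightarrow> exp_bounded (\<lambda>n. poly (r :: nat poly) (f n))"
proof (induction r)
  case (pCons a r)
  then show ?case
    unfolding poly_pCons
    by (intro exp_bounded_add exp_bounded_mult exp_bounded_poly_bounded[OF poly_bounded_const])
qed (simp add: exp_bounded_poly_bounded)

lemma prog_ok_search:
  assumes wf: "wf_tm M1" "wf_tm M2"
    and n: "n = tm_states M1 + tm_syms M1 + tm_tapes M1 + tm_states M2 + tm_syms M2 + tm_tapes M2 + 8"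
  shows "prog_ok n (search M1 M2)"
proof -
  have q: "tm_start M1 < n" "tm_start M2 < n" "8 \<le> n" "0 < n"
    using wf unfolding n wf_tm_def by auto
  have v: "v x < n" if "view_ok n v" for v x using that by (simp add: view_ok_def)
  have em: "prog_ok n (emit h m)" if "\<And>v. view_ok n v \<Longrightarrow> h v < n" "moves_ok n m" for h m
    using that q by (auto simp: emit_def intro!: prog_ok_Upd)
  have s: "prog_ok n (sim M1 MT 6)" "prog_ok n (sim M2 NT 7)"
    using wf by (auto simp: n intro!: prog_ok_sim)
  have g: "prog_ok n (guess (Rg 5))" using q by (auto simp: guess_def act_ok_def)
  show ?thesis
    using q v em s g
    by (auto simp: search_def parser_def parse_unary_def skip_false_def parse_pairs_def parse_separator_def read_flag_def
        exponentiate_def double_ctr_def guess_loop_def move1_def intro!: prog_ok_Upd)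
qed

lemma search_in_NEXP:
  assumes wf: "wf_tm M1" "wf_tm M2"
    and time: "\<And>w t v. time_bounded M1 {} (enc3 w t v) (poly r1 (length w + length t + length v))"
      "\<And>w t v. time_bounded M2 {} (enc3 w t v) (poly r2 (length w + length t + length v))"
  obtains A where "in_NEXP A"
    "\<And>m w t r. pack m w t r \<in> A \<longleftrightarrow> (\<exists>v. length v \<le> 2 ^ m \<and> accepts (if flag r = 1 then M2 else M1) {} (enc3 w t v))"
proof -
  define n where "n = tm_states M1 + tm_syms M1 + tm_tapes M1 + tm_states M2 + tm_syms M2 + tm_tapes M2 + 8"
  have "n \<ge> 4" by (simp add: n_def)
  then obtain V where V: "wf_tm V"
    "\<And>Ob inp. set inp \<subseteq> {..<4} \<Longrightarrow> accepts V Ob inp \<longleftrightarrow> pacc (Ob, [], []) ([search M1 M2], init_store inp)"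
    "\<And>Ob inp T. set inp \<subseteq> {..<4} \<Longrightarrow> time_bounded V Ob inp T \<longleftrightarrow> pbounded (Ob, [], []) ([search M1 M2], init_store inp) T"
    using compile[OF _ prog_ok_search[OF wf n_def]] by metis
  have "exp_bounded (search_time r1 r2)"
    unfolding search_time_def
    by (intro exp_bounded_add exp_bounded_mult exp_bounded_poly exp_bounded_power exp_bounded_poly_bounded[OF poly_bounded_const] exp_bounded_poly_bounded[OF poly_bounded_id])
  then obtain q where q: "\<And>n. search_time r1 r2 n \<le> 2 ^ poly q n" unfolding exp_bounded_def by blast
  have ri: "time_bounded V {} (enc y) (2 ^ poly q (length y)) \<and> (accepts V {} (enc y) \<longleftrightarrow>
      (case parse y of None \<Rightarrow> False | Some (m, w, t, r) \<Rightarrow>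
        \<exists>v. length v \<le> 2 ^ m \<and> accepts (if flag r = 1 then M2 else M1) {} (enc3 w t v)))" (is "_ \<and> (_ \<longleftrightarrow> ?P)") for y
  proof -
    obtain X where X: "runs_to (search M1 M2) (init_store (enc y)) (search_time r1 r2 (length y)) X" "X \<noteq> {} \<longleftrightarrow> ?P"
      using runs_iff_search[OF wf time, of y] unfolding runs_iff_def by blast
    have "time_bounded V {} (enc y) (2 ^ poly q (length y))"
      unfolding V(3)[OF set_enc] by (rule bounded_runs_mono[OF pacc_final(2)[OF X(1)] q])
    then show ?thesis
      unfolding V(2)[OF set_enc] pacc_final(1)[OF X(1)] using X(2) by blast
  qed
  show ?thesis
  \<comment> \<open>The oracle is by definition whatever the compiled search accepts. It is
    described only on packed words, and the oracle machine asks no others.\<close>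
  proof (rule that[of "{y. accepts V {} (enc y)}"])
    show "in_NEXP {y. accepts V {} (enc y)}"
      unfolding in_NEXP_def using V(1) ri by blast
    show "pack m w t r \<in> {y. accepts V {} (enc y)} \<longleftrightarrow> (\<exists>v. length v \<le> 2 ^ m \<and> accepts (if flag r = 1 then M2 else M1) {} (enc3 w t v))"
      for m w t r
      using ri[of "pack m w t r"] by (simp add: parse_pack)
  qed
qed

subsection \<open>An oracle machine guessing the outer witness\<close>

definition nstore :: "tape \<Rightarrow> nat \<Rightarrow> nat \<Rightarrow> nat \<Rightarrow> nat \<Rightarrow> nat \<Rightarrow> bool list \<Rightarrow> store" where
  "nstore inp n a c g f ys = (\<lambda>z. case z of Inp \<Rightarrow> inp | Qry \<Rightarrow> (cells (enc ys), length ys) | MT i \<Rightarrow> reg 0 | NT i \<Rightarrow> reg 0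
     | Rg i \<Rightarrow> if i = 0 then ctr n else if i = 1 then ctr a else if i < 4 then ctr 0 else if i = 4 then ctr c
         else if i = 5 then reg g else if i = 6 then reg f else reg 0)"

lemma nstore_simps [simp]:
  "nstore inp n a c g f ys Inp = inp" "nstore inp n a c g f ys Qry = (cells (enc ys), length ys)"
  "nstore inp n a c g f ys (Rg 0) = ctr n" "nstore inp n a c g f ys (Rg (Suc 0)) = ctr a" "nstore inp n a c g f ys (Rg 2) = ctr 0"
  "nstore inp n a c g f ys (Rg 3) = ctr 0" "nstore inp n a c g f ys (Rg 4) = ctr c" "nstore inp n a c g f ys (Rg 5) = reg g"
  "nstore inp n a c g f ys (Rg 6) = reg f"
  by (simp_all add: nstore_def)

lemma nstore_upd:
  "(nstore inp n a c g f ys)(Inp := inp') = nstore inp' n a c g f ys"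
  "(nstore inp n a c g f ys)(Rg 0 := ctr n') = nstore inp n' a c g f ys"
  "(nstore inp n a c g f ys)(Rg (Suc 0) := ctr a') = nstore inp n a' c g f ys"
  "(nstore inp n a c g f ys)(Rg 4 := ctr c') = nstore inp n a c' g f ys"
  "(nstore inp n a c g f ys)(Rg 5 := reg g') = nstore inp n a c g' f ys"
  "(nstore inp n a c g f ys)(Rg 6 := reg f') = nstore inp n a c g f' ys"
  "(nstore inp n a c g f ys)(Qry := (cells (enc ys'), length ys')) = nstore inp n a c g f ys'"
  by (rule store_eqI; simp; simp add: nstore_def)+

definition put_bit :: "(view \<Rightarrow> nat) \<Rightarrow> moves \<Rightarrow> prog" where
  "put_bit h m = Upd (\<lambda>v. v(Qry := h v)) (m(Qry := 1))"

lemma runs_to_put_bit: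
  assumes "s Qry = (cells (enc ys), length ys)" "h (view s) = enc_bit b"
  shows "runs_to (put_bit h m) s 1 {(bump m s)(Qry := (cells (enc (ys @ [b])), length (ys @ [b])))}"
  unfolding put_bit_def
proof (rule runs_to_Upd, rule ext)
  fix z
  have "upd (cells (enc ys), length ys) (enc_bit b) 1 = (cells (enc (ys @ [b])), length (ys @ [b]))"
    using upd_rtape_end[of "enc ys" "enc_bit b"] by simp
  then show "((bump m s)(Qry := (cells (enc (ys @ [b])), length (ys @ [b])))) z =
      eff s ((view s)(Qry := h (view s))) (m(Qry := 1)) z"
    using assms by (simp add: eff_def bump_apply view_def upd_scan_turn)
qed

section \<open>Evaluating the polynomial at the input length\<close>

definition add_input_length :: prog where
  "add_input_length = Seq (Drain (Rg 0) (Move ((move1 (Rg 0) (-1))(Rg 2 := 1, Rg 3 := 1))))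
     (Drain (Rg 3) (Move ((move1 (Rg 3) (-1))(Rg 0 := 1))))"

lemma runs_to_add_input_length:
  assumes s: "s (Rg 0) = ctr n" "s (Rg 2) = ctr k" "s (Rg 3) = ctr 0"
  shows "runs_to add_input_length s (4 * n + 3) {s(Rg 2 := ctr (k + n))}"
proof -
  let ?s = "s(Rg 0 := ctr 0, Rg 2 := ctr (k + n), Rg 3 := ctr n)"
  have 1: "runs_to (Drain (Rg 0) (Move ((move1 (Rg 0) (-1))(Rg 2 := 1, Rg 3 := 1)))) s (2 * n + 1) {?s}"
  proof (rule runs_to_eq[OF runs_to_Drain_Move[where n = n]])
    show "{\<lambda>y. shift (((move1 (Rg 0) (-1))(Rg 2 := 1, Rg 3 := 1)) y) n (s y)} = {?s}"
      using s by (auto simp: fun_eq_iff move1_def)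
  qed (use s in \<open>auto simp: move1_def\<close>)
  have 2: "runs_to (Drain (Rg 3) (Move ((move1 (Rg 3) (-1))(Rg 0 := 1)))) ?s (2 * n + 1) {s(Rg 2 := ctr (k + n))}"
  proof (rule runs_to_eq[OF runs_to_Drain_Move[where n = n]])
    show "{\<lambda>y. shift (((move1 (Rg 3) (-1))(Rg 0 := 1)) y) n (?s y)} = {s(Rg 2 := ctr (k + n))}"
      using s by (auto simp: fun_eq_iff move1_def)
  qed (auto simp: move1_def)
  show ?thesis unfolding add_input_length_def by (rule runs_to_mono[OF runs_to_Seq1[OF 1 2]]) simp
qed

definition times_input_length :: prog where
  "times_input_length = Seq (Drain (Rg 1) (Seq (Move (move1 (Rg 1) (-1))) add_input_length))
     (Drain (Rg 2) (Move ((move1 (Rg 2) (-1))(Rg 1 := 1))))"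

lemma runs_to_times_input_length:
  assumes s: "s (Rg 0) = ctr n" "s (Rg 1) = ctr a" "s (Rg 2) = ctr 0" "s (Rg 3) = ctr 0"
  shows "runs_to times_input_length s (a * (6 * n + 6) + 3) {s(Rg 1 := ctr (a * n))}"
proof -
  let ?\<sigma> = "\<lambda>j. s(Rg 1 := ctr (a - j), Rg 2 := ctr (j * n))"
  let ?c = "Seq (Move (move1 (Rg 1) (-1))) add_input_length"
  have "runs_to (Drain (Rg 1) ?c) (?\<sigma> 0) (a * (1 + (4 * n + 3) + 1 + 1) + 1) {?\<sigma> a}"
  proof (rule runs_to_iterate)
    fix j assume j: "j < a"
    let ?s = "s(Rg 1 := ctr (a - Suc j), Rg 2 := ctr (j * n))"
    have "nat (int (a - j) - 1) = a - Suc j" by simp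
    then have 1: "runs_to (Move (move1 (Rg 1) (-1))) (?\<sigma> j) 1 {?s}"
      using runs_to_Move[of "move1 (Rg 1) (-1)" "?\<sigma> j"] by (simp add: bump_move1 fun_upd_twist)
    have "runs_to add_input_length ?s (4 * n + 3) {?s(Rg 2 := ctr (j * n + n))}"
      by (rule runs_to_add_input_length) (use s in simp_all)
    then have 2: "runs_to add_input_length ?s (4 * n + 3) {?\<sigma> (Suc j)}" by (simp add: add.commute)
    show "runs_to ?c (?\<sigma> j) (1 + (4 * n + 3) + 1) {?\<sigma> (Suc j)}" by (rule runs_to_Seq1[OF 1 2])
  next
    fix j assume "j \<le> a"
    then show "(\<not> at_zero (Rg 1) (view (?\<sigma> j))) \<longleftrightarrow> j < a" by (auto simp: at_zero_ctr[of _ _ "a - j"])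
  qed
  moreover have "?\<sigma> 0 = s" using s by (auto simp: fun_eq_iff)
  ultimately have 1: "runs_to (Drain (Rg 1) ?c) s (a * (1 + (4 * n + 3) + 1 + 1) + 1) {?\<sigma> a}" by (simp only:)
  have 2: "runs_to (Drain (Rg 2) (Move ((move1 (Rg 2) (-1))(Rg 1 := 1)))) (?\<sigma> a) (2 * (a * n) + 1) {s(Rg 1 := ctr (a * n))}"
  proof (rule runs_to_eq[OF runs_to_Drain_Move[where n = "a * n"]])
    show "{\<lambda>y. shift (((move1 (Rg 2) (- 1))(Rg 1 := 1)) y) (a * n) (?\<sigma> a y)} = {s(Rg 1 := ctr (a * n))}"
      using s by (auto simp: fun_eq_iff move1_def)
  qed (auto simp: move1_def)
  show ?thesis
    unfolding times_input_length_def by (rule runs_to_mono[OF runs_to_Seq1[OF 1 2]]) (simp add: algebra_simps)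
qed

fun add_const :: "nat \<Rightarrow> prog" where
  "add_const 0 = Skip"
| "add_const (Suc c) = Seq (Move (move1 (Rg 1) 1)) (add_const c)"

lemma runs_to_add_const: "s (Rg 1) = ctr a \<Longrightarrow> runs_to (add_const c) s (2 * c + 1) {s(Rg 1 := ctr (a + c))}"
proof (induction c arbitrary: s a)
  case 0
  then show ?case using runs_to_Skip[of s] by (simp add: fun_upd_idem)
next
  case (Suc c)
  have 1: "runs_to (Move (move1 (Rg 1) 1)) s 1 {s(Rg 1 := ctr (Suc a))}"
    using runs_to_Move[of "move1 (Rg 1) 1" s] Suc.prems by (simp add: bump_move1 nat_add_distrib)
  show ?case
    unfolding add_const.simps by (rule runs_to_eq[OF runs_to_Seq1[OF 1 Suc.IH[of _ "Suc a"]]]) (simp_all add: fun_eq_iff)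
qed

text \<open>Coefficients come lowest degree first, as in \<open>Poly\<close>. They are built into
  the program, so at run time only the input length in \<open>Rg 0\<close> has to be
  available.\<close>

fun horner :: "nat list \<Rightarrow> prog" where
  "horner [] = Skip"
| "horner (c # cs) = Seq (horner cs) (Seq times_input_length (add_const c))"

fun horner_time :: "nat list \<Rightarrow> nat \<Rightarrow> nat" where
  "horner_time [] n = 1"
| "horner_time (c # cs) n = horner_time cs n + (poly (Poly cs) n * (6 * n + 6) + 3) + (2 * c + 1) + 2"

lemma runs_to_horner:
  assumes s: "s (Rg 0) = ctr n" "s (Rg 1) = ctr 0" "s (Rg 2) = ctr 0" "s (Rg 3) = ctr 0"
  shows "runs_to (horner cs) s (horner_time cs n) {s(Rg 1 := ctr (poly (Poly cs) n))}"
proof (induction cs)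
  case Nil
  then show ?case using runs_to_Skip[of s] s by (simp add: fun_upd_idem)
next
  case (Cons c cs)
  let ?a = "poly (Poly cs) n"
  let ?s = "s(Rg 1 := ctr ?a)"
  have 2: "runs_to times_input_length ?s (?a * (6 * n + 6) + 3) {?s(Rg 1 := ctr (?a * n))}"
    by (rule runs_to_times_input_length) (use s in simp_all)
  have 3: "runs_to (add_const c) (?s(Rg 1 := ctr (?a * n))) (2 * c + 1) {?s(Rg 1 := ctr (?a * n), Rg 1 := ctr (?a * n + c))}"
    by (rule runs_to_add_const) simp
  show ?case
    unfolding horner.simps
    by (rule runs_to_eq[OF runs_to_Seq1[OF Cons.IH runs_to_Seq1[OF 2 3]]]) (simp_all add: algebra_simps fun_eq_iff)
qed

lemma poly_bounded_horner_time: "poly_bounded (horner_time cs)"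
proof (induction cs)
  case (Cons c cs)
  have "poly_bounded (\<lambda>n. poly (Poly cs) n)" unfolding poly_bounded_def by blast
  then show ?case unfolding horner_time.simps by (intro poly_bounded_intros Cons.IH)
qed simp

text \<open>On the input tape a blank does mark the end, since bits are encoded by nonzero symbols.
  The head goes home because the input is read once more when it is copied into the query.\<close>

definition measure_input :: prog where
  "measure_input = Seq (While (\<lambda>v. v Inp \<noteq> 0) (Move ((move1 Inp 1)(Rg 0 := 1))))
     (Seq (Drain (Rg 0) (Move ((move1 (Rg 0) (-1))(Rg 3 := 1, Inp := -1))))
          (Drain (Rg 3) (Move ((move1 (Rg 3) (-1))(Rg 0 := 1)))))"

lemma suffix_drop_enc: "suffix (drop j (enc w)) (enc w)"
  by (rule suffix_drop)

lemma drop_enc: "j < length w \<Longrightarrow> drop j (enc w) = enc_bit (w ! j) # drop (Suc j) (enc w)"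
  by (simp add: Cons_nth_drop_Suc[symmetric] enc_def)

lemma view_input:
  assumes "s Inp = rtape (enc w) (drop j (enc w))" "j \<le> length w"
  shows "view s Inp = (if j < length w then enc_bit (w ! j) else 0)"
  using scan_rtape[OF suffix_drop_enc[of j w]] assms drop_enc[of j w]
  by (cases "j < length w") (simp_all add: view_def)

lemma turn_input: "j < length w \<Longrightarrow> turn (rtape (enc w) (drop j (enc w))) 1 = rtape (enc w) (drop (Suc j) (enc w))"
  using turn_rtape[of "enc_bit (w ! j)" "drop (Suc j) (enc w)" "enc w"] suffix_drop_enc[of j w] by (simp add: drop_enc)

lemma runs_to_measure_input:
  fixes w :: "bool list"
  defines "l \<equiv> enc w"
  shows "runs_to measure_input (nstore (rtape l l) 0 0 0 0 0 []) (6 * length w + 5) {nstore (rtape l l) (length w) 0 0 0 0 []}"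
proof -
  let ?n = "length w"
  let ?\<sigma> = "\<lambda>j. nstore (rtape l (drop j l)) j 0 0 0 0 []"
  have 1: "runs_to (While (\<lambda>v. v Inp \<noteq> 0) (Move ((move1 Inp 1)(Rg 0 := 1)))) (?\<sigma> 0) (?n * (1 + 1) + 1) {?\<sigma> ?n}"
  proof (rule runs_to_iterate)
    fix j assume j: "j < ?n"
    show "runs_to (Move ((move1 Inp 1)(Rg 0 := 1))) (?\<sigma> j) 1 {?\<sigma> (Suc j)}"
      using runs_to_Move[of "(move1 Inp 1)(Rg 0 := 1)" "?\<sigma> j"] turn_input[OF j]
      by (simp add: bump_move2 nstore_upd l_def nat_add_distrib)
  next
    fix j assume j: "j \<le> ?n"
    show "(view (?\<sigma> j) Inp \<noteq> 0) \<longleftrightarrow> j < ?n"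
      using view_input[of "?\<sigma> j" w j] j by (simp add: l_def enc_bit_def)
  qed
  let ?s = "(nstore (rtape l l) 0 0 0 0 0 [])(Rg 3 := ctr ?n)"
  have 2: "runs_to (Drain (Rg 0) (Move ((move1 (Rg 0) (-1))(Rg 3 := 1, Inp := -1)))) (?\<sigma> ?n) (2 * ?n + 1) {?s}"
  proof (rule runs_to_eq[OF runs_to_Drain_Move[where n = ?n]])
    let ?m = "(move1 (Rg 0) (-1))(Rg 3 := 1, Inp := -1)"
    have "(\<lambda>y. shift (?m y) ?n (?\<sigma> ?n y)) = ?s"
    proof (rule store_eqI)
      show "shift (?m Inp) ?n (?\<sigma> ?n Inp) = ?s Inp" by (simp add: l_def) (simp add: rtape_def)
      fix i
      show "shift (?m (Rg i)) ?n (?\<sigma> ?n (Rg i)) = ?s (Rg i)"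
        by (cases "i = 0"; cases "i = 3"; simp add: move1_def; simp add: nstore_def)
    qed (simp_all add: move1_def, simp_all add: nstore_def)
    then show "{\<lambda>y. shift (?m y) ?n (?\<sigma> ?n y)} = {?s}" by simp
  qed (auto simp: move1_def)
  have 3: "runs_to (Drain (Rg 3) (Move ((move1 (Rg 3) (-1))(Rg 0 := 1)))) ?s (2 * ?n + 1) {nstore (rtape l l) ?n 0 0 0 0 []}"
  proof (rule runs_to_eq[OF runs_to_Drain_Move[where n = ?n]])
    let ?m = "(move1 (Rg 3) (-1))(Rg 0 := 1)"
    have "(\<lambda>y. shift (?m y) ?n (?s y)) = nstore (rtape l l) ?n 0 0 0 0 []"
    proof (rule store_eqI)
      fix i
      show "shift (?m (Rg i)) ?n (?s (Rg i)) = nstore (rtape l l) ?n 0 0 0 0 [] (Rg i)"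
        by (cases "i = 0"; cases "i = 3"; simp add: move1_def; simp add: nstore_def)
    qed (simp_all add: move1_def, simp_all add: nstore_def)
    then show "{\<lambda>y. shift (?m y) ?n (?s y)} = {nstore (rtape l l) ?n 0 0 0 0 []}" by simp
  qed (auto simp: move1_def)
  show ?thesis
    unfolding measure_input_def using runs_to_Seq1[OF 1 runs_to_Seq1[OF 2 3]] by (auto intro: runs_to_mono)
qed

text \<open>The value is moved to \<open>Rg 4\<close>, where it becomes the budget for the length of
  \<open>t\<close>.\<close>

definition put_unary :: prog where
  "put_unary = Drain (Rg 1) (put_bit (\<lambda>_. 2) ((move1 (Rg 1) (-1))(Rg 4 := 1)))"

lemma runs_to_put_unary:
  "runs_to put_unary (nstore inp n m 0 0 0 []) (2 * m + 1) {nstore inp n 0 m 0 0 (replicate m True)}"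
proof -
  let ?\<sigma> = "\<lambda>j. nstore inp n (m - j) j 0 0 (replicate j True)"
  have "runs_to put_unary (?\<sigma> 0) (m * (1 + 1) + 1) {?\<sigma> m}"
    unfolding put_unary_def
  proof (rule runs_to_iterate)
    fix j assume j: "j < m"
    have "nat (int (m - j) - 1) = m - Suc j" by simp
    then have "bump ((move1 (Rg 1) (-1))(Rg 4 := 1)) (?\<sigma> j) = nstore inp n (m - Suc j) (Suc j) 0 0 (replicate j True)"
      by (simp add: bump_move2 nstore_upd nat_add_distrib)
    then show "runs_to (put_bit (\<lambda>_. 2) ((move1 (Rg 1) (-1))(Rg 4 := 1))) (?\<sigma> j) 1 {?\<sigma> (Suc j)}"
      using runs_to_put_bit[of "?\<sigma> j" "replicate j True" "\<lambda>_. 2" True "(move1 (Rg 1) (-1))(Rg 4 := 1)"]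
      by (simp only: nstore_simps nstore_upd replicate_append_same replicate_Suc[symmetric]) (simp add: enc_bit_def)
  next
    fix j assume "j \<le> m"
    then show "(\<not> at_zero (Rg 1) (view (?\<sigma> j))) \<longleftrightarrow> j < m" by (auto simp: at_zero_ctr[of _ _ "m - j"])
  qed
  then show ?thesis by (auto intro: runs_to_mono)
qed

lemma runs_to_put_const:
  "runs_to (put_bit (\<lambda>_. enc_bit b) (\<lambda>_. 0)) (nstore inp n a c g f ys) 1 {nstore inp n a c g f (ys @ [b])}"
  using runs_to_put_bit[of "nstore inp n a c g f ys" ys "\<lambda>_. enc_bit b" b "\<lambda>_. 0"] by (simp only: nstore_simps nstore_upd bump_0 refl simp_thms)

definition put_input :: prog where
  "put_input = While (\<lambda>v. v Inp \<noteq> 0) (Seq (put_bit (\<lambda>_. enc_bit True) (\<lambda>_. 0)) (put_bit (\<lambda>v. v Inp) (move1 Inp 1)))"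

lemma double_snoc: "double (w @ [b]) = double w @ [True, b]"
  by (simp add: double_def)

lemma runs_to_put_input:
  fixes w :: "bool list"
  defines "l \<equiv> enc w"
  shows "runs_to put_input (nstore (rtape l l) n 0 c 0 0 ys) (4 * length w + 1) {nstore (rtape l []) n 0 c 0 0 (ys @ double w)}"
proof -
  let ?n = "length w"
  let ?\<sigma> = "\<lambda>j. nstore (rtape l (drop j l)) n 0 c 0 0 (ys @ double (take j w))"
  have "runs_to put_input (?\<sigma> 0) (?n * (1 + 1 + 1 + 1) + 1) {?\<sigma> ?n}"
    unfolding put_input_def
  proof (rule runs_to_iterate)
    fix j assume j: "j < ?n"
    let ?s = "nstore (rtape l (drop j l)) n 0 c 0 0 ((ys @ double (take j w)) @ [True])"
    have "view ?s Inp = enc_bit (w ! j)" using view_input[of ?s w j] j by (simp add: l_def)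
    moreover have "bump (move1 Inp 1) ?s = nstore (rtape l (drop (Suc j) l)) n 0 c 0 0 ((ys @ double (take j w)) @ [True])"
      using turn_input[OF j] by (simp add: bump_move1 nstore_upd l_def)
    ultimately have 2: "runs_to (put_bit (\<lambda>v. v Inp) (move1 Inp 1)) ?s 1
        {nstore (rtape l (drop (Suc j) l)) n 0 c 0 0 (((ys @ double (take j w)) @ [True]) @ [w ! j])}"
      using runs_to_put_bit[of ?s "(ys @ double (take j w)) @ [True]" "\<lambda>v. v Inp" "w ! j" "move1 Inp 1"]
      by (simp only: nstore_simps nstore_upd)
    moreover have "((ys @ double (take j w)) @ [True]) @ [w ! j] = ys @ double (take (Suc j) w)"
      using j by (simp add: take_Suc_conv_app_nth double_snoc)
    ultimately show "runs_to (Seq (put_bit (\<lambda>_. enc_bit True) (\<lambda>_. 0)) (put_bit (\<lambda>v. v Inp) (move1 Inp 1))) (?\<sigma> j) (1 + 1 + 1) {?\<sigma> (Suc j)}"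
      using runs_to_Seq1[OF runs_to_put_const 2] by (simp only:)
  next
    fix j assume j: "j \<le> ?n"
    show "(view (?\<sigma> j) Inp \<noteq> 0) \<longleftrightarrow> j < ?n"
      using view_input[of "?\<sigma> j" w j] j by (simp add: l_def enc_bit_def)
  qed
  moreover have "drop ?n l = []" by (simp add: l_def)
  ultimately show ?thesis by (auto intro: runs_to_mono)
qed

text \<open>The string \<open>t\<close> is guessed straight onto the query tape in doubled form: the
  oracle does all the checking, so the machine itself never reads \<open>t\<close> again.\<close>

definition put_guess :: prog where
  "put_guess = While (\<lambda>v. v (Rg 5) \<noteq> 0) (Cond (at_zero (Rg 4)) Fail
     (Seq (put_bit (\<lambda>_. enc_bit True) (move1 (Rg 4) (-1))) (Seq (put_bit (\<lambda>v. v (Rg 5)) (\<lambda>_. 0)) (guess (Rg 5)))))"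

lemma runs_to_guess_then:
  fixes inp n
  defines "G \<equiv> \<lambda>c g ys. nstore inp n 0 c g 0 ys"
  assumes d: "\<And>g. g \<le> 2 \<Longrightarrow> runs_to d (G c g ys) T (L g)"
  shows "runs_to (Seq (guess (Rg 5)) d) (G c g0 ys) (T + 2) (\<Union>g\<in>{..2}. L g)"
proof -
  have "(G c g0 ys)(Rg 5 := reg g) = G c g ys" for g by (simp add: G_def nstore_upd)
  then have gs: "runs_to (guess (Rg 5)) (G c g0 ys) 1 {G c g ys | g. g \<le> 2}"
    using runs_to_guess[of "G c g0 ys" "Rg 5" g0] by (simp add: G_def)
  from runs_to_Seq_family[OF gs d[unfolded G_def[symmetric]]]
  have "runs_to (Seq (guess (Rg 5)) d) (G c g0 ys) (1 + T + 1) (\<Union>g\<in>{..2}. L g)"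
    by (simp only: atMost_def)
  then show ?thesis by (rule runs_to_mono) simp
qed

lemma runs_to_put_guess:
  fixes inp n
  defines "G \<equiv> \<lambda>c g ys. nstore inp n 0 c g 0 ys"
  shows "g \<le> 2 \<Longrightarrow> runs_to put_guess (G c g ys) (8 * c + 3)
    (if g = 0 then {G c 0 ys} else {G (c - 1 - length v) 0 (ys @ double ((g = 2) # v)) | v. length v + 1 \<le> c})"
proof (induction c arbitrary: g ys)
  case 0
  show ?case
  proof (cases "g = 0")
    case True
    have "runs_to put_guess (G 0 0 ys) 1 {G 0 0 ys}"
      unfolding put_guess_def by (rule runs_to_While_done) (simp add: G_def view_def)
    then show ?thesis using True by (auto intro: runs_to_mono)
  next
    case False
    have "runs_to (Cond (at_zero (Rg 4)) Fail (Seq (put_bit (\<lambda>_. enc_bit True) (move1 (Rg 4) (-1)))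
        (Seq (put_bit (\<lambda>v. v (Rg 5)) (\<lambda>_. 0)) (guess (Rg 5))))) (G 0 g ys) (1 + 1) {}"
      by (rule runs_to_Cond) (use runs_to_Fail at_zero_ctr[of "G 0 g ys" "Rg 4" 0] in \<open>simp add: G_def\<close>)
    then have "runs_to put_guess (G 0 g ys) (1 + 1 + 1) {}"
      unfolding put_guess_def using False by (intro runs_to_While_step0) (simp_all add: G_def view_def)
    then show ?thesis using False by (auto intro: runs_to_mono)
  qed
next
  case (Suc c)
  show ?case
  proof (cases "g = 0")
    case True
    have "runs_to put_guess (G (Suc c) 0 ys) 1 {G (Suc c) 0 ys}"
      unfolding put_guess_def by (rule runs_to_While_done) (simp add: G_def view_def)
    then show ?thesis using True by (auto intro: runs_to_mono)
  next
    case False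
    let ?ys = "(ys @ [True]) @ [g = 2]"
    let ?c = "Cond (at_zero (Rg 4)) Fail (Seq (put_bit (\<lambda>_. enc_bit True) (move1 (Rg 4) (-1)))
        (Seq (put_bit (\<lambda>v. v (Rg 5)) (\<lambda>_. 0)) (guess (Rg 5))))"
    have "bump (move1 (Rg 4) (-1)) (G (Suc c) g ys) = G c g ys" by (simp add: G_def bump_move1 nstore_upd)
    then have 1: "runs_to (put_bit (\<lambda>_. enc_bit True) (move1 (Rg 4) (-1))) (G (Suc c) g ys) 1 {G c g (ys @ [True])}"
      using runs_to_put_bit[of "G (Suc c) g ys" ys "\<lambda>_. enc_bit True" True "move1 (Rg 4) (-1)"]
      unfolding G_def by (simp only: nstore_simps nstore_upd refl simp_thms)
    have "view (G c g (ys @ [True])) (Rg 5) = enc_bit (g = 2)"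
      using False Suc.prems by (auto simp: G_def view_def enc_bit_def)
    then have 2: "runs_to (put_bit (\<lambda>v. v (Rg 5)) (\<lambda>_. 0)) (G c g (ys @ [True])) 1 {G c g ?ys}"
      using runs_to_put_bit[of "G c g (ys @ [True])" "ys @ [True]" "\<lambda>v. v (Rg 5)" "g = 2" "\<lambda>_. 0"]
      unfolding G_def by (simp only: nstore_simps nstore_upd bump_0 refl simp_thms)
    have "(G c g ?ys)(Rg 5 := reg g') = G c g' ?ys" for g' by (simp add: G_def nstore_upd)
    then have gs: "runs_to (guess (Rg 5)) (G c g ?ys) 1 {G c g' ?ys | g'. g' \<le> 2}"
      using runs_to_guess[of "G c g ?ys" "Rg 5" g] by (simp add: G_def)
    have body: "runs_to ?c (G (Suc c) g ys) (1 + (1 + 1 + 1) + 1 + 1) {G c g' ?ys | g'. g' \<le> 2}"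
      by (rule runs_to_Cond) (use runs_to_Seq1[OF 1 runs_to_Seq1[OF 2 gs]] at_zero_ctr[of "G (Suc c) g ys" "Rg 4" "Suc c"] in \<open>simp add: G_def\<close>)
    define H where "H = (\<lambda>v. G (c - length v) 0 (?ys @ double v))"
    define L where "L = (\<lambda>g. if g = 0 then {H []} else {H ((g = (2::nat)) # v) | v. length v + 1 \<le> c})"
    have R: "runs_to put_guess (G (Suc c) g ys) (1 + (1 + 1 + 1) + 1 + 1 + (8 * c + 3) + 1) (\<Union>s'\<in>{G c g' ?ys | g'. g' \<le> 2}. L (scan (s' (Rg 5))))"
      unfolding put_guess_def
    proof (rule runs_to_While_step[OF _ body])
      fix s' assume "s' \<in> {G c g' ?ys | g'. g' \<le> 2}"
      then obtain g' where s': "s' = G c g' ?ys" "g' \<le> 2" by blast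
      have sc: "scan (G c g' ?ys (Rg 5)) = g'" by (simp add: G_def)
      have L: "L g' = (if g' = 0 then {G c 0 ?ys} else {G (c - 1 - length v) 0 (?ys @ double ((g' = 2) # v)) | v. length v + 1 \<le> c})"
        by (simp add: L_def H_def)
      show "runs_to (While (\<lambda>v. v (Rg 5) \<noteq> 0) ?c) s' (8 * c + 3) (L (scan (s' (Rg 5))))"
        unfolding s' sc L by (rule Suc.IH[OF s'(2), unfolded put_guess_def])
    qed (use False in \<open>simp add: G_def view_def\<close>)
    have "{G c g' ?ys | g'. g' \<le> 2} = (\<lambda>g'. G c g' ?ys) ` {..2}" by auto
    then have "(\<Union>s'\<in>{G c g' ?ys | g'. g' \<le> 2}. L (scan (s' (Rg 5)))) = (\<Union>g\<in>{..2}. L g)" by (simp add: G_def)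
    also have "\<dots> = {H v | v. length v \<le> c}" unfolding L_def by (rule guess_union)
    finally show ?thesis using R by (intro runs_to_eq[OF R]) (use False in \<open>simp_all add: H_def\<close>)
  qed
qed

definition guesser :: "nat list \<Rightarrow> prog" where
  "guesser cs = Seq (Upd (\<lambda>v. v(Rg 0 := 1, Rg 1 := 1, Rg 2 := 1, Rg 3 := 1, Rg 4 := 1)) (\<lambda>_. 0))
    (Seq measure_input (Seq (horner cs) (Seq put_unary (Seq (put_bit (\<lambda>_. enc_bit False) (\<lambda>_. 0))
    (Seq put_input (Seq (put_bit (\<lambda>_. enc_bit False) (\<lambda>_. 0)) (Seq (Seq (guess (Rg 5)) put_guess)
      (Seq (put_bit (\<lambda>_. enc_bit False) (\<lambda>_. 0)) (put_bit (\<lambda>_. enc_bit False) (\<lambda>_. 0))))))))))"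

definition guesser_time :: "nat list \<Rightarrow> nat \<Rightarrow> nat" where
  "guesser_time cs n = 10 * n + 60 + horner_time cs n + 10 * poly (Poly cs) n"

lemma runs_to_guesser:
  fixes w :: "bool list" and cs :: "nat list"
  defines "m \<equiv> poly (Poly cs) (length w)"
  shows "runs_to (guesser cs) (init_store (enc w)) (guesser_time cs (length w))
    {nstore (rtape (enc w) []) (length w) 0 (m - length t) 0 0 (pack m w t []) | t. length t \<le> m}"
proof -
  let ?n = "length w"
  let ?l = "enc w"
  let ?s0 = "nstore (rtape ?l ?l) 0 0 0 0 0 []"
  have 1: "runs_to (Upd (\<lambda>v. v(Rg 0 := 1, Rg 1 := 1, Rg 2 := 1, Rg 3 := 1, Rg 4 := 1)) (\<lambda>_. 0)) (init_store ?l) 1 {?s0}"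
  proof (rule runs_to_Upd, rule store_eqI)
    fix i
    show "?s0 (Rg i) = eff (init_store ?l) ((view (init_store ?l))(Rg 0 := 1, Rg 1 := 1, Rg 2 := 1, Rg 3 := 1, Rg 4 := 1)) (\<lambda>_. 0) (Rg i)"
      using upd_reg_ctr by (simp add: nstore_def eff_def view_def init_store_def)
  qed (auto simp: eff_def view_def init_store_def rtape_def nstore_def reg_0 cells_def upd_def scan_def fun_eq_iff)
  note 2 = runs_to_measure_input[of w]
  have 3: "runs_to (horner cs) (nstore (rtape ?l ?l) ?n 0 0 0 0 []) (horner_time cs ?n) {nstore (rtape ?l ?l) ?n m 0 0 0 []}"
    using runs_to_horner[of "nstore (rtape ?l ?l) ?n 0 0 0 0 []" ?n cs] by (simp add: nstore_upd m_def)
  note 4 = runs_to_put_unary[of "rtape ?l ?l" ?n m]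
  let ?p = "replicate m True @ [False]"
  note 5 = runs_to_put_const[of False "rtape ?l ?l" ?n 0 m 0 0 "replicate m True"]
  note 6 = runs_to_put_input[of w ?n m ?p]
  note 7 = runs_to_put_const[of False "rtape ?l []" ?n 0 m 0 0 "?p @ double w"]
  let ?q = "(?p @ double w) @ [False]"
  define H where "H = (\<lambda>t. nstore (rtape ?l []) ?n 0 (m - length t) 0 0 (?q @ double t))"
  have 8: "runs_to (Seq (guess (Rg 5)) put_guess) (nstore (rtape ?l []) ?n 0 m 0 0 ?q) (8 * m + 3 + 2) {H t | t. length t \<le> m}"
  proof -
    have "runs_to (Seq (guess (Rg 5)) put_guess) (nstore (rtape ?l []) ?n 0 m 0 0 ?q) (8 * m + 3 + 2)
       (\<Union>g\<in>{..2::nat}. if g = 0 then {H []} else {H ((g = 2) # v) | v. length v + 1 \<le> m})"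
    proof (rule runs_to_guess_then)
      fix g :: nat assume g: "g \<le> 2"
      have "(if g = 0 then {H []} else {H ((g = 2) # v) | v. length v + 1 \<le> m}) =
        (if g = 0 then {nstore (rtape ?l []) ?n 0 m 0 0 ?q} else {nstore (rtape ?l []) ?n 0 (m - 1 - length v) 0 0 (?q @ double ((g = 2) # v)) | v. length v + 1 \<le> m})"
        by (simp add: H_def)
      then show "runs_to put_guess (nstore (rtape ?l []) ?n 0 m g 0 ?q) (8 * m + 3) (if g = 0 then {H []} else {H ((g = 2) # v) | v. length v + 1 \<le> m})"
        using runs_to_put_guess[OF g, of "rtape ?l []" ?n m ?q] by (simp only:)
    qed
    then show ?thesis unfolding guess_union .
  qed
  have 9: "runs_to (Seq (put_bit (\<lambda>_. enc_bit False) (\<lambda>_. 0)) (put_bit (\<lambda>_. enc_bit False) (\<lambda>_. 0))) (H t) (1 + 1 + 1)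
      {nstore (rtape ?l []) ?n 0 (m - length t) 0 0 (pack m w t [])}" for t
    using runs_to_Seq1[OF runs_to_put_const[of False "rtape ?l []" ?n 0 "m - length t" 0 0 "?q @ double t"] runs_to_put_const[of False]]
    by (simp add: H_def pack_def)
  have 10: "runs_to (Seq (Seq (guess (Rg 5)) put_guess) (Seq (put_bit (\<lambda>_. enc_bit False) (\<lambda>_. 0)) (put_bit (\<lambda>_. enc_bit False) (\<lambda>_. 0))))
      (nstore (rtape ?l []) ?n 0 m 0 0 ?q) (8 * m + 3 + 2 + (1 + 1 + 1) + 1)
      (\<Union>t\<in>{t. length t \<le> m}. {nstore (rtape ?l []) ?n 0 (m - length t) 0 0 (pack m w t [])})"
    by (rule runs_to_Seq_family[OF 8 9])
  have "(\<Union>t\<in>{t. length t \<le> m}. {nstore (rtape ?l []) ?n 0 (m - length t) 0 0 (pack m w t [])}) =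
     {nstore (rtape ?l []) ?n 0 (m - length t) 0 0 (pack m w t []) | t. length t \<le> m}" by blast
  then show ?thesis
    unfolding guesser_def
    by (intro runs_to_eq[OF runs_to_Seq1[OF 1 runs_to_Seq1[OF 2 runs_to_Seq1[OF 3 runs_to_Seq1[OF 4 runs_to_Seq1[OF 5
        runs_to_Seq1[OF 6 runs_to_Seq1[OF 7 10]]]]]]]]) (simp_all add: guesser_time_def m_def)
qed

section \<open>The two queries\<close>

text \<open>The first query is \<open>pack m w t []\<close> and the second one its extension \<open>pack m w t [True]\<close>; the register
  \<open>Rg 6\<close> tells the machine which of the two queries has been answered.\<close>

definition after_yes :: prog where
  "after_yes = Cond (\<lambda>v. v (Rg 6) = 0) (Seq (Write (Rg 6) 1) (put_bit (\<lambda>_. enc_bit True) (\<lambda>_. 0))) Fail"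

definition after_no :: prog where
  "after_no = Cond (\<lambda>v. v (Rg 6) = 1) Skip Fail"

text \<open>The cell behind the word is blank, and this alone delimits the query.\<close>

lemma tape_word_cells: "tape_word (cells (enc ys)) = ys"
proof -
  have "(LEAST n. cells (enc ys) n \<notin> {1, 2}) = length ys"
  proof (rule Least_equality)
    show "cells (enc ys) (length ys) \<notin> {1, 2}" by (simp add: cells_def)
    fix n assume "cells (enc ys) n \<notin> {1, 2}"
    then show "length ys \<le> n" using enc_bit_range[of "ys ! n"] by (rule_tac ccontr) (auto simp: cells_def enc_def)
  qed
  then show ?thesis
    by (simp add: tape_word_def) (rule nth_equalityI, auto simp: cells_def enc_def enc_bit_def)
qed

lemma pack_snoc: "pack m w t [] @ [True] = pack m w t [True]"
  by (simp add: pack_def)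

text \<open>Acceptance requires a yes first, for the existence of \<open>u\<close>, and then a no,
  for the absence of a violating \<open>v\<close>. Any other sequence of answers meets a failing
  test of \<open>Rg 6\<close>, so there is never a third query.\<close>

lemma query_phase:
  fixes inp n a c ys A
  defines "E \<equiv> (A, [after_yes, Ask], [after_no])"
  shows "pacc E ([Ask], nstore inp n a c 0 0 ys) \<longleftrightarrow> ys \<in> A \<and> ys @ [True] \<notin> A"
    and "pbounded E ([Ask], nstore inp n a c 0 0 ys) 10"
proof -
  let ?s = "\<lambda>f ys. nstore inp n a c 0 f ys"
  have st: "pstep E ([Ask], ?s f ys) y \<longleftrightarrow> y = (if ys \<in> A then [after_yes, Ask] else [after_no], ?s f ys)" for f ys y
    by (simp add: pstep_def E_def tape_word_cells)
  have ask: "pacc E ([Ask], ?s f ys) \<longleftrightarrow> pacc E (if ys \<in> A then [after_yes, Ask] else [after_no], ?s f ys)"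
    "pbounded E ([Ask], ?s f ys) (Suc T) \<longleftrightarrow> pbounded E (if ys \<in> A then [after_yes, Ask] else [after_no], ?s f ys) T" for f ys T
    by (subst reaches_unfold, simp add: st) (simp add: bounded_runs_Suc st)
  have v: "view (?s f ys) (Rg 6) = f" for f ys by (simp add: view_def)
  have w: "runs_to (Write (Rg 6) 1) (?s 0 ys) 1 {?s 1 ys}"
    by (rule runs_to_Upd, rule store_eqI; simp add: eff_def view_def; simp add: nstore_def)
  have y0: "runs_to after_yes (?s 0 ys) (1 + 1 + 1 + 1) {?s 1 (ys @ [True])}"
    unfolding after_yes_def by (rule runs_to_Cond) (use runs_to_Seq1[OF w runs_to_put_const] v in simp)
  have y1: "runs_to after_yes (?s 1 ys) (1 + 1) {}" for ys
    unfolding after_yes_def by (rule runs_to_Cond) (use runs_to_Fail v in simp)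
  have n0: "runs_to after_no (?s 0 ys) (1 + 1) {}"
    unfolding after_no_def by (rule runs_to_Cond) (use runs_to_Fail v in simp)
  have n1: "runs_to after_no (?s 1 ys) (1 + 1) {?s 1 ys}" for ys
    unfolding after_no_def by (rule runs_to_Cond) (use runs_to_Skip v in simp)
  have acc: "pacc E ([], s)" for s by (subst reaches_unfold) simp
  have halt: "pbounded E ([], s) 0" for s by (rule bounded_runs_stuck) (simp add: pstep_def)
  have D: "pacc E (d # k, s) \<longleftrightarrow> (\<exists>s'\<in>X. pacc E (k, s'))" if "runs_to d s T X" for d k s T X
    using that unfolding runs_to_def by blast
  have B: "pbounded E (d # k, s) (T + T')" if "runs_to d s T X" "\<And>s'. s' \<in> X \<Longrightarrow> pbounded E (k, s') T'" for d k s T T' X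
    using that unfolding runs_to_def by blast
  have second: "pacc E ([Ask], ?s 1 ys) \<longleftrightarrow> ys \<notin> A" "pbounded E ([Ask], ?s 1 ys) 3" for ys
  proof -
    show "pacc E ([Ask], ?s 1 ys) \<longleftrightarrow> ys \<notin> A"
      unfolding ask(1) using D[OF y1] D[OF n1] acc by simp
    have "pbounded E ([after_yes, Ask], ?s 1 ys) (1 + 1 + 0)" by (rule B[OF y1]) simp
    moreover have "pbounded E ([after_no], ?s 1 ys) (1 + 1 + 0)" by (rule B[OF n1]) (rule halt)
    ultimately have "pbounded E (if ys \<in> A then [after_yes, Ask] else [after_no], ?s 1 ys) (1 + 1 + 0)" by simp
    then have "pbounded E ([Ask], ?s 1 ys) (Suc (1 + 1 + 0))" unfolding ask(2) .
    then show "pbounded E ([Ask], ?s 1 ys) 3" by (rule bounded_runs_mono) simp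
  qed
  show "pacc E ([Ask], ?s 0 ys) \<longleftrightarrow> ys \<in> A \<and> ys @ [True] \<notin> A"
    unfolding ask(1) using D[OF y0, of "[Ask]"] D[OF n0, of "[]"] second(1) by simp
  have "pbounded E (if ys \<in> A then [after_yes, Ask] else [after_no], ?s 0 ys) 7"
  proof (cases "ys \<in> A")
    case True
    have "pbounded E ([after_yes, Ask], ?s 0 ys) (1 + 1 + 1 + 1 + 3)"
      by (rule B[OF y0]) (use second(2) in simp)
    then show ?thesis using True by simp
  next
    case False
    have "pbounded E ([after_no], ?s 0 ys) (1 + 1 + 0)" by (rule B[OF n0]) simp
    then show ?thesis using False by (auto intro: bounded_runs_mono)
  qed
  then have "pbounded E ([Ask], ?s 0 ys) (Suc 7)" unfolding ask(2) .
  then show "pbounded E ([Ask], ?s 0 ys) 10" by (rule bounded_runs_mono) simp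
qed

lemma prog_ok_guesser: "prog_ok 8 (guesser cs)"
proof -
  have v: "v x < n" if "view_ok n v" for v x n using that by (simp add: view_ok_def)
  have pb: "prog_ok 8 (put_bit h m)" if "\<And>v. view_ok 8 v \<Longrightarrow> h v < 8" "moves_ok 8 m" for h m
    using that by (auto simp: put_bit_def intro!: prog_ok_Upd)
  have e: "enc_bit b < 8" for b by (simp add: enc_bit_def)
  have ac: "prog_ok 8 (add_const c)" for c
    by (induction c) (auto simp: move1_def intro!: prog_ok_Upd)
  have ti: "prog_ok 8 times_input_length"
    by (auto simp: times_input_length_def add_input_length_def move1_def intro!: prog_ok_Upd)
  have ho: "prog_ok 8 (horner cs)" by (induction cs) (auto simp: ac ti intro!: prog_ok_Upd)
  have g: "prog_ok 8 (guess (Rg 5))" by (auto simp: guess_def act_ok_def)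
  show ?thesis
    using v pb e ho g
    by (auto simp: guesser_def measure_input_def put_unary_def put_input_def put_guess_def move1_def intro!: prog_ok_Upd)
qed

lemma prog_ok_after: "prog_ok 8 after_yes" "prog_ok 8 after_no"
  by (auto simp: after_yes_def after_no_def put_bit_def enc_bit_def intro!: prog_ok_Upd)

text \<open>\<open>M1\<close> decides \<open>R\<close> and \<open>M2\<close> decides the negation of
  \<open>S\<close>, so both questions put to the oracle are existential and fit into one language in
  NEXP; the universal condition becomes the demand for a negative answer.\<close>

lemma in_NP_NEXP_of_predicates:
  fixes p :: "nat poly"
  assumes R: "polytime_pred3 R" and S: "polytime_pred3 S"
    and L: "\<And>w. w \<in> L \<longleftrightarrow>
          (\<exists>t. length t \<le> poly p (length w) \<and>
             ((\<exists>u. length u \<le> 2 ^ poly p (length w) \<and> R w t u) \<and>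
              (\<forall>v. length v \<le> 2 ^ poly p (length w) \<longrightarrow> S w t v)))"
  shows "in_NP_NEXP L"
proof -
  obtain M1 and r1 :: "nat poly" where M1: "wf_tm M1"
    "\<And>w t u. time_bounded M1 {} (enc3 w t u) (poly r1 (length w + length t + length u))"
    "\<And>w t u. R w t u \<longleftrightarrow> accepts M1 {} (enc3 w t u)"
    using R unfolding polytime_pred3_def by blast
  obtain M2 and r2 :: "nat poly" where M2: "wf_tm M2"
    "\<And>w t u. time_bounded M2 {} (enc3 w t u) (poly r2 (length w + length t + length u))"
    "\<And>w t u. \<not> S w t u \<longleftrightarrow> accepts M2 {} (enc3 w t u)"
    using polytime_pred3_not[OF S] unfolding polytime_pred3_def by blast
  obtain A where A: "in_NEXP A"
    "\<And>m w t r. pack m w t r \<in> A \<longleftrightarrow> (\<exists>v. length v \<le> 2 ^ m \<and> accepts (if flag r = 1 then M2 else M1) {} (enc3 w t v))"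
    by (rule search_in_NEXP[OF M1(1) M2(1) M1(2) M2(2)], rule that)
  have A1: "pack m w t [] \<in> A \<longleftrightarrow> (\<exists>v. length v \<le> 2 ^ m \<and> R w t v)" for m w t
    unfolding A(2) M1(3) by (simp add: flag_def)
  have A2: "pack m w t [True] \<in> A \<longleftrightarrow> (\<exists>v. length v \<le> 2 ^ m \<and> \<not> S w t v)" for m w t
    unfolding A(2) M2(3) by (simp add: flag_def)
  have "(8::nat) \<ge> 4" by simp
  then obtain V where V: "wf_tm V"
    "\<And>Ob inp. set inp \<subseteq> {..<4} \<Longrightarrow> accepts V Ob inp \<longleftrightarrow> pacc (Ob, [after_yes, Ask], [after_no]) ([guesser (coeffs p), Ask], init_store inp)"
    "\<And>Ob inp T. set inp \<subseteq> {..<4} \<Longrightarrow> time_bounded V Ob inp T \<longleftrightarrow> pbounded (Ob, [after_yes, Ask], [after_no]) ([guesser (coeffs p), Ask], init_store inp) T"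
    using compile_oracle[OF _ prog_ok_guesser prog_ok_after] by metis
  let ?E = "(A, [after_yes, Ask], [after_no])"
  have "poly_bounded (poly p)" unfolding poly_bounded_def by blast
  then have "poly_bounded (\<lambda>n. guesser_time (coeffs p) n + 10)"
    unfolding guesser_time_def by (intro poly_bounded_intros poly_bounded_horner_time) simp_all
  then obtain q where q: "\<And>n. guesser_time (coeffs p) n + 10 \<le> poly q n" unfolding poly_bounded_def by blast
  have "time_bounded V A (enc w) (poly q (length w)) \<and> (w \<in> L \<longleftrightarrow> accepts V A (enc w))" for w
  proof -
    let ?m = "poly p (length w)"
    have "runs_to (guesser (coeffs p)) (init_store (enc w)) (guesser_time (coeffs p) (length w))
      {nstore (rtape (enc w) []) (length w) 0 (?m - length t) 0 0 (pack ?m w t []) | t. length t \<le> ?m}" (is "runs_to _ _ ?T ?X")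
      using runs_to_guesser[of "coeffs p" w] by simp
    then have g: "pacc ?E ([guesser (coeffs p), Ask], init_store (enc w)) \<longleftrightarrow> (\<exists>s'\<in>?X. pacc ?E ([Ask], s'))"
      "(\<forall>s'\<in>?X. pbounded ?E ([Ask], s') 10) \<Longrightarrow> pbounded ?E ([guesser (coeffs p), Ask], init_store (enc w)) (?T + 10)"
      unfolding runs_to_def by blast+
    have "pbounded ?E ([guesser (coeffs p), Ask], init_store (enc w)) (?T + 10)"
      by (rule g(2)) (use query_phase(2) in blast)
    then have t: "time_bounded V A (enc w) (poly q (length w))"
      unfolding V(3)[OF set_enc] by (rule bounded_runs_mono[OF _ q])
    have "accepts V A (enc w) \<longleftrightarrow> (\<exists>t. length t \<le> ?m \<and> pack ?m w t [] \<in> A \<and> pack ?m w t [True] \<notin> A)"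
      unfolding V(2)[OF set_enc] g(1) using query_phase(1)[where A = A] by (auto simp: pack_snoc)
    also have "\<dots> \<longleftrightarrow> w \<in> L" unfolding L A1 A2 by auto
    finally show ?thesis using t by blast
  qed
  then show ?thesis unfolding in_NP_NEXP_def using A(1) V(1) by blast
qed

theorem mainTheorem15:
  fixes L :: "bool list set"
  shows "in_NP_NEXP L \<longleftrightarrow>
    (\<exists>(p :: nat poly) R S. polytime_pred3 R \<and> polytime_pred3 S \<and>
       (\<forall>w. w \<in> L \<longleftrightarrow>
          (\<exists>t. length t \<le> poly p (length w) \<and>
             ((\<exists>u. length u \<le> 2 ^ poly p (length w) \<and> R w t u) \<and>
              (\<forall>v. length v \<le> 2 ^ poly p (length w) \<longrightarrow> S w t v)))))"
    (is "_ \<longleftrightarrow> ?P")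
proof
  show "in_NP_NEXP L \<Longrightarrow> ?P" by (rule predicates_of_in_NP_NEXP)
  show "?P \<Longrightarrow> in_NP_NEXP L" by (elim exE conjE) (rule in_NP_NEXP_of_predicates, assumption, assumption, erule spec)
qed

end
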